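(* Let $B$ be a factorial affine domain of dimension two over $\mathbb{C}$. Assume that $B^*=\mathbb{C}^*$ and that $B$ has a surjective $\mathbb{C}$-derivation $D$ with $\operatorname{Ker} D\supsetneqq\mathbb{C}$. Then $B$ is isomorphic as a $\mathbb{C}$-algebra to a polynomial ring $\mathbb{C}[x,y]$ in such a way that $D$ corresponds to the partial derivation $\partial/\partial x$.
   Context: An affine domain over $\mathbb{C}$ is a finitely generated $\mathbb{C}$-algebra that is an integral domain; factorial means unique factorization domain; $B^*$ is the group of units of $B$. A $\mathbb{C}$-derivation $D$ of $B$ is surjective if it is surjective as a map $B\to B$. *)

theory Defs
  imports
    "HOL-Algebra.Algebraic_Closure_Type"
    "HOL-Library.Extended_Nat"
    Complex_Main
begin

text \<open>
  A commutative ring is a type of class \<^class>\<open>comm_ring_1\<close>; \<^const>\<open>ring_of_type_algebra\<close>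
  turns it into a HOL-Algebra ring, so that the notions of HOL-Algebra apply to it.
\<close>

locale complex_algebra = vector_space scale
  for scale :: "complex \<Rightarrow> 'b::comm_ring_1 \<Rightarrow> 'b" +
  assumes scale_mult: "scale c (a * b) = scale c a * b"
begin

definition constants :: "'b set" where
  "constants = range (\<lambda>c. scale c 1)"

definition subalgebra :: "'b set \<Rightarrow> bool" where
  "subalgebra A \<longleftrightarrow> subspace A \<and> 1 \<in> A \<and> (\<forall>a\<in>A. \<forall>b\<in>A. a * b \<in> A)"

definition finitely_generated :: bool where
  "finitely_generated \<longleftrightarrow> (\<exists>S. finite S \<and> subalgebra hull S = UNIV)"

definition derivation :: "('b \<Rightarrow> 'b) \<Rightarrow> bool" where
  "derivation D \<longleftrightarrow>
     Vector_Spaces.linear scale scale D \<and> (\<forall>a b. D (a * b) = D a * b + a * D b)"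

end

definition algebra_iso ::
  "(complex \<Rightarrow> 'a::comm_ring_1 \<Rightarrow> 'a) \<Rightarrow> (complex \<Rightarrow> 'b::comm_ring_1 \<Rightarrow> 'b) \<Rightarrow> ('a \<Rightarrow> 'b) \<Rightarrow> bool"
where
  "algebra_iso s t f \<longleftrightarrow>
     Vector_Spaces.linear s t f \<and> f 1 = 1 \<and> (\<forall>a b. f (a * b) = f a * f b) \<and> bij f"

definition krull_dim :: "('a, 'm) ring_scheme \<Rightarrow> enat" where
  "krull_dim R =
     (SUP n \<in> {n. \<exists>P. (\<forall>i\<le>n. primeideal (P i) R) \<and> (\<forall>i<n. P i \<subset> P (Suc i))}. enat n)"

text \<open>
  The polynomial ring in \<open>x\<close>, \<open>y\<close> over the complex numbers is rendered as
  \<^typ>\<open>complex poly poly\<close>: the outer variable is \<open>x\<close>, the inner one is \<open>y\<close>.  Hence the partial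
  derivative with respect to \<open>x\<close> is \<^term>\<open>pderiv :: complex poly poly \<Rightarrow> complex poly poly\<close>.
\<close>

definition scale_xy :: "complex \<Rightarrow> complex poly poly \<Rightarrow> complex poly poly" where
  "scale_xy c p = Polynomial.smult [:c:] p"

lemma complex_algebra_xy: "complex_algebra scale_xy"
proof
  fix a b :: complex and p q :: "complex poly poly"
  show "scale_xy a (p + q) = scale_xy a p + scale_xy a q"
    by (simp add: scale_xy_def Polynomial.smult_add_right)
  show "scale_xy (a + b) p = scale_xy a p + scale_xy b p"
    by (simp add: scale_xy_def flip: Polynomial.smult_add_left)
  show "scale_xy a (scale_xy b p) = scale_xy (a * b) p"
    by (simp add: scale_xy_def mult.commute)
  show "scale_xy 1 p = p"
    by (simp add: scale_xy_def pCons_one)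
  show "scale_xy a (p * q) = scale_xy a p * q"
    by (simp add: scale_xy_def)
qed

lemma derivation_pderiv_xy: "complex_algebra.derivation scale_xy pderiv"
proof -
  interpret complex_algebra scale_xy by (rule complex_algebra_xy)
  show ?thesis
    unfolding derivation_def
    by (auto simp: pderiv_mult algebra_simps pderiv_add pderiv_smult scale_xy_def
             intro!: Vector_Spaces.linear.intro module_hom.intro module_hom_axioms.intro
                     vector_space_axioms module_axioms)
qed

lemma pderiv_xy_x: "pderiv [:0, 1 :: complex poly:] = 1"
  and pderiv_xy_y: "pderiv [:[:0, 1 :: complex:]:] = 0"
  by (simp_all add: pderiv_pCons)

end

theory Submission
  imports Defs "HOL-Complex_Analysis.Complex_Analysis"
begin

text \<open>
  Write \<open>A\<close> for the kernel of \<open>D\<close>.  As \<open>D\<close> is surjective there is \<open>x\<close> with \<open>D x = 1\<close>, and \<open>A\<close>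
  contains a non-constant \<open>a\<close>.  The theorem says that \<open>B = A[x]\<close> and that \<open>A\<close> is a polynomial ring
  in one variable.  The first claim amounts to \<open>D\<close> being locally nilpotent, because then every
  element is a polynomial in \<open>x\<close> over \<open>A\<close>, by repeated integration.

  \<^emph>\<open>Dimension.\<close>  A homomorphism from a subring \<open>S\<close> into an algebraically closed field extends to a
  finitely generated domain over \<open>S\<close> as soon as it does not kill a certain nonzero element of \<open>S\<close>
  (\<open>extend_hom_adjoins\<close>).  For \<open>S = \<complex>\<close> this is the Nullstellensatz (\<open>separating_point\<close>).  Three
  algebraically independent elements of \<open>B\<close> can be specialised to constants one after the other,
  which gives a chain of four prime ideals (\<open>three_independent_krull_dim\<close>).  As \<open>x\<close> is
  transcendental over \<open>A\<close>, it follows that \<open>B\<close> is algebraic over \<open>\<complex>(a, x)\<close> and that any two elements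
  of \<open>A\<close> are algebraically dependent over \<open>\<complex>\<close>.

  \<^emph>\<open>Local nilpotency.\<close>  Let \<open>k = \<complex>(a)\<close>.  The field of fractions \<open>L\<close> of \<open>B\<close> is finite over \<open>k(x)\<close>,
  and \<open>D\<close> extends \<open>d/dx\<close>.  The trace from \<open>L\<close> to \<open>k(x)\<close> commutes with derivation (\<open>tr_d\<close>).  Let
  \<open>R\<close> be \<open>B\<close> with the nonzero elements of \<open>\<complex>[a]\<close> inverted.  Since \<open>D\<close> is surjective on \<open>R\<close>, all
  elements of the \<open>k[x]\<close>-module \<open>tr R\<close> are derivatives of rational functions.  A derivative has no
  simple poles, and a module with a pole contains elements with a simple pole, so \<open>tr R\<close> lies in
  \<open>k[x]\<close> (\<open>exact_module_is_polynomial\<close>).  As the trace form is nondegenerate, \<open>R\<close> embeds into a free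
  \<open>k[x]\<close>-module of finite rank, which is noetherian.  Hence, for \<open>f \<in> B\<close>, both the sequence of the
  powers of \<open>f\<close> and the sequence of the \<open>D\<^sup>j f\<close> satisfy a monic relation over \<open>k[x]\<close>
  (\<open>monic_relation\<close>).  Let \<open>\<pi> : B \<rightarrow> \<complex>\<close> be a point at which the denominators do not vanish.  The
  Taylor series \<open>\<Sum> \<pi> (D\<^sup>k f) z\<^sup>k / k!\<close> solves a linear differential equation with polynomial
  coefficients and constant leading coefficient, so it is entire; it is integral over \<open>\<complex>[z]\<close>, so it has
  polynomial growth; hence it is a polynomial, by Liouville, of degree bounded independently of \<open>\<pi>\<close>
  (\<open>integral_ode_vanishing\<close>).  So some \<open>D\<^sup>k f\<close> vanishes at all these points, and it is zero.

  \<^emph>\<open>The kernel.\<close>  A factor of a nonzero element of \<open>A\<close> lies in \<open>A\<close>.  Thus \<open>A\<close> is the coordinate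
  ring of an affine curve with constant units in which all points are zero sets of prime elements.
  These primes are uncountable in number, whereas the curve has finitely many places at infinity
  (\<open>finite_places\<close>) and there are only countably many possible orders there.  Hence two
  non-associate primes \<open>f\<close>, \<open>g\<close> have the same orders at infinity (\<open>equal_order_primes\<close>).  The
  function \<open>f / g\<close> has a single simple pole on the complete curve, so it is a coordinate on a
  projective line; this is made precise by \<open>pole_reduction\<close>, and \<open>affine_curve_is_line\<close> deduces that
  \<open>A = \<complex>[g]\<close>.
\<close>

section \<open>Extending homomorphisms along finitely generated extensions\<close>

definition is_subring :: "'a::comm_ring_1 set \<Rightarrow> bool" where
  "is_subring S \<longleftrightarrow> 1 \<in> S \<and> (\<forall>a\<in>S. \<forall>b\<in>S. a - b \<in> S \<and> a * b \<in> S)"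

text \<open>
  Subrings are sets, and a homomorphism on a subring is a total function of which only the values on
  that set matter.  This makes it possible to extend homomorphisms step by step without changing types.
\<close>

definition ring_hom_on :: "'a::comm_ring_1 set \<Rightarrow> ('a \<Rightarrow> 'k::comm_ring_1) \<Rightarrow> bool" where
  "ring_hom_on S \<phi> \<longleftrightarrow>
     \<phi> 1 = 1 \<and> (\<forall>a\<in>S. \<forall>b\<in>S. \<phi> (a + b) = \<phi> a + \<phi> b \<and> \<phi> (a * b) = \<phi> a * \<phi> b)"

definition polys_over :: "'a::comm_ring_1 set \<Rightarrow> 'a poly set" where
  "polys_over S = {p. \<forall>i. poly.coeff p i \<in> S}"

definition adjoin :: "'a::comm_ring_1 set \<Rightarrow> 'a \<Rightarrow> 'a set" where
  "adjoin S g = (\<lambda>p. poly p g) ` polys_over S"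

definition transcendental :: "'a::comm_ring_1 set \<Rightarrow> 'a \<Rightarrow> bool" where
  "transcendental S t \<longleftrightarrow> (\<forall>p \<in> polys_over S. poly p t = 0 \<longrightarrow> p = 0)"

lemma subring_closed:
  assumes "is_subring S"
  shows subring_0: "0 \<in> S" and subring_1: "1 \<in> S"
    and subring_uminus: "a \<in> S \<Longrightarrow> - a \<in> S"
    and subring_add: "a \<in> S \<Longrightarrow> b \<in> S \<Longrightarrow> a + b \<in> S"
    and subring_diff: "a \<in> S \<Longrightarrow> b \<in> S \<Longrightarrow> a - b \<in> S"
    and subring_mult: "a \<in> S \<Longrightarrow> b \<in> S \<Longrightarrow> a * b \<in> S"
    and subring_power: "a \<in> S \<Longrightarrow> a ^ n \<in> S"
    and subring_sum: "(\<And>i. i \<in> I \<Longrightarrow> f i \<in> S) \<Longrightarrow> sum f I \<in> S"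
    and subring_prod: "(\<And>i. i \<in> I \<Longrightarrow> f i \<in> S) \<Longrightarrow> prod f I \<in> S"
proof -
  show 1: "1 \<in> S" and d: "\<And>a b. a \<in> S \<Longrightarrow> b \<in> S \<Longrightarrow> a - b \<in> S"
    and m: "\<And>a b. a \<in> S \<Longrightarrow> b \<in> S \<Longrightarrow> a * b \<in> S"
    using assms by (auto simp: is_subring_def)
  show z: "0 \<in> S" using d[OF 1 1] by simp
  show u: "- a \<in> S" if "a \<in> S" for a using d[OF z that] by simp
  show p: "a + b \<in> S" if "a \<in> S" "b \<in> S" for a b using d[OF that(1) u[OF that(2)]] by simp
  show "a ^ n \<in> S" if "a \<in> S" by (induct n) (use 1 m that in auto)
  show "sum f I \<in> S" if "\<And>i. i \<in> I \<Longrightarrow> f i \<in> S"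
    using that by (induct I rule: infinite_finite_induct) (use z p in auto)
  show "prod f I \<in> S" if "\<And>i. i \<in> I \<Longrightarrow> f i \<in> S"
    using that by (induct I rule: infinite_finite_induct) (use 1 m in auto)
qed

lemma subring_UNIV: "is_subring UNIV" by (simp add: is_subring_def)

lemma polys_over_coeff: "p \<in> polys_over S \<Longrightarrow> poly.coeff p i \<in> S"
  by (simp add: polys_over_def)

lemma subring_poly:
  assumes "is_subring R" "p \<in> polys_over R" "g \<in> R"
  shows "poly p g \<in> R"
  unfolding poly_altdef using assms
  by (intro subring_sum subring_mult subring_power) (auto simp: polys_over_def)

lemma polys_over_mono: "S \<subseteq> R \<Longrightarrow> polys_over S \<subseteq> polys_over R"
  by (auto simp: polys_over_def)

lemma polys_over_closed:
  assumes S: "is_subring S"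
  shows "is_subring (polys_over S)"
    and "c \<in> S \<Longrightarrow> [:c:] \<in> polys_over S" and "c \<in> S \<Longrightarrow> monom c n \<in> polys_over S"
    and "c \<in> S \<Longrightarrow> p \<in> polys_over S \<Longrightarrow> pCons c p \<in> polys_over S"
    and "c \<in> S \<Longrightarrow> p \<in> polys_over S \<Longrightarrow> Polynomial.smult c p \<in> polys_over S"
  using S unfolding is_subring_def[of "polys_over S"]
  by (auto simp: polys_over_def coeff_mult coeff_pCons subring_closed split: nat.splits
           intro!: subring_sum subring_mult)

lemma adjoin_subring:
  assumes S: "is_subring S"
  shows "is_subring (adjoin S g)" and "S \<subseteq> adjoin S g" and "g \<in> adjoin S g"
proof -
  note P = polys_over_closed[OF S]
  have "1 \<in> adjoin S g" unfolding adjoin_def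
    by (rule image_eqI[of _ _ 1]) (use P(1) in \<open>auto simp: subring_closed\<close>)
  moreover have "a - b \<in> adjoin S g \<and> a * b \<in> adjoin S g" if ab: "a \<in> adjoin S g" "b \<in> adjoin S g" for a b
  proof -
    obtain p q where pq: "p \<in> polys_over S" "q \<in> polys_over S" "a = poly p g" "b = poly q g"
      using ab unfolding adjoin_def by blast
    have "a - b = poly (p - q) g" "a * b = poly (p * q) g" using pq by auto
    moreover have "p - q \<in> polys_over S" "p * q \<in> polys_over S"
      using pq P(1) by (auto simp: subring_closed)
    ultimately show ?thesis unfolding adjoin_def by (metis imageI)
  qed
  ultimately show "is_subring (adjoin S g)" by (simp add: is_subring_def)
  show "S \<subseteq> adjoin S g"
  proof
    fix c assume "c \<in> S"
    thus "c \<in> adjoin S g" unfolding adjoin_def by (intro image_eqI[of _ _ "[:c:]"] P) auto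
  qed
  show "g \<in> adjoin S g" unfolding adjoin_def
    by (rule image_eqI[of _ _ "[:0, 1:]"]) (auto intro!: P simp: subring_closed[OF S])
qed

lemma adjoin_least: "is_subring R \<Longrightarrow> S \<subseteq> R \<Longrightarrow> g \<in> R \<Longrightarrow> adjoin S g \<subseteq> R"
  unfolding adjoin_def using subring_poly polys_over_mono by blast

lemma hom_on_closed:
  assumes "ring_hom_on S \<phi>" "is_subring S"
  shows hom_on_0: "\<phi> 0 = 0" and hom_on_1: "\<phi> 1 = 1"
    and hom_on_add: "a \<in> S \<Longrightarrow> b \<in> S \<Longrightarrow> \<phi> (a + b) = \<phi> a + \<phi> b"
    and hom_on_mult: "a \<in> S \<Longrightarrow> b \<in> S \<Longrightarrow> \<phi> (a * b) = \<phi> a * \<phi> b"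
    and hom_on_uminus: "a \<in> S \<Longrightarrow> \<phi> (- a) = - \<phi> a"
    and hom_on_diff: "a \<in> S \<Longrightarrow> b \<in> S \<Longrightarrow> \<phi> (a - b) = \<phi> a - \<phi> b"
    and hom_on_power: "a \<in> S \<Longrightarrow> \<phi> (a ^ n) = \<phi> a ^ n"
    and hom_on_sum: "(\<And>i. i \<in> I \<Longrightarrow> f i \<in> S) \<Longrightarrow> \<phi> (sum f I) = (\<Sum>i\<in>I. \<phi> (f i))"
proof -
  note c = subring_closed[OF assms(2)]
  show 1: "\<phi> 1 = 1" and p: "\<And>a b. a \<in> S \<Longrightarrow> b \<in> S \<Longrightarrow> \<phi> (a + b) = \<phi> a + \<phi> b"
    and m: "\<And>a b. a \<in> S \<Longrightarrow> b \<in> S \<Longrightarrow> \<phi> (a * b) = \<phi> a * \<phi> b"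
    using assms by (auto simp: ring_hom_on_def)
  show z: "\<phi> 0 = 0" using p[of 0 0] c(1) by simp
  show u: "\<phi> (- a) = - \<phi> a" if "a \<in> S" for a
    using p[OF that c(3)[OF that]] z by (simp add: add_eq_0_iff)
  show "\<phi> (a - b) = \<phi> a - \<phi> b" if "a \<in> S" "b \<in> S" for a b
    using p[OF that(1) c(3)[OF that(2)]] u[OF that(2)] by simp
  show "\<phi> (a ^ n) = \<phi> a ^ n" if "a \<in> S" by (induct n) (use 1 m that c in auto)
  show "\<phi> (sum f I) = (\<Sum>i\<in>I. \<phi> (f i))" if "\<And>i. i \<in> I \<Longrightarrow> f i \<in> S"
    using that
  proof (induct I rule: infinite_finite_induct)
    case (insert i I)
    have "\<phi> (f i + sum f I) = \<phi> (f i) + \<phi> (sum f I)" using insert by (intro p c) auto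
    thus ?case using insert by simp
  qed (use z in auto)
qed

lemma map_poly_hom_on:
  assumes h: "ring_hom_on S \<phi>" and S: "is_subring S"
    and p: "p \<in> polys_over S" and q: "q \<in> polys_over S"
  shows "map_poly \<phi> (p + q) = map_poly \<phi> p + map_poly \<phi> q"
    and "map_poly \<phi> (p * q) = map_poly \<phi> p * map_poly \<phi> q"
    and "c \<in> S \<Longrightarrow> map_poly \<phi> (Polynomial.smult c p) = Polynomial.smult (\<phi> c) (map_poly \<phi> p)"
  using p q hom_on_0[OF h S]
  by (auto intro!: poly_eqI simp: coeff_map_poly coeff_mult polys_over_def hom_on_closed[OF h S]
      subring_closed[OF S])

text \<open>
  Prescribing the value \<open>w\<close> at \<open>g\<close> is consistent exactly when every relation satisfied by \<open>g\<close> over \<open>S\<close>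
  is satisfied by \<open>w\<close> after applying \<open>\<phi>\<close>.
\<close>

lemma extend_hom_eval:
  assumes h: "ring_hom_on S \<phi>" and S: "is_subring S"
    and w: "\<And>p. p \<in> polys_over S \<Longrightarrow> poly p g = 0 \<Longrightarrow> poly (map_poly \<phi> p) w = 0"
  obtains \<psi> where "ring_hom_on (adjoin S g) \<psi>" "\<And>a. a \<in> S \<Longrightarrow> \<psi> a = \<phi> a" "\<psi> g = w"
    "\<And>p. p \<in> polys_over S \<Longrightarrow> \<psi> (poly p g) = poly (map_poly \<phi> p) w"
proof -
  note P = polys_over_closed[OF S] and h0 = hom_on_0[OF h S]
  define \<psi> where "\<psi> v = poly (map_poly \<phi> (SOME p. p \<in> polys_over S \<and> poly p g = v)) w" for v
  have ev: "\<psi> (poly p g) = poly (map_poly \<phi> p) w" if p: "p \<in> polys_over S" for p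
  proof -
    define q where "q = (SOME q. q \<in> polys_over S \<and> poly q g = poly p g)"
    have q: "q \<in> polys_over S \<and> poly q g = poly p g"
      unfolding q_def by (rule someI[of _ p]) (use p in auto)
    have m: "q - p \<in> polys_over S" using p q P(1) by (auto simp: subring_closed)
    hence "poly (map_poly \<phi> (q - p)) w = 0" using w q by simp
    moreover have "map_poly \<phi> q = map_poly \<phi> (q - p) + map_poly \<phi> p"
      using map_poly_hom_on(1)[OF h S m p] by simp
    ultimately show ?thesis unfolding \<psi>_def q_def[symmetric] by simp
  qed
  have "ring_hom_on (adjoin S g) \<psi>"
    unfolding ring_hom_on_def adjoin_def
  proof (intro conjI ballI; (elim imageE)?)
    have "\<psi> (poly [:1:] g) = poly (map_poly \<phi> [:1:]) w" using S by (intro ev P) (auto simp: subring_closed)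
    thus "\<psi> 1 = 1" using hom_on_1[OF h S] by (simp add: map_poly_pCons h0)
    fix a b p q assume "a = poly p g" "b = poly q g" "p \<in> polys_over S" "q \<in> polys_over S"
    moreover from this have "p + q \<in> polys_over S" "p * q \<in> polys_over S" using P(1) by (auto simp: subring_closed)
    ultimately show "\<psi> (a + b) = \<psi> a + \<psi> b" "\<psi> (a * b) = \<psi> a * \<psi> b"
      using ev[of "p + q"] ev[of "p * q"] ev[of p] ev[of q] map_poly_hom_on[OF h S, of p q] by auto
  qed
  moreover have "\<psi> a = \<phi> a" if "a \<in> S" for a
    using ev[OF P(2)[OF that]] by (simp add: map_poly_pCons h0)
  moreover have "\<psi> g = w"
    using ev[of "[:0, 1:]"] P(2)[of 1] P(4)[of 0 "[:1:]"] S
    by (simp add: map_poly_pCons h0 hom_on_1[OF h S] subring_closed)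
  ultimately show ?thesis using that ev by blast
qed

text \<open>
  Division with remainder without leaving the subring: the price is a power of the leading
  coefficient of the divisor.
\<close>

lemma pseudo_division_over:
  fixes p q :: "'a::idom poly"
  assumes S: "is_subring S" and p: "p \<in> polys_over S" "p \<noteq> 0" and q: "q \<in> polys_over S"
  shows "\<exists>k. \<exists>h \<in> polys_over S. \<exists>r \<in> polys_over S.
    Polynomial.smult (Polynomial.lead_coeff p ^ k) q = p * h + r \<and> (r = 0 \<or> Polynomial.degree r < Polynomial.degree p)"
  using q
proof (induct "Polynomial.degree q" arbitrary: q rule: less_induct)
  case less
  note P = polys_over_closed[OF S]
  note PC = subring_closed[OF P(1)]
  let ?c = "Polynomial.lead_coeff p"
  show ?case
  proof (cases "q = 0 \<or> Polynomial.degree q < Polynomial.degree p")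
    case True
    thus ?thesis using less.prems PC(1) by (intro exI[of _ 0] bexI[of _ 0] bexI[of _ q]) auto
  next
    case False
    hence q0: "q \<noteq> 0" and dle: "Polynomial.degree p \<le> Polynomial.degree q" by auto
    let ?m = "monom (Polynomial.lead_coeff q) (Polynomial.degree q - Polynomial.degree p)"
    define q' where "q' = Polynomial.smult ?c q - p * ?m"
    have cS: "?c \<in> S" "Polynomial.lead_coeff q \<in> S" using p less.prems by (auto simp: polys_over_def)
    have m: "?m \<in> polys_over S" by (rule P(3)) (use cS in auto)
    have q': "q' \<in> polys_over S" unfolding q'_def using p less.prems m cS by (intro PC P) auto
    have "q' = 0 \<or> Polynomial.degree q' < Polynomial.degree q"
    proof (rule ccontr)
      assume a: "\<not> ?thesis"
      have dle': "Polynomial.degree q' \<le> Polynomial.degree q" unfolding q'_def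
        by (rule degree_diff_le) (use p(2) q0 dle in \<open>auto simp: degree_mult_eq degree_monom_eq\<close>)
      moreover have "poly.coeff q' (Polynomial.degree q) = 0"
        using coeff_mult_degree_sum[of p ?m] q0 dle
        by (simp add: q'_def degree_monom_eq)
      ultimately show False using a
        by (metis leading_coeff_0_iff le_neq_implies_less)
    qed
    thus ?thesis
    proof
      assume "q' = 0"
      thus ?thesis using m PC(1) by (intro exI[of _ 1] bexI[of _ ?m] bexI[of _ 0]) (auto simp: q'_def)
    next
      assume "Polynomial.degree q' < Polynomial.degree q"
      from less.hyps[OF this q'] obtain k h r where *: "h \<in> polys_over S" "r \<in> polys_over S"
        "Polynomial.smult (?c ^ k) q' = p * h + r" "r = 0 \<or> Polynomial.degree r < Polynomial.degree p" by blast
      have "Polynomial.smult (?c ^ Suc k) q = p * (h + Polynomial.smult (?c ^ k) ?m) + r"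
      proof -
        have "Polynomial.smult (?c ^ Suc k) q = Polynomial.smult (?c ^ k) (q' + p * ?m)"
          by (simp add: q'_def ac_simps)
        thus ?thesis using *(3) by (simp add: smult_add_right algebra_simps)
      qed
      moreover have "h + Polynomial.smult (?c ^ k) ?m \<in> polys_over S"
        using *(1) m cS S by (intro PC(4) P(5) subring_power) auto
      ultimately show ?thesis using *(2,4) by blast
    qed
  qed
qed

text \<open>
  If \<open>g\<close> is transcendental over \<open>S\<close>, its image is free, and it has to avoid the roots of one polynomial,
  which is nonzero if \<open>\<phi>\<close> does not kill the leading coefficient of \<open>b\<close>.  If \<open>g\<close> is algebraic, its image
  has to be a root of \<open>\<phi> p\<close> for a polynomial \<open>p\<close> of least degree with \<open>p(g) = 0\<close>.  By pseudo-division
  any root is consistent if \<open>\<phi>\<close> does not kill the leading coefficient of \<open>p\<close>.  Moreover some multiple of \<open>b\<close> is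
  a nonzero element of \<open>S\<close>, so that it suffices not to kill that element.
\<close>

lemma extend_hom_adjoin:
  fixes S :: "'a::idom set"
  assumes S: "is_subring S" and b: "b \<in> adjoin S g" "b \<noteq> 0"
  shows "\<exists>s\<in>S. s \<noteq> 0 \<and> (\<forall>\<phi> :: 'a \<Rightarrow> 'k::alg_closed_field. ring_hom_on S \<phi> \<and> \<phi> s \<noteq> 0 \<longrightarrow>
           (\<exists>\<psi>. ring_hom_on (adjoin S g) \<psi> \<and> (\<forall>a\<in>S. \<psi> a = \<phi> a) \<and> \<psi> b \<noteq> 0))"
proof (cases "transcendental S g")
  case True
  obtain q where q: "q \<in> polys_over S" "b = poly q g" using b by (auto simp: adjoin_def)
  hence q0: "q \<noteq> 0" using b by auto
  show ?thesis
  proof (intro bexI[of _ "Polynomial.lead_coeff q"] conjI allI impI; (elim conjE)?)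
    show "Polynomial.lead_coeff q \<noteq> 0" "Polynomial.lead_coeff q \<in> S" using q0 q by (auto simp: polys_over_def)
    fix \<phi> :: "'a \<Rightarrow> 'k" assume h: "ring_hom_on S \<phi>" and nz: "\<phi> (Polynomial.lead_coeff q) \<noteq> 0"
    have "map_poly \<phi> q \<noteq> 0"
      using nz hom_on_0[OF h S] by (metis coeff_0 coeff_map_poly)
    then obtain w where w: "poly (map_poly \<phi> q) w \<noteq> 0"
    proof (cases "Polynomial.degree (map_poly \<phi> q) = 0")
      case True
      then obtain c where "map_poly \<phi> q = [:c:]" by (auto elim: degree_eq_zeroE)
      thus ?thesis using \<open>map_poly \<phi> q \<noteq> 0\<close> that[of 0] by auto
    next
      \<comment> \<open>At a root of \<open>\<phi> q - 1\<close> the polynomial \<open>\<phi> q\<close> has the value 1.\<close>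
      case False
      hence "Polynomial.degree (map_poly \<phi> q - 1) > 0"
        using degree_add_eq_left[of "-1" "map_poly \<phi> q"] by simp
      from alg_closed_imp_poly_has_root[OF this] that show ?thesis by force
    qed
    have "poly (map_poly \<phi> p) w = 0" if "p \<in> polys_over S" "poly p g = 0" for p
      using True that by (auto simp: transcendental_def)
    from extend_hom_eval[OF h S this] q w
    show "\<exists>\<psi>. ring_hom_on (adjoin S g) \<psi> \<and> (\<forall>a\<in>S. \<psi> a = \<phi> a) \<and> \<psi> b \<noteq> 0" by metis
  qed
next
  case False
  note P = polys_over_closed[OF S]
  note PC = subring_closed[OF P(1)] 
  define Q where "Q p \<longleftrightarrow> p \<in> polys_over S \<and> poly p g = 0 \<and> p \<noteq> 0" for p
  define p where "p = arg_min Polynomial.degree Q"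
  have ex: "\<exists>p. Q p" using False by (auto simp: Q_def transcendental_def)
  have p: "p \<in> polys_over S" "poly p g = 0" "p \<noteq> 0"
    using arg_min_natI[of Q] ex by (auto simp: p_def Q_def)
  have pmin: "r = 0" if "r \<in> polys_over S" "poly r g = 0" "Polynomial.degree r < Polynomial.degree p" for r
    using arg_min_nat_le[of Q r Polynomial.degree] that by (force simp: p_def Q_def)
  let ?c = "Polynomial.lead_coeff p"
  have cS: "?c \<in> S" "?c \<noteq> 0" using p by (auto simp: polys_over_def)
  \<comment> \<open>A polynomial of least degree among those whose value at \<open>g\<close> is a nonzero multiple of \<open>b\<close> is
    constant: otherwise dividing \<open>p\<close> by it leaves a smaller one or contradicts the choice of \<open>p\<close>.\<close>
  define J where "J r \<longleftrightarrow> r \<in> polys_over S \<and> poly r g \<noteq> 0 \<and> (\<exists>v\<in>adjoin S g. poly r g = b * v)" for r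
  define u where "u = arg_min Polynomial.degree J"
  note AC = subring_closed[OF adjoin_subring(1)[OF S, of g]]
  have Sin: "\<And>c. c \<in> S \<Longrightarrow> c \<in> adjoin S g" using adjoin_subring(2)[OF S] by blast
  have evin: "poly r g \<in> adjoin S g" if "r \<in> polys_over S" for r using that by (auto simp: adjoin_def)
  have exJ: "\<exists>r. J r \<and> (Polynomial.degree r < Polynomial.degree p)"
  proof -
    obtain q where q: "q \<in> polys_over S" "b = poly q g" using b by (auto simp: adjoin_def)
    obtain k h r where *: "h \<in> polys_over S" "r \<in> polys_over S"
        "Polynomial.smult (?c ^ k) q = p * h + r" "r = 0 \<or> Polynomial.degree r < Polynomial.degree p"
      using pseudo_division_over[OF S p(1,3) q(1)] by blast
    have "poly (Polynomial.smult (?c ^ k) q) g = poly r g" using *(3) p(2) by simp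
    hence r: "poly r g = b * ?c ^ k" using q by (simp add: ac_simps)
    have "poly r g \<noteq> 0" unfolding r using b cS by simp
    moreover have "?c ^ k \<in> adjoin S g" using cS by (intro AC Sin)
    ultimately show ?thesis using * r by (auto simp: J_def)
  qed
  have u: "J u" using arg_min_natI[of J] exJ by (auto simp: u_def)
  have umin: "Polynomial.degree u \<le> Polynomial.degree r" if "J r" for r
    using arg_min_nat_le[of J r Polynomial.degree] that by (simp add: u_def)
  have ulp: "Polynomial.degree u < Polynomial.degree p" using exJ umin by force
  have u0: "u \<noteq> 0" and uS: "u \<in> polys_over S" using u by (auto simp: J_def)
  have "Polynomial.degree u = 0"
  proof (rule ccontr)
    assume du: "Polynomial.degree u \<noteq> 0"
    let ?d = "Polynomial.lead_coeff u"
    obtain k h r where *: "h \<in> polys_over S" "r \<in> polys_over S"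
        "Polynomial.smult (?d ^ k) p = u * h + r" "r = 0 \<or> Polynomial.degree r < Polynomial.degree u"
      using pseudo_division_over[OF S uS u0 p(1)] by blast
    obtain v where v: "v \<in> adjoin S g" "poly u g = b * v" using u by (auto simp: J_def)
    have "poly (Polynomial.smult (?d ^ k) p) g = poly u g * poly h g + poly r g" using *(3) by simp
    hence e: "poly r g = - (poly u g * poly h g)" using p(2) by (simp add: add_eq_0_iff)
    have "poly r g = b * (- (v * poly h g))" using e v by simp
    moreover have "- (v * poly h g) \<in> adjoin S g" by (intro AC v evin *)
    ultimately have "poly r g = 0" using umin[of r] *(2,4) du by (fastforce simp: J_def)
    hence r0: "r = 0" using pmin[of r] * ulp du by auto
    hence "poly h g = 0" using e u by (auto simp: J_def)
    have sm: "Polynomial.smult (?d ^ k) p = u * h" using *(3) r0 by simp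
    have h0: "h \<noteq> 0" using sm p(3) u0 by auto
    have "Polynomial.degree p = Polynomial.degree u + Polynomial.degree h"
      using arg_cong[OF sm, of Polynomial.degree] u0 h0 by (simp add: degree_mult_eq)
    hence "h = 0" using pmin[of h] * \<open>poly h g = 0\<close> du by simp
    thus False using h0 by simp
  qed
  then obtain e where e: "u = [:e:]" by (auto elim: degree_eq_zeroE)
  obtain v where v: "v \<in> adjoin S g" "e = b * v" using u e by (auto simp: J_def)
  have eS: "e \<in> S" "e \<noteq> 0" using uS u0 e by (auto simp: polys_over_def dest: spec[of _ 0])
  have dp: "Polynomial.degree p > 0" using ulp by simp
  show ?thesis
  proof (intro bexI[of _ "?c * e"] conjI allI impI; (elim conjE)?)
    show "?c * e \<noteq> 0" "?c * e \<in> S" using cS eS subring_mult[OF S] by auto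
    fix \<phi> :: "'a \<Rightarrow> 'k" assume h: "ring_hom_on S \<phi>" and nz: "\<phi> (?c * e) \<noteq> 0"
    note H = hom_on_closed[OF h S]
    have nz': "\<phi> ?c \<noteq> 0" "\<phi> e \<noteq> 0" using nz H(4)[OF cS(1) eS(1)] by auto
    have "Polynomial.degree (map_poly \<phi> p) = Polynomial.degree p"
      by (rule map_poly_degree_eq) (use nz' in simp)
    then obtain w where w: "poly (map_poly \<phi> p) w = 0" using alg_closed_imp_poly_has_root dp by metis
    have "poly (map_poly \<phi> q) w = 0" if q: "q \<in> polys_over S" "poly q g = 0" for q
    proof -
      obtain k f r where *: "f \<in> polys_over S" "r \<in> polys_over S"
        "Polynomial.smult (?c ^ k) q = p * f + r" "r = 0 \<or> Polynomial.degree r < Polynomial.degree p"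
        using pseudo_division_over[OF S p(1,3) q(1)] by blast
      have "poly r g = 0" using arg_cong[OF *(3), of "\<lambda>p. poly p g"] p(2) q(2) by simp
      hence "r = 0" using * pmin by auto
      hence "map_poly \<phi> (Polynomial.smult (?c ^ k) q) = map_poly \<phi> p * map_poly \<phi> f"
        using *(3) map_poly_hom_on(2)[OF h S p(1) *(1)] by simp
      hence "Polynomial.smult (\<phi> (?c ^ k)) (map_poly \<phi> q) = map_poly \<phi> p * map_poly \<phi> f"
        using map_poly_hom_on(3)[OF h S q(1) q(1), of "?c ^ k"] subring_power[OF S cS(1)] by simp
      hence "\<phi> ?c ^ k * poly (map_poly \<phi> q) w = 0"
        using w H(7)[OF cS(1)] by (metis mult_zero_left poly_mult poly_smult)
      thus ?thesis using nz' by simp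
    qed
    then obtain \<psi> where \<psi>: "ring_hom_on (adjoin S g) \<psi>" "\<And>a. a \<in> S \<Longrightarrow> \<psi> a = \<phi> a"
      using extend_hom_eval[OF h S] by metis
    have "\<psi> e = \<psi> b * \<psi> v"
      unfolding v(2) using \<psi>(1) b(1) v(1) by (simp add: ring_hom_on_def)
    hence "\<psi> b \<noteq> 0" using nz' \<psi>(2)[OF eS(1)] by auto
    thus "\<exists>\<psi>. ring_hom_on (adjoin S g) \<psi> \<and> (\<forall>a\<in>S. \<psi> a = \<phi> a) \<and> \<psi> b \<noteq> 0" using \<psi> by blast
  qed
qed

fun adjoins :: "'a::comm_ring_1 set \<Rightarrow> 'a list \<Rightarrow> 'a set" where
  "adjoins S [] = S"
| "adjoins S (g # gs) = adjoins (adjoin S g) gs"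

lemma adjoins_subring:
  assumes "is_subring S"
  shows "is_subring (adjoins S gs) \<and> S \<subseteq> adjoins S gs \<and> set gs \<subseteq> adjoins S gs"
  using assms
proof (induct gs arbitrary: S)
  case (Cons g gs)
  note a = adjoin_subring[OF Cons.prems, of g]
  from Cons.hyps[OF a(1)] a show ?case by auto
qed auto

lemma adjoins_least: "is_subring S \<Longrightarrow> is_subring R \<Longrightarrow> S \<subseteq> R \<Longrightarrow> set gs \<subseteq> R \<Longrightarrow> adjoins S gs \<subseteq> R"
proof (induct gs arbitrary: S)
  case (Cons g gs)
  have "adjoins (adjoin S g) gs \<subseteq> R"
    using Cons.prems by (intro Cons.hyps adjoin_subring adjoin_least) auto
  thus ?case by simp
qed auto

text \<open>
  For \<open>S\<close> a field this is the Nullstellensatz in the form that a nonzero element of a finitely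
  generated domain does not vanish at all points.
\<close>

theorem extend_hom_adjoins:
  fixes S :: "'a::idom set"
  assumes "is_subring S" and "b \<in> adjoins S gs" "b \<noteq> 0"
  shows "\<exists>s\<in>S. s \<noteq> 0 \<and> (\<forall>\<phi> :: 'a \<Rightarrow> 'k::alg_closed_field. ring_hom_on S \<phi> \<and> \<phi> s \<noteq> 0 \<longrightarrow>
           (\<exists>\<psi>. ring_hom_on (adjoins S gs) \<psi> \<and> (\<forall>a\<in>S. \<psi> a = \<phi> a) \<and> \<psi> b \<noteq> 0))"
  using assms
proof (induct gs arbitrary: S)
  case Nil
  thus ?case by (intro bexI[of _ b]) auto
next
  case (Cons g gs)
  note a = adjoin_subring[OF Cons.prems(1), of g]
  have b: "b \<in> adjoins (adjoin S g) gs" using Cons.prems by simp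
  obtain s where s: "s \<in> adjoin S g" "s \<noteq> 0" and es: "\<forall>\<phi> :: 'a \<Rightarrow> 'k. ring_hom_on (adjoin S g) \<phi> \<and> \<phi> s \<noteq> 0 \<longrightarrow>
           (\<exists>\<psi>. ring_hom_on (adjoins (adjoin S g) gs) \<psi> \<and> (\<forall>a\<in>adjoin S g. \<psi> a = \<phi> a) \<and> \<psi> b \<noteq> 0)"
    using Cons.hyps[OF a(1) b Cons.prems(3)] by blast
  obtain t where t: "t \<in> S" "t \<noteq> 0" and et: "\<forall>\<phi> :: 'a \<Rightarrow> 'k. ring_hom_on S \<phi> \<and> \<phi> t \<noteq> 0 \<longrightarrow>
           (\<exists>\<psi>. ring_hom_on (adjoin S g) \<psi> \<and> (\<forall>a\<in>S. \<psi> a = \<phi> a) \<and> \<psi> s \<noteq> 0)"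
    using extend_hom_adjoin[OF Cons.prems(1) s] by blast
  show ?case
  proof (intro bexI[of _ t] conjI allI impI t; (elim conjE)?)
    fix \<phi> :: "'a \<Rightarrow> 'k" assume "ring_hom_on S \<phi>" "\<phi> t \<noteq> 0"
    then obtain \<psi> where 1: "ring_hom_on (adjoin S g) \<psi>" "\<forall>a\<in>S. \<psi> a = \<phi> a" "\<psi> s \<noteq> 0" using et by blast
    then obtain \<theta> where "ring_hom_on (adjoins (adjoin S g) gs) \<theta>" "\<forall>a\<in>adjoin S g. \<theta> a = \<psi> a" "\<theta> b \<noteq> 0"
      using es by blast
    thus "\<exists>\<psi>. ring_hom_on (adjoins S (g # gs)) \<psi> \<and> (\<forall>a\<in>S. \<psi> a = \<phi> a) \<and> \<psi> b \<noteq> 0"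
      using 1 a by (auto intro!: exI[of _ \<theta>])
  qed
qed

section \<open>Krull dimension bounds transcendence degree\<close>

lemma subring_image:
  assumes "ring_hom_on UNIV \<theta>" "is_subring S"
  shows "is_subring (\<theta> ` S)"
proof -
  have c: "\<theta> 1 = 1" "\<And>a b. \<theta> (a - b) = \<theta> a - \<theta> b" "\<And>a b. \<theta> (a * b) = \<theta> a * \<theta> b"
    using hom_on_1[OF assms(1) subring_UNIV] hom_on_diff[OF assms(1) subring_UNIV]
      hom_on_mult[OF assms(1) subring_UNIV] by auto
  show ?thesis unfolding is_subring_def
  proof (intro conjI ballI; (elim imageE)?)
    show "1 \<in> \<theta> ` S" using c(1) subring_1[OF assms(2)] by (metis imageI)
    fix a b s t assume *: "a = \<theta> s" "b = \<theta> t" "s \<in> S" "t \<in> S"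
    have "a - b = \<theta> (s - t)" "a * b = \<theta> (s * t)" using * c by auto
    thus "a - b \<in> \<theta> ` S" "a * b \<in> \<theta> ` S"
      using * subring_diff[OF assms(2)] subring_mult[OF assms(2)] by auto
  qed
qed

lemma adjoins_image_subset:
  assumes h: "ring_hom_on UNIV \<theta>" and S: "is_subring S"
  shows "\<theta> ` adjoins S gs \<subseteq> adjoins (\<theta> ` S) (map \<theta> gs)"
  using S
proof (induct gs arbitrary: S)
  case (Cons g gs)
  note H = hom_on_closed[OF h subring_UNIV]
  have S': "is_subring (\<theta> ` S)" by (rule subring_image[OF h Cons.prems])
  have "\<theta> ` adjoin S g \<subseteq> adjoin (\<theta> ` S) (\<theta> g)"
  proof
    fix v assume "v \<in> \<theta> ` adjoin S g"
    then obtain p where p: "p \<in> polys_over S" "v = \<theta> (poly p g)" by (auto simp: adjoin_def)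
    have "v = poly (map_poly \<theta> p) (\<theta> g)"
      unfolding p(2) by (rule poly_induct2[of _ p p]) (use H in \<open>auto simp: map_poly_pCons\<close>)
    moreover have "map_poly \<theta> p \<in> polys_over (\<theta> ` S)"
      using p(1) H(1) by (auto simp: polys_over_def coeff_map_poly)
    ultimately show "v \<in> adjoin (\<theta> ` S) (\<theta> g)" by (auto simp: adjoin_def)
  qed
  moreover have "adjoins U l \<subseteq> adjoins V l" if "is_subring U" "is_subring V" "U \<subseteq> V" for U V :: "'b set" and l
    using adjoins_least[OF that(1), of "adjoins V l" l] adjoins_subring[OF that(2), of l] that by blast
  ultimately show ?case
    using Cons.hyps[OF adjoin_subring(1)[OF Cons.prems, of g]]
      subring_image[OF h adjoin_subring(1)[OF Cons.prems, of g]] adjoin_subring(1)[OF S', of "\<theta> g"]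
    by simp (meson order_trans)
qed auto

lemma transcendental_hom:
  assumes h: "ring_hom_on UNIV \<theta>" and inj: "\<And>b. \<theta> b = 0 \<Longrightarrow> b = 0" and t: "transcendental S t"
  shows "transcendental (\<theta> ` S) (\<theta> t)"
  unfolding transcendental_def
proof (intro ballI impI)
  fix q assume q: "q \<in> polys_over (\<theta> ` S)" "poly q (\<theta> t) = 0"
  note H = hom_on_closed[OF h subring_UNIV]
  have inj': "a = b" if "\<theta> a = \<theta> b" for a b using inj[of "a - b"] H(6)[of a b] that by simp
  have "\<exists>s. s \<in> S \<and> \<theta> s = poly.coeff q i" for i
  proof -
    have "poly.coeff q i \<in> \<theta> ` S" using q(1) by (rule polys_over_coeff)
    thus ?thesis by auto
  qed
  then obtain s where s: "\<And>i. s i \<in> S" "\<And>i. \<theta> (s i) = poly.coeff q i" by metis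
  define p where "p = Abs_poly s"
  have "MOST i. s i = 0"
    using MOST_coeff_eq_0[of q] by (rule MOST_mono) (metis s(2) inj)
  hence "poly.coeff p = s" unfolding p_def by (intro Abs_poly_inverse) simp
  hence cp: "poly.coeff p i = s i" for i by simp
  have qp: "q = map_poly \<theta> p" by (rule poly_eqI) (simp add: coeff_map_poly H(1) cp s)
  have "poly q (\<theta> t) = \<theta> (poly p t)"
    unfolding qp by (rule poly_induct2[of _ p p]) (use H in \<open>auto simp: map_poly_pCons\<close>)
  hence "poly p t = 0" using q(2) inj by simp
  hence "p = 0" using t cp s by (auto simp: transcendental_def polys_over_def)
  thus "q = 0" using qp by simp
qed

text \<open>
  The prime ideal \<open>ker \<theta>\<close> is enlarged by specialising the transcendental element \<open>\<theta> t\<close> to a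
  constant, while everything in \<open>S\<close> keeps its value.  Working with homomorphisms into one big field
  instead of quotient rings keeps the algebraic independence of the remaining elements visible.
\<close>

lemma degenerate_hom:
  fixes \<theta> :: "'b::idom \<Rightarrow> 'k::alg_closed_field"
  assumes h: "ring_hom_on UNIV \<theta>" and K: "is_subring K" "infinite (\<theta> ` K)" and gen: "adjoins K gs = UNIV"
    and S: "is_subring S" "K \<subseteq> S" and t: "transcendental (\<theta> ` S) (\<theta> t)"
  obtains \<theta>' where "ring_hom_on UNIV \<theta>'" "\<And>s. s \<in> S \<Longrightarrow> \<theta>' s = \<theta> s" "{b. \<theta> b = 0} \<subset> {b. \<theta>' b = 0}"
proof -
  let ?S = "\<theta> ` S" and ?T = "adjoin (\<theta> ` S) (\<theta> t)" and ?R = "range \<theta>"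
  note H = hom_on_closed[OF h subring_UNIV]
  have sS: "is_subring ?S" by (rule subring_image[OF h S(1)])
  note T = adjoin_subring[OF sS, of "\<theta> t"]
  have "?R \<subseteq> adjoins (\<theta> ` K) (map \<theta> gs)" using adjoins_image_subset[OF h K(1), of gs] gen by simp
  also have "\<dots> \<subseteq> adjoins ?T (map \<theta> gs)"
    using adjoins_subring[OF T(1), of "map \<theta> gs"] T S(2)
    by (intro adjoins_least subring_image[OF h K(1)]) auto
  finally have R: "?R \<subseteq> adjoins ?T (map \<theta> gs)" .
  obtain s where s: "s \<in> ?T" "s \<noteq> 0" and ext: "\<forall>\<phi> :: 'k \<Rightarrow> 'k. ring_hom_on ?T \<phi> \<and> \<phi> s \<noteq> 0 \<longrightarrow>
           (\<exists>\<psi>. ring_hom_on (adjoins ?T (map \<theta> gs)) \<psi> \<and> (\<forall>a\<in>?T. \<psi> a = \<phi> a) \<and> \<psi> 1 \<noteq> 0)"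
    using extend_hom_adjoins[OF T(1), of 1 "map \<theta> gs"] adjoins_subring[OF T(1), of "map \<theta> gs"]
      subring_1 one_neq_zero by blast
  obtain p where p: "p \<in> polys_over ?S" "s = poly p (\<theta> t)" using s by (auto simp: adjoin_def)
  have p0: "p \<noteq> 0" using p s by auto
  \<comment> \<open>Almost every constant can serve as the new value of \<open>t\<close>.\<close>
  obtain l where l: "l \<in> \<theta> ` K" "poly p l \<noteq> 0"
  proof -
    have "\<not> \<theta> ` K \<subseteq> {x. poly p x = 0}" using K(2) poly_roots_finite[OF p0] finite_subset by blast
    thus ?thesis using that by blast
  qed
  have id: "ring_hom_on ?S (\<lambda>x. x)" by (simp add: ring_hom_on_def)
  have mid: "map_poly (\<lambda>x. x) q = q" for q :: "'k poly" by (simp add: map_poly_idI)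
  have "poly (map_poly (\<lambda>x. x) q) l = 0" if "q \<in> polys_over ?S" "poly q (\<theta> t) = 0" for q
    using t that by (auto simp: transcendental_def mid)
  from extend_hom_eval[OF id sS this] obtain \<phi> where \<phi>: "ring_hom_on ?T \<phi>" "\<And>a. a \<in> ?S \<Longrightarrow> \<phi> a = a"
    "\<phi> (\<theta> t) = l" "\<And>p. p \<in> polys_over ?S \<Longrightarrow> \<phi> (poly p (\<theta> t)) = poly (map_poly (\<lambda>x. x) p) l" by metis
  have "\<phi> s \<noteq> 0" using \<phi>(4)[OF p(1)] l p mid by simp
  then obtain \<psi> where \<psi>: "ring_hom_on (adjoins ?T (map \<theta> gs)) \<psi>" "\<forall>a\<in>?T. \<psi> a = \<phi> a" using ext \<phi>(1) by blast
  show ?thesis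
  proof (rule that[of "\<psi> \<circ> \<theta>"])
    show "ring_hom_on UNIV (\<psi> \<circ> \<theta>)"
      using \<psi>(1) R H by (auto simp: ring_hom_on_def subset_iff)
    show "(\<psi> \<circ> \<theta>) s = \<theta> s" if "s \<in> S" for s using that \<psi>(2) T \<phi>(2) by auto
    obtain c where c: "c \<in> K" "l = \<theta> c" using l by blast
    have tc: "\<theta> (t - c) \<noteq> 0"
    proof
      assume "\<theta> (t - c) = 0"
      hence "poly [:- l, 1:] (\<theta> t) = 0" using c H by simp
      moreover have "[:- l, 1:] \<in> polys_over ?S"
        using c S(2) sS by (intro polys_over_closed) (auto simp: subring_closed)
      ultimately have "[:- l, 1:] = 0" using t by (auto simp: transcendental_def)
      thus False by simp
    qed
    have eq: "\<psi> (\<theta> (t - c)) = 0"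
    proof -
      have in1: "\<theta> t \<in> ?T" "l \<in> ?T" using T c S by auto
      have "\<psi> (\<theta> t - l) = \<phi> (\<theta> t - l)" using \<psi>(2) in1 T(1) subring_diff by blast
      also have "\<dots> = \<phi> (\<theta> t) - \<phi> l" using hom_on_diff[OF \<phi>(1) T(1)] in1 by blast
      also have "\<dots> = 0" using \<phi>(2,3) c S by auto
      finally show ?thesis using c H by simp
    qed
    have "\<psi> 0 = 0" using hom_on_0[OF \<psi>(1)] adjoins_subring[OF T(1)] by blast
    hence "{b. \<theta> b = 0} \<subseteq> {b. (\<psi> \<circ> \<theta>) b = 0}" by auto
    moreover have "t - c \<in> {b. (\<psi> \<circ> \<theta>) b = 0}" "t - c \<notin> {b. \<theta> b = 0}" using tc eq by auto
    ultimately show "{b. \<theta> b = 0} \<subset> {b. (\<psi> \<circ> \<theta>) b = 0}" by blast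
  qed
qed

lemma primeideal_kernel:
  fixes \<theta> :: "'b::idom \<Rightarrow> 'k::idom"
  assumes h: "ring_hom_on UNIV \<theta>"
  shows "primeideal {b. \<theta> b = 0} (ring_of_type_algebra :: 'b ring)"
proof -
  note H = hom_on_closed[OF h subring_UNIV]
  interpret R: cring "ring_of_type_algebra :: 'b ring" by (rule cring_from_type_algebra)
  have inv: "inv\<^bsub>add_monoid (ring_of_type_algebra :: 'b ring)\<^esub> x = - x" for x :: 'b
    by (rule R.minus_equality[unfolded a_inv_def]) (simp_all add: ring_of_type_algebra_def)
  show ?thesis
  proof (rule primeidealI)
    show "ideal {b. \<theta> b = 0} (ring_of_type_algebra :: 'b ring)"
    proof (rule idealI)
      show "ring (ring_of_type_algebra :: 'b ring)" by (rule ring_from_type_algebra)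
      show "subgroup {b. \<theta> b = 0} (add_monoid (ring_of_type_algebra :: 'b ring))"
      proof (rule subgroup.intro)
        fix x assume "x \<in> {b. \<theta> b = 0}"
        thus "inv\<^bsub>add_monoid (ring_of_type_algebra :: 'b ring)\<^esub> x \<in> {b. \<theta> b = 0}" unfolding inv by (simp add: H)
      qed (auto simp: H ring_of_type_algebra_def)
    qed (auto simp: ring_of_type_algebra_def H)
    show "cring (ring_of_type_algebra :: 'b ring)" by (rule cring_from_type_algebra)
    show "carrier (ring_of_type_algebra :: 'b ring) \<noteq> {b. \<theta> b = 0}"
    proof
      assume "carrier (ring_of_type_algebra :: 'b ring) = {b. \<theta> b = 0}"
      hence "\<theta> 1 = 0" by (auto simp: ring_of_type_algebra_def)
      thus False using H by simp
    qed
  qed (auto simp: ring_of_type_algebra_def H)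
qed

text \<open>
  Starting with the embedding into an algebraically closed field, \<open>c\<close>, \<open>x\<close> and \<open>a\<close> are specialised in
  turn; the four kernels form a strictly increasing chain.
\<close>

theorem three_independent_krull_dim:
  fixes K :: "'b::idom set"
  assumes K: "is_subring K" "infinite K" and gen: "adjoins K gs = UNIV"
    and a: "transcendental K a" and x: "transcendental (adjoin K a) x"
    and c: "transcendental (adjoin (adjoin K a) x) c"
  shows "krull_dim (ring_of_type_algebra :: 'b ring) \<ge> 3"
proof -
  define \<theta> :: "'b \<Rightarrow> 'b fract alg_closure" where "\<theta> b = to_ac (to_fract b)" for b
  have h: "ring_hom_on UNIV \<theta>" by (simp add: \<theta>_def ring_hom_on_def)
  have inj: "b = 0" if "\<theta> b = 0" for b using that by (simp add: \<theta>_def)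
  have iK: "infinite (\<theta> ` K)"
  proof -
    have "inj \<theta>" by (rule injI) (simp add: \<theta>_def)
    thus ?thesis using K(2) by (meson finite_imageD inj_on_subset subset_UNIV)
  qed
  let ?A = "adjoin K a" and ?X = "adjoin (adjoin K a) x"
  note A = adjoin_subring[OF K(1), of a]
  note X = adjoin_subring[OF A(1), of x]
  obtain \<theta>1 where 1: "ring_hom_on UNIV \<theta>1" "\<And>s. s \<in> ?X \<Longrightarrow> \<theta>1 s = \<theta> s" "{b. \<theta> b = 0} \<subset> {b. \<theta>1 b = 0}"
    using degenerate_hom[OF h K(1) iK gen X(1) _ transcendental_hom[OF h inj c]] A X by blast
  have im1: "\<theta>1 ` ?A = \<theta> ` ?A" "\<theta>1 ` K = \<theta> ` K" "\<theta>1 x = \<theta> x"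
    using 1(2) A X by (auto intro!: image_cong)
  obtain \<theta>2 where 2: "ring_hom_on UNIV \<theta>2" "\<And>s. s \<in> ?A \<Longrightarrow> \<theta>2 s = \<theta>1 s" "{b. \<theta>1 b = 0} \<subset> {b. \<theta>2 b = 0}"
    using degenerate_hom[OF 1(1) K(1) _ gen A(1), of x] transcendental_hom[OF h inj x] im1 iK A by metis
  have "\<theta>2 s = \<theta> s" if "s \<in> ?A" for s using 1(2)[of s] 2(2)[OF that] that X by auto
  hence im2: "\<theta>2 ` K = \<theta> ` K" "\<theta>2 a = \<theta> a"
    using A by (auto intro!: image_cong)
  obtain \<theta>3 :: "'b \<Rightarrow> 'b fract alg_closure" where 3: "ring_hom_on UNIV \<theta>3" "{b. \<theta>2 b = 0} \<subset> {b. \<theta>3 b = 0}"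
    using degenerate_hom[OF 2(1) K(1) _ gen K(1), of a] transcendental_hom[OF h inj a] im2 iK by (metis order_refl)
  define P where "P = (!) [{b. \<theta> b = 0}, {b. \<theta>1 b = 0}, {b. \<theta>2 b = 0}, {b. \<theta>3 b = 0}]"
  have "\<forall>i\<le>3. primeideal (P i) (ring_of_type_algebra :: 'b ring)"
    using primeideal_kernel[OF h] primeideal_kernel[OF 1(1)] primeideal_kernel[OF 2(1)] primeideal_kernel[OF 3(1)]
    by (auto simp: P_def numeral_3_eq_3 le_Suc_eq)
  moreover have "\<forall>i<3. P i \<subset> P (Suc i)"
    using 1(3) 2(3) 3(2) by (auto simp: P_def numeral_3_eq_3 less_Suc_eq)
  ultimately have "enat 3 \<le> krull_dim (ring_of_type_algebra :: 'b ring)"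
    unfolding krull_dim_def by (intro SUP_upper) auto
  thus ?thesis by (simp add: numeral_eq_enat)
qed

section \<open>Derivations of fraction fields and finite field extensions\<close>

definition is_derivation :: "('a::comm_ring_1 \<Rightarrow> 'a) \<Rightarrow> bool" where
  "is_derivation d \<longleftrightarrow> (\<forall>a b. d (a + b) = d a + d b \<and> d (a * b) = d a * b + a * d b)"

lemma derivation_rules:
  assumes "is_derivation d"
  shows deriv_add: "d (a + b) = d a + d b" and deriv_mult: "d (a * b) = d a * b + a * d b"
    and deriv_0: "d 0 = 0" and deriv_1: "d 1 = 0" and deriv_uminus: "d (- a) = - d a"
    and deriv_diff: "d (a - b) = d a - d b" and deriv_sum: "d (sum f I) = (\<Sum>i\<in>I. d (f i))"
    and deriv_power: "d (a ^ n) = of_nat n * a ^ (n - 1) * d a"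
proof -
  show p: "d (a + b) = d a + d b" for a b using assms by (auto simp: is_derivation_def)
  show m: "d (a * b) = d a * b + a * d b" for a b using assms by (auto simp: is_derivation_def)
  show z: "d 0 = 0" using p[of 0 0] by simp
  show o: "d 1 = 0" using m[of 1 1] by simp
  show u: "d (- a) = - d a" for a using p[of a "- a"] z by (simp add: add_eq_0_iff)
  show "d (a - b) = d a - d b" using p[of a "- b"] u by simp
  show "d (sum f I) = (\<Sum>i\<in>I. d (f i))" by (induct I rule: infinite_finite_induct) (auto simp: z p)
  show "d (a ^ n) = of_nat n * a ^ (n - 1) * d a"
  proof (induct n)
    case (Suc n)
    have "d (a ^ Suc n) = d a * a ^ n + a * (of_nat n * a ^ (n - 1) * d a)" by (simp add: m Suc)
    also have "a * (of_nat n * a ^ (n - 1) * d a) = of_nat n * a ^ n * d a" by (cases n) (auto simp: algebra_simps)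
    finally show ?case by (simp add: algebra_simps)
  qed (simp add: o)
qed

text \<open>
  Functions on fractions are defined by means of a chosen numerator and denominator; that the choice
  does not matter is proved under the hypotheses of the individual lemmas.
\<close>

definition fract_rep :: "'a::idom fract \<Rightarrow> 'a \<times> 'a" where
  "fract_rep r = (SOME p. snd p \<noteq> 0 \<and> r = Fract (fst p) (snd p))"

definition fract_hom :: "('a::idom \<Rightarrow> 'l::field) \<Rightarrow> 'a fract \<Rightarrow> 'l" where
  "fract_hom \<phi> r = \<phi> (fst (fract_rep r)) / \<phi> (snd (fract_rep r))"

definition fract_deriv :: "('a::idom \<Rightarrow> 'a) \<Rightarrow> 'a fract \<Rightarrow> 'a fract" where
  "fract_deriv d r = (case fract_rep r of (a, b) \<Rightarrow> Fract (d a * b - a * d b) (b * b))"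

lemma fract_rep:
  obtains c e where "fract_rep r = (c, e)" "e \<noteq> 0" "r = Fract c e"
proof -
  have "\<exists>p. snd p \<noteq> 0 \<and> r = Fract (fst p) (snd p)" by (cases r) auto
  from someI_ex[OF this] that show ?thesis unfolding fract_rep_def[symmetric]
    by (metis prod.collapse)
qed

lemma fract_hom_Fract:
  assumes h: "ring_hom_on UNIV \<phi>" and inj: "\<And>a. \<phi> a = 0 \<Longrightarrow> a = 0" and b: "b \<noteq> 0"
  shows "fract_hom \<phi> (Fract a b) = \<phi> a / \<phi> b"
proof -
  define r where "r = Fract a b"
  obtain c e where *: "e \<noteq> 0" "r = Fract c e" "fract_hom \<phi> r = \<phi> c / \<phi> e"
    using fract_rep[of r] by (metis fract_hom_def fst_conv snd_conv)
  hence "a * e = c * b" using b by (simp add: r_def eq_fract)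
  hence "\<phi> a * \<phi> e = \<phi> c * \<phi> b" using hom_on_mult[OF h subring_UNIV] by (metis UNIV_I)
  moreover have "\<phi> e \<noteq> 0" "\<phi> b \<noteq> 0" using * inj b by auto
  ultimately have "\<phi> a / \<phi> b = \<phi> c / \<phi> e" by (simp add: field_simps)
  thus ?thesis using *(3) by (simp add: r_def)
qed

lemma fract_hom_hom:
  assumes h: "ring_hom_on UNIV \<phi>" and inj: "\<And>a. \<phi> a = 0 \<Longrightarrow> a = 0"
  shows "ring_hom_on UNIV (fract_hom \<phi>)" and "fract_hom \<phi> (to_fract a) = \<phi> a"
proof -
  note H = hom_on_closed[OF h subring_UNIV]
  note F = fract_hom_Fract[OF h inj]
  have "fract_hom \<phi> (u + v) = fract_hom \<phi> u + fract_hom \<phi> v \<and>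
        fract_hom \<phi> (u * v) = fract_hom \<phi> u * fract_hom \<phi> v" for u v
  proof (cases u; cases v)
    fix a b c e assume "u = Fract a b" "b \<noteq> 0" "v = Fract c e" "e \<noteq> 0"
    moreover from this have "\<phi> b \<noteq> 0" "\<phi> e \<noteq> 0" using inj by auto
    ultimately show ?thesis by (simp add: F H field_simps)
  qed
  moreover have "fract_hom \<phi> 1 = 1" using F[of 1 1] H by (simp add: One_fract_def)
  ultimately show "ring_hom_on UNIV (fract_hom \<phi>)" by (simp add: ring_hom_on_def)
  show "fract_hom \<phi> (to_fract a) = \<phi> a" using F[of 1 a] H by (simp add: to_fract_def)
qed

lemma fract_deriv_Fract:
  assumes d: "is_derivation d" and b: "b \<noteq> 0"
  shows "fract_deriv d (Fract a b) = Fract (d a * b - a * d b) (b * b)"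
proof -
  define r where "r = Fract a b"
  obtain c e where *: "e \<noteq> 0" "r = Fract c e"
    "fract_deriv d r = Fract (d c * e - c * d e) (e * e)"
    using fract_rep[of r] by (metis (no_types, lifting) fract_deriv_def case_prod_conv)
  hence eq: "a * e = c * b" using b by (simp add: r_def eq_fract)
  hence deq: "d a * e + a * d e = d c * b + c * d b" using deriv_mult[OF d] by metis
  have "(d a * b - a * d b) * (e * e) = (d c * e - c * d e) * (b * b)"
  proof -
    have dae: "d a * e = d c * b + c * d b - a * d e" using deq by (simp add: algebra_simps)
    have "(d a * b - a * d b) * (e * e) = (d a * e) * b * e - (a * e) * d b * e" by (simp add: algebra_simps)
    also have "\<dots> = (d c * b + c * d b - a * d e) * b * e - (c * b) * d b * e" unfolding dae eq ..
    also have "\<dots> = d c * e * (b * b) - (a * e) * d e * b" by (simp add: algebra_simps)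
    also have "\<dots> = (d c * e - c * d e) * (b * b)" by (simp add: eq algebra_simps)
    finally show ?thesis .
  qed
  thus ?thesis using * b by (simp add: r_def eq_fract)
qed

lemma fract_deriv_derivation:
  assumes d: "is_derivation d"
  shows "is_derivation (fract_deriv d)" and "fract_deriv d (to_fract a) = to_fract (d a)"
proof -
  note D = derivation_rules[OF d]
  note F = fract_deriv_Fract[OF d]
  have "fract_deriv d (u + v) = fract_deriv d u + fract_deriv d v \<and>
        fract_deriv d (u * v) = fract_deriv d u * v + u * fract_deriv d v" for u v
  proof (cases u; cases v)
    fix a b c e assume "u = Fract a b" "b \<noteq> 0" "v = Fract c e" "e \<noteq> 0"
    thus ?thesis by (simp add: F D eq_fract) (simp add: algebra_simps)
  qed
  thus "is_derivation (fract_deriv d)" by (simp add: is_derivation_def)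
  show "fract_deriv d (to_fract a) = to_fract (d a)" using F[of 1 a] D by (simp add: to_fract_def)
qed

text \<open>
  Two derivations that agree on a ring agree on its field of fractions, stated along an embedding.
\<close>

lemma hom_fract_deriv:
  assumes h: "ring_hom_on UNIV h" and d: "is_derivation d" and e: "is_derivation e"
    and c: "\<And>a. h (to_fract (d a)) = e (h (to_fract a))"
  shows "h (fract_deriv d r) = e (h (r :: 'a::idom fract) :: 'l::field)"
proof (cases r)
  case (Fract a b)
  note H = hom_on_closed[OF h subring_UNIV]
  let ?a = "h (to_fract a)" and ?b = "h (to_fract b)"
  have b0: "?b \<noteq> 0"
  proof
    assume "?b = 0"
    hence "h (to_fract b * inverse (to_fract b)) = 0" by (subst H) auto
    thus False using Fract H by simp
  qed
  have r: "r * to_fract b = to_fract a" using Fract by (simp add: to_fract_def eq_fract)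
  have "fract_deriv d r * to_fract b + r * to_fract (d b) = to_fract (d a)"
    using r fract_deriv_derivation[OF d] by (metis deriv_mult)
  hence "h (fract_deriv d r) * ?b + h r * e ?b = e ?a" using H(3,4) c by (metis UNIV_I)
  moreover have "h r * ?b = ?a" using r H(4) by (metis UNIV_I)
  hence "e (h r) * ?b + h r * e ?b = e ?a" using deriv_mult[OF e] by metis
  ultimately show ?thesis using b0 by (metis add_right_cancel mult_right_cancel)
qed

text \<open>
  A field extension is given by an embedding \<open>h\<close>; the larger field is then a vector space over the
  smaller one, so that dimension arguments are available.
\<close>

locale field_ext =
  fixes h :: "'f::field \<Rightarrow> 'l::field"
  assumes hom: "ring_hom_on UNIV h"
begin

lemmas h_simps [simp] = hom_on_closed[OF hom subring_UNIV, simplified]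

lemma h_eq_0 [simp]: "h c = 0 \<longleftrightarrow> c = 0"
proof
  assume "h c = 0"
  show "c = 0"
  proof (rule ccontr)
    assume "c \<noteq> 0"
    have "h (c * inverse c) = 0" unfolding h_simps(4) using \<open>h c = 0\<close> by simp
    thus False using \<open>c \<noteq> 0\<close> by simp
  qed
qed simp

sublocale vector_space "\<lambda>c v. h c * v"
  by unfold_locales (auto simp: algebra_simps)

lemma dependent_family:
  fixes v :: "nat \<Rightarrow> 'l"
  assumes E: "finite E" and v: "\<And>i. i \<le> n \<Longrightarrow> v i \<in> span E" and n: "card E \<le> n"
  obtains c where "\<exists>i\<le>n. c i \<noteq> 0" "(\<Sum>i\<le>n. h (c i) * v i) = 0"
proof (cases "inj_on v {..n}")
  case False
  then obtain i j where ij: "i \<le> n" "j \<le> n" "i \<noteq> j" "v i = v j" by (auto simp: inj_on_def)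
  define c :: "nat \<Rightarrow> 'f" where "c k = (if k = i then 1 else if k = j then - 1 else 0)" for k
  have "(\<Sum>k\<le>n. h (c k) * v k) = (\<Sum>k\<in>{i, j}. h (c k) * v k)"
    using ij by (intro sum.mono_neutral_right) (auto simp: c_def)
  also have "\<dots> = 0" using ij by (simp add: c_def)
  finally have "(\<Sum>k\<le>n. h (c k) * v k) = 0" .
  moreover have "c i \<noteq> 0" by (simp add: c_def)
  ultimately show ?thesis using that[of c] ij(1) by blast
next
  case True
  have "card (v ` {..n}) = Suc n" using True by (simp add: card_image)
  hence "dependent (v ` {..n})"
    using independent_span_bound[OF E, of "v ` {..n}"] v n by auto
  then obtain u where u: "\<exists>w\<in>v ` {..n}. u w \<noteq> 0" "(\<Sum>w\<in>v ` {..n}. h (u w) * w) = 0"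
    by (subst (asm) dependent_finite) auto
  show ?thesis
    by (rule that[of "u \<circ> v"]) (use u in \<open>auto simp: sum.reindex[OF True]\<close>)
qed

definition algebraic_elem :: "'l \<Rightarrow> bool" where
  "algebraic_elem g \<longleftrightarrow> (\<exists>p. p \<noteq> 0 \<and> poly (map_poly h p) g = 0)"

lemma map_poly_h:
  "map_poly h (p + q) = map_poly h p + map_poly h q" "map_poly h (p * q) = map_poly h p * map_poly h q"
  "poly.coeff (map_poly h p) i = h (poly.coeff p i)" "Polynomial.degree (map_poly h p) = Polynomial.degree p"
  "map_poly h p = 0 \<longleftrightarrow> p = 0" "map_poly h (pCons c p) = pCons (h c) (map_poly h p)"
proof -
  show "map_poly h (p + q) = map_poly h p + map_poly h q" "map_poly h (p * q) = map_poly h p * map_poly h q"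
    using map_poly_hom_on[OF hom subring_UNIV] by (auto simp: polys_over_def)
  show "Polynomial.degree (map_poly h p) = Polynomial.degree p"
    by (cases "p = 0") (auto intro!: map_poly_degree_eq)
qed (auto simp: coeff_map_poly map_poly_pCons poly_eq_iff)

text \<open>
  A finite-dimensional domain over a field is a field.  The powers of \<open>v\<close> are dependent, and a
  relation of least degree has a nonzero constant term, which can be solved for the inverse of \<open>v\<close>.
\<close>

lemma subring_span_inverse:
  assumes E: "finite E" and S: "is_subring (span E)" and v: "v \<in> span E"
  shows "inverse v \<in> span E"
proof (cases "v = 0")
  case True
  thus ?thesis using v by simp
next
  case False
  define J where "J p \<longleftrightarrow> p \<noteq> 0 \<and> poly (map_poly h p) v = 0" for p
  have exJ: "\<exists>p. J p"
  proof -
    obtain c where c: "\<exists>i\<le>card E. c i \<noteq> 0" "(\<Sum>i\<le>card E. h (c i) * v ^ i) = 0"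
      using dependent_family[OF E, of "card E" "\<lambda>i. v ^ i"] subring_power[OF S v] by blast
    let ?p = "\<Sum>i\<le>card E. monom (c i) i"
    have cf: "poly.coeff ?p i = (if i \<le> card E then c i else 0)" for i
      by (simp add: coeff_sum if_distrib[of "\<lambda>x. x = _"] sum.delta)
    have "?p \<noteq> 0" using c(1) cf by (metis coeff_0)
    moreover have "poly (map_poly h ?p) v = 0"
    proof -
      have "Polynomial.degree (map_poly h ?p) \<le> card E" by (rule degree_le) (simp add: map_poly_h cf)
      hence "poly (map_poly h ?p) v = (\<Sum>i\<le>card E. poly.coeff (map_poly h ?p) i * v ^ i)"
        unfolding poly_altdef by (intro sum.mono_neutral_left) (auto simp: not_le coeff_eq_0)
      thus ?thesis using c(2) by (simp add: map_poly_h cf)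
    qed
    ultimately show ?thesis by (auto simp: J_def)
  qed
  define p where "p = arg_min Polynomial.degree J"
  have p: "J p" using arg_min_natI[of J] exJ by (auto simp: p_def)
  obtain c q where q: "p = pCons c q" by (cases p)
  have "c \<noteq> 0"
  proof
    assume "c = 0"
    hence "J q" "Polynomial.degree q < Polynomial.degree p"
      using p q False by (auto simp: J_def map_poly_h)
    thus False using arg_min_nat_le[of J q Polynomial.degree] by (simp add: p_def)
  qed
  have "h c + v * poly (map_poly h q) v = 0" using p q by (simp add: J_def map_poly_h)
  hence *: "poly (map_poly h q) v * v = - h c" by (simp add: add_eq_0_iff ac_simps)
  have "h (- inverse c) * poly (map_poly h q) v * v = h (inverse c * c)"
  proof -
    have "h (- inverse c) * poly (map_poly h q) v * v = h (- inverse c) * (poly (map_poly h q) v * v)" by (rule mult.assoc)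
    also have "\<dots> = h (inverse c) * h c" using * by simp
    finally show ?thesis by (simp del: left_inverse right_inverse)
  qed
  hence "v * (h (- inverse c) * poly (map_poly h q) v) = 1" using \<open>c \<noteq> 0\<close> by (simp add: ac_simps)
  hence "inverse v = h (- inverse c) * poly (map_poly h q) v" by (rule inverse_unique)
  moreover have "poly (map_poly h q) v \<in> span E"
    unfolding poly_altdef using subring_power[OF S v] by (auto simp: map_poly_h intro!: span_sum span_scale)
  ultimately show ?thesis using span_scale by metis
qed

text \<open>
  If \<open>g\<close> has degree \<open>d\<close>, the products of a spanning set with the powers of \<open>g\<close> below \<open>d\<close> span the
  ring generated by it and \<open>g\<close>.
\<close>

lemma adjoin_algebraic_finite:
  assumes E: "finite E" "1 \<in> span E" "\<And>a b. a \<in> span E \<Longrightarrow> b \<in> span E \<Longrightarrow> a * b \<in> span E"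
    and g: "algebraic_elem g"
  obtains E' where "finite E'" "1 \<in> span E'" "\<forall>a\<in>span E'. \<forall>b\<in>span E'. a * b \<in> span E'"
    "span E \<subseteq> span E'" "g \<in> span E'"
proof -
  obtain p where p: "p \<noteq> 0" "poly (map_poly h p) g = 0" using g by (auto simp: algebraic_elem_def)
  define d where "d = Polynomial.degree p"
  let ?l = "Polynomial.lead_coeff p"
  have gd: "g ^ d = (\<Sum>i<d. h (- poly.coeff p i / ?l) * g ^ i)"
  proof -
    have "0 = (\<Sum>i\<le>d. h (poly.coeff p i) * g ^ i)" using p by (simp add: poly_altdef map_poly_h d_def)
    also have "\<dots> = (\<Sum>i<d. h (poly.coeff p i) * g ^ i) + h ?l * g ^ d"
      by (simp add: lessThan_Suc_atMost[symmetric] d_def)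
    finally have "h (- inverse ?l) * (- h ?l * g ^ d) = h (- inverse ?l) * (\<Sum>i<d. h (poly.coeff p i) * g ^ i)"
      by (metis add.commute add_eq_0_iff mult_minus_left)
    moreover have "h (- inverse ?l) * (- h ?l * g ^ d) = g ^ d"
    proof -
      have "h (- inverse ?l) * (- h ?l * g ^ d) = h (inverse ?l * ?l) * g ^ d" by (simp del: left_inverse)
      thus ?thesis using p by simp
    qed
    ultimately have "g ^ d = h (- inverse ?l) * (\<Sum>i<d. h (poly.coeff p i) * g ^ i)" by simp
    also have "\<dots> = (\<Sum>i<d. h (- inverse ?l * poly.coeff p i) * g ^ i)"
      unfolding sum_distrib_left by (simp add: ac_simps)
    finally show ?thesis by (simp add: field_simps)
  qed
  then obtain c where gd: "g ^ d = (\<Sum>i<d. h (c i) * g ^ i)" by metis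
  have d0: "d > 0"
  proof (rule ccontr)
    assume "\<not> d > 0"
    hence "g ^ d = 0" using gd by simp
    thus False using \<open>\<not> d > 0\<close> by simp
  qed
  define E' where "E' = (\<lambda>(e, i). e * g ^ i) ` (E \<times> {..<d})"
  have mulspan: "(\<And>e. e \<in> U \<Longrightarrow> e * w \<in> span V) \<Longrightarrow> u \<in> span U \<Longrightarrow> u * w \<in> span V" for U V u w
  proof -
    assume a: "\<And>e. e \<in> U \<Longrightarrow> e * w \<in> span V" and u: "u \<in> span U"
    show "u * w \<in> span V" using u
    proof (induct rule: span_induct_alt)
      case (step c x y)
      have "(h c * x + y) * w = h c * (x * w) + y * w" by (simp add: algebra_simps)
      thus ?case using a[OF step(1)] step(2) by (auto intro!: span_add span_scale)
    qed (simp add: span_zero)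
  qed
  have pw: "u * g ^ i \<in> span E'" if "u \<in> span E" "i < d" for u i
    by (rule mulspan[OF _ that(1)], rule span_base) (use that in \<open>auto simp: E'_def\<close>)
  have sub: "u \<in> span E'" if "u \<in> span E" for u using pw[OF that d0] by simp
  have mg: "u * g \<in> span E'" if "u \<in> span E'" for u
  proof (rule mulspan[OF _ that])
    fix e assume "e \<in> E'"
    then obtain e0 i where e: "e0 \<in> E" "i < d" "e = e0 * g ^ i" by (auto simp: E'_def)
    show "e * g \<in> span E'"
    proof (cases "Suc i < d")
      case True
      thus ?thesis using pw[OF span_base[OF e(1)] True] e by (simp add: ac_simps)
    next
      case False
      hence "Suc i = d" using e by simp
      hence "e * g = e0 * g ^ d" using e by auto
      also have "\<dots> = (\<Sum>i<d. h (c i) * (e0 * g ^ i))"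
        unfolding gd sum_distrib_left by (simp add: ac_simps)
      finally have "e * g = (\<Sum>i<d. h (c i) * (e0 * g ^ i))" .
      thus ?thesis using pw[OF span_base[OF e(1)]] by (auto intro!: span_sum span_scale)
    qed
  qed
  have mgi: "u * g ^ i \<in> span E'" if "u \<in> span E'" for u i
  proof (induct i)
    case (Suc i)
    have "u * g ^ Suc i = u * g ^ i * g" by (simp add: ac_simps)
    thus ?case using mg[OF Suc] by (simp only:)
  qed (use that in simp)
  have mE: "u * e \<in> span E'" if "u \<in> span E'" "e \<in> span E" for u e
  proof (rule mulspan[OF _ that(1)])
    fix f assume "f \<in> E'"
    then obtain e0 i where e: "e0 \<in> E" "i < d" "f = e0 * g ^ i" by (auto simp: E'_def)
    have "f * e = (e0 * e) * g ^ i" using e by (simp add: ac_simps)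
    thus "f * e \<in> span E'" using pw[OF E(3)[OF span_base[OF e(1)] that(2)] e(2)] by (simp only:)
  qed
  show ?thesis
  proof (rule that[of E'])
    show "finite E'" using E by (auto simp: E'_def)
    show "1 \<in> span E'" by (rule sub[OF E(2)])
    show "span E \<subseteq> span E'" using sub by blast
    show "g \<in> span E'" using mg[OF sub[OF E(2)]] by simp
    show "\<forall>a\<in>span E'. \<forall>b\<in>span E'. a * b \<in> span E'"
    proof (intro ballI)
      fix a b assume ab: "a \<in> span E'" "b \<in> span E'"
    have "b * a \<in> span E'"
    proof (rule mulspan[OF _ ab(2)])
      fix f assume "f \<in> E'"
      then obtain e0 i where e: "e0 \<in> E" "i < d" "f = e0 * g ^ i" by (auto simp: E'_def)
      show "f * a \<in> span E'" using mgi[OF mE[OF ab(1) span_base[OF e(1)]], of i] e by (simp add: ac_simps)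
    qed
    thus "a * b \<in> span E'" by (simp add: ac_simps)
    qed
  qed
qed

theorem finite_algebra:
  assumes "finite G" "\<And>g. g \<in> G \<Longrightarrow> algebraic_elem g"
  obtains E where "finite E" "is_subring (span E)" "range h \<subseteq> span E" "G \<subseteq> span E"
proof -
  have "\<exists>E. finite E \<and> 1 \<in> span E \<and> (\<forall>a\<in>span E. \<forall>b\<in>span E. a * b \<in> span E) \<and> G \<subseteq> span E"
    using assms
  proof (induct G)
    case empty
    have "a * b \<in> span {1}" if "a \<in> span {1}" "b \<in> span {1}" for a b
    proof -
      have "\<exists>c. a = h c * 1" "\<exists>c. b = h c * 1" using that unfolding span_singleton by blast+
      then obtain c e where "a = h c * 1" "b = h e * 1" by blast
      hence "a * b = h (c * e) * 1" by simp
      thus ?thesis unfolding span_singleton by (rule range_eqI)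
    qed
    thus ?case by (intro exI[of _ "{1}"]) (auto simp: span_base)
  next
    case (insert g G)
    then obtain E where E: "finite E" "1 \<in> span E" "\<forall>a\<in>span E. \<forall>b\<in>span E. a * b \<in> span E" "G \<subseteq> span E" by auto
    have g: "algebraic_elem g" using insert by simp
    obtain E' where "finite E'" "1 \<in> span E'" "\<forall>a\<in>span E'. \<forall>b\<in>span E'. a * b \<in> span E'"
      "span E \<subseteq> span E'" "g \<in> span E'"
      by (rule adjoin_algebraic_finite[OF E(1,2) E(3)[rule_format] g])
    thus ?case using E(4) by (intro exI[of _ E']) auto
  qed
  then obtain E where E: "finite E" "1 \<in> span E" "\<And>a b. a \<in> span E \<Longrightarrow> b \<in> span E \<Longrightarrow> a * b \<in> span E" "G \<subseteq> span E"
    by blast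
  show ?thesis
  proof (rule that[of E])
    show "is_subring (span E)" using E by (auto simp: is_subring_def span_diff)
    show "range h \<subseteq> span E" using span_scale[OF E(2)] by fastforce
  qed (use E in auto)
qed

end

section \<open>Surjective derivations over a rational function field\<close>

lemma remove_factor:
  fixes \<pi> s :: "'k::field poly"
  assumes "Polynomial.degree \<pi> > 0" "s \<noteq> 0"
  obtains e s1 where "s = \<pi> ^ e * s1" "\<not> \<pi> dvd s1"
proof -
  have "\<exists>e s1. s = \<pi> ^ e * s1 \<and> \<not> \<pi> dvd s1"
    using assms(2)
  proof (induct "Polynomial.degree s" arbitrary: s rule: less_induct)
    case less
    show ?case
    proof (cases "\<pi> dvd s")
      case True
      then obtain t where t: "s = \<pi> * t" by auto
      have "t \<noteq> 0" "\<pi> \<noteq> 0" using t less.prems by auto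
      hence "Polynomial.degree t < Polynomial.degree s" using t assms(1) by (simp add: degree_mult_eq)
      from less.hyps[OF this \<open>t \<noteq> 0\<close>] obtain e s1 where "t = \<pi> ^ e * s1" "\<not> \<pi> dvd s1" by blast
      thus ?thesis using t by (intro exI[of _ "Suc e"] exI[of _ s1]) (simp add: ac_simps)
    next
      case False
      thus ?thesis by (intro exI[of _ 0] exI[of _ s]) simp
    qed
  qed
  thus ?thesis using that by blast
qed

lemma reduced_fraction:
  fixes \<pi> :: "'k::field poly"
  assumes "Polynomial.degree \<pi> > 0"
  obtains r s where "u = Fract r s" "s \<noteq> 0" "\<not> (\<pi> dvd r \<and> \<pi> dvd s)"
proof -
  define J where "J s \<longleftrightarrow> s \<noteq> 0 \<and> (\<exists>r. u = Fract r s)" for s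
  define s where "s = arg_min Polynomial.degree J"
  have "\<exists>s. J s" unfolding J_def by (cases u) auto
  hence s: "J s" using arg_min_natI[of J] by (auto simp: s_def)
  then obtain r where r: "u = Fract r s" "s \<noteq> 0" by (auto simp: J_def)
  have "\<not> (\<pi> dvd r \<and> \<pi> dvd s)"
  proof
    assume "\<pi> dvd r \<and> \<pi> dvd s"
    then obtain a b where ab: "r = \<pi> * a" "s = \<pi> * b" unfolding dvd_def by blast
    have b0: "b \<noteq> 0" "\<pi> \<noteq> 0" using ab r by auto
    hence "J b" using r ab by (auto simp: J_def mult_fract_cancel)
    moreover have "Polynomial.degree b < Polynomial.degree s" using ab b0 assms by (simp add: degree_mult_eq)
    ultimately show False using arg_min_nat_le[of J b Polynomial.degree] by (simp add: s_def)
  qed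
  thus ?thesis using that r by blast
qed

lemma derivation_pderiv: "is_derivation (pderiv :: 'k::idom poly \<Rightarrow> _)"
  by (simp add: is_derivation_def pderiv_add pderiv_mult algebra_simps)

text \<open>
  If \<open>\<pi>\<close> divides the denominator of \<open>u\<close> exactly \<open>k\<close> times and \<open>k > 0\<close>, then it divides the
  denominator of the derivative exactly \<open>k + 1 \<ge> 2\<close> times, since in characteristic zero neither \<open>k\<close>
  nor the derivative of \<open>\<pi>\<close> is divisible by \<open>\<pi>\<close>.
\<close>

lemma no_simple_pole:
  fixes \<pi> p :: "'k::field_char_0 poly"
  assumes pr: "prime_elem \<pi>" and np: "\<not> \<pi> dvd p"
  shows "fract_deriv pderiv u \<noteq> Fract p \<pi>"
proof
  assume e: "fract_deriv pderiv u = Fract p \<pi>"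
  have p0: "\<pi> \<noteq> 0" using pr by auto
  have dp: "Polynomial.degree \<pi> > 0"
  proof (rule ccontr)
    assume "\<not> ?thesis"
    hence "\<pi> dvd 1" using p0 by (simp add: is_unit_iff_degree)
    thus False using pr by (simp add: prime_elem_def)
  qed
  obtain r s where u: "u = Fract r s" "s \<noteq> 0" "\<not> (\<pi> dvd r \<and> \<pi> dvd s)"
    by (rule reduced_fraction[OF dp])
  have eq: "(pderiv r * s - r * pderiv s) * \<pi> = p * (s * s)"
    using e u p0 by (simp add: fract_deriv_Fract[OF derivation_pderiv] eq_fract)
  hence "\<pi> dvd p * (s * s)" by (metis dvd_triv_right)
  hence ps: "\<pi> dvd s" using pr np by (auto simp: prime_elem_dvd_mult_iff)
  obtain k t where kt: "s = \<pi> ^ k * t" "\<not> \<pi> dvd t" by (rule remove_factor[OF dp u(2)])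
  have "k \<noteq> 0" using ps kt by (metis mult_1 power_0)
  then obtain m where m: "k = Suc m" by (cases k) auto
  have ds: "pderiv s = \<pi> ^ m * (of_nat k * pderiv \<pi> * t + \<pi> * pderiv t)"
    unfolding kt(1) using deriv_power[OF derivation_pderiv, of \<pi> k]
    by (simp add: pderiv_mult m algebra_simps)
  have s: "s = \<pi> ^ m * (\<pi> * t)" using kt m by (simp add: ac_simps)
  have "(pderiv r * s - r * pderiv s) * \<pi> = \<pi> ^ m * \<pi> * (pderiv r * (\<pi> * t) - r * (of_nat k * pderiv \<pi> * t + \<pi> * pderiv t))"
    unfolding ds by (subst s) (simp add: algebra_simps)
  moreover have "p * (s * s) = \<pi> ^ m * \<pi> * (p * \<pi> ^ m * \<pi> * t * t)" unfolding s by (simp add: algebra_simps)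
  ultimately have "pderiv r * (\<pi> * t) - r * (of_nat k * pderiv \<pi> * t + \<pi> * pderiv t) = p * \<pi> ^ m * \<pi> * t * t"
    using eq p0 by simp
  hence "r * of_nat k * pderiv \<pi> * t = \<pi> * (pderiv r * t - r * pderiv t - p * \<pi> ^ m * t * t)"
    by (simp add: algebra_simps)
  hence "\<pi> dvd r * of_nat k * pderiv \<pi> * t" by simp
  moreover have "\<not> \<pi> dvd r" using ps u by auto
  moreover have "\<not> \<pi> dvd of_nat k"
  proof -
    have "(of_nat k :: 'k poly) = [:of_nat k:]" by (simp add: of_nat_poly)
    moreover have "(of_nat k :: 'k) \<noteq> 0" using m by (simp del: of_nat_Suc)
    ultimately have "(of_nat k :: 'k poly) dvd 1" by (simp add: is_unit_iff_degree)
    thus ?thesis using pr dvd_trans[of \<pi> "of_nat k" 1] by (auto simp: prime_elem_def)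
  qed
  moreover have "\<not> \<pi> dvd pderiv \<pi>"
  proof
    assume "\<pi> dvd pderiv \<pi>"
    moreover have "pderiv \<pi> \<noteq> 0" using dp by (simp add: pderiv_eq_0_iff)
    ultimately have "Polynomial.degree \<pi> \<le> Polynomial.degree (pderiv \<pi>)" by (rule dvd_imp_degree_le)
    thus False using dp by (simp add: degree_pderiv)
  qed
  ultimately show False using pr kt by (auto simp: prime_elem_dvd_mult_iff)
qed

text \<open>
  Multiplying \<open>p / q\<close> by a proper factor of \<open>q\<close> gives another element with the same property and a
  smaller denominator.  By induction these elements are polynomials, which settles reducible \<open>q\<close>.
  If \<open>q\<close> is irreducible and does not divide \<open>p\<close>, then \<open>p / q\<close> has a simple pole, and derivatives have none.
\<close>

theorem exact_module_is_polynomial: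
  fixes w :: "'k::field_char_0 poly fract"
  assumes "\<And>q. \<exists>u. fract_deriv pderiv u = to_fract q * w"
  shows "w \<in> range to_fract"
proof -
  have "Fract p q \<in> range to_fract"
    if "q \<noteq> 0" "\<And>g. \<exists>u. fract_deriv pderiv u = to_fract g * Fract p q" for p q :: "'k poly"
    using that
  proof (induct "Polynomial.degree q" arbitrary: p q rule: less_induct)
    case less
    note ex = less.prems(2)
    show ?case
    proof (cases "q dvd p")
      case True
      then obtain t where "p = q * t" by auto
      hence "Fract p q = to_fract t" using less.prems by (simp add: to_fract_def eq_fract)
      thus ?thesis by blast
    next
      case False
      hence nu: "\<not> q dvd 1" using dvd_trans by (metis one_dvd)
      have "\<not> irreducible q"
      proof
        assume "irreducible q"
        hence "prime_elem q" by (rule field_poly_irreducible_imp_prime)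
        from no_simple_pole[OF this False] ex[of 1] show False by (simp add: to_fract_def One_fract_def)
      qed
      then obtain a b where ab: "q = a * b" "\<not> a dvd 1" "\<not> b dvd 1"
        using nu less.prems by (auto simp: irreducible_def)
      have nz: "a \<noteq> 0" "b \<noteq> 0" using ab less.prems by auto
      have dg: "Polynomial.degree a > 0" "Polynomial.degree b > 0" using ab nz by (auto simp: is_unit_iff_degree)
      have d: "Polynomial.degree a < Polynomial.degree q" "Polynomial.degree b < Polynomial.degree q"
        using ab nz dg by (auto simp: degree_mult_eq)
      have w: "to_fract a * Fract p q = Fract p b" using nz ab by (simp add: to_fract_def eq_fract)
      have "\<exists>u. fract_deriv pderiv u = to_fract g * Fract p b" for g
        using ex[of "g * a"] by (simp add: w[symmetric] to_fract_mult ac_simps)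
      from less.hyps[OF d(2) nz(2) this] obtain t where t: "Fract p b = to_fract t" by auto
      have eq: "Fract p q = Fract t a" using t nz ab by (simp add: to_fract_def eq_fract ac_simps)
      from less.hyps[OF d(1) nz(1), of t] ex show ?thesis by (simp add: eq)
    qed
  qed
  thus ?thesis using assms by (cases w) auto
qed

text \<open>
  Submodules of a free module of finite rank over \<open>k[x]\<close> are finitely generated; this is the form for
  a submodule that is generated by a sequence.  The proof is by induction on the rank \<open>n\<close>.
\<close>

lemma sequence_in_free_module:
  fixes v :: "nat \<Rightarrow> nat \<Rightarrow> 'k::field poly"
  shows "\<exists>m c. \<forall>i<n. v m i = (\<Sum>j<m. c j * v j i)"
proof (induct n arbitrary: v)
  case (Suc n)
  define L where "L M f \<longleftrightarrow> (\<exists>c. \<forall>i. f i = (\<Sum>j<M. c j * v j i))" for M and f :: "nat \<Rightarrow> 'k poly"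
  have Ladd: "L M (\<lambda>i. f i + g i)" if fg: "L M f" "L M g" for M f g
  proof -
    obtain c d where "\<forall>i. f i = (\<Sum>j<M. c j * v j i)" "\<forall>i. g i = (\<Sum>j<M. d j * v j i)" using fg by (auto simp: L_def)
    thus ?thesis unfolding L_def by (intro exI[of _ "\<lambda>j. c j + d j"]) (simp add: sum.distrib algebra_simps)
  qed
  have Lscale: "L M (\<lambda>i. a * f i)" if f: "L M f" for M f a
  proof -
    obtain c where "\<forall>i. f i = (\<Sum>j<M. c j * v j i)" using f by (auto simp: L_def)
    thus ?thesis unfolding L_def by (intro exI[of _ "\<lambda>j. a * c j"]) (simp add: sum_distrib_left ac_simps)
  qed
  have Lbase: "L M (v j)" if "j < M" for M j
    unfolding L_def using that
    by (intro exI[of _ "\<lambda>k. if k = j then 1 else 0"]) (simp add: if_distrib[of "\<lambda>x. x * _"] sum.delta cong: if_cong)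
  have Lmono: "L M' f" if f: "L M f" "M \<le> M'" for M M' f
  proof -
    obtain c where c: "\<forall>i. f i = (\<Sum>j<M. c j * v j i)" using f by (auto simp: L_def)
    have "(\<Sum>j<M. c j * v j i) = (\<Sum>j<M'. (if j < M then c j else 0) * v j i)" for i
      using f(2) by (intro sum.mono_neutral_cong_left) auto
    thus ?thesis unfolding L_def using c by (intro exI[of _ "\<lambda>j. if j < M then c j else 0"]) simp
  qed
  have Lsum: "L M (\<lambda>i. \<Sum>j<(k::nat). g j i)" if "\<And>j. j < k \<Longrightarrow> L M (g j)" for M k g
    using that
  proof (induct k)
    case 0
    show ?case unfolding L_def by (intro exI[of _ "\<lambda>_. 0"]) simp
  next
    case (Suc k)
    thus ?case by (simp add: Ladd)
  qed
  have concl: ?case if "L m (v m)" for m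
    using that unfolding L_def by blast
  show ?case
  proof (cases "\<forall>j. v j n = 0")
    case True
    obtain m c where "\<forall>i<n. v m i = (\<Sum>j<m. c j * v j i)" using Suc[of v] by blast
    thus ?thesis using True by (intro exI[of _ m] exI[of _ c]) (auto simp: less_Suc_eq)
  next
    case False
    \<comment> \<open>Division with remainder shows that the last coordinate of \<open>u\<close>, chosen of least degree,
      divides the last coordinates of all \<open>v j\<close>.  Subtracting multiples of \<open>u\<close> from the tail of the
      sequence, starting after the terms that occur in \<open>u\<close>, lowers the rank.\<close>
    define J where "J u \<longleftrightarrow> u n \<noteq> 0 \<and> (\<exists>M. L M u)" for u
    define u where "u = arg_min (\<lambda>u. Polynomial.degree (u n)) J"
    obtain j where "v j n \<noteq> 0" using False by blast
    moreover have "L (Suc j) (v j)" by (rule Lbase) simp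
    ultimately have "\<exists>u. J u" unfolding J_def by blast
    hence u: "J u" using arg_min_natI[of J] by (auto simp: u_def)
    have umin: "Polynomial.degree (u n) \<le> Polynomial.degree (w n)" if "J w" for w
      using arg_min_nat_le[of J w "\<lambda>u. Polynomial.degree (u n)"] that by (simp add: u_def)
    obtain N where N: "L N u" using u by (auto simp: J_def)
    have u0: "u n \<noteq> 0" using u by (auto simp: J_def)
    define q where "q j = v j n div u n" for j
    have q: "v j n = q j * u n" for j
    proof (rule ccontr)
      assume ne: "v j n \<noteq> q j * u n"
      let ?w = "\<lambda>i. v j i + (- q j) * u i"
      have wn: "?w n = v j n mod u n" by (simp add: q_def minus_div_mult_eq_mod[symmetric])
      have "L (max N (Suc j)) ?w"
        by (intro Ladd Lscale Lmono[OF N] Lmono[OF Lbase[of j "Suc j"]]) auto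
      moreover have "?w n \<noteq> 0" using ne by simp
      ultimately have "J ?w" by (auto simp: J_def)
      from umin[OF this] have "Polynomial.degree (u n) \<le> Polynomial.degree (v j n mod u n)" unfolding wn .
      moreover have "v j n mod u n \<noteq> 0" unfolding wn[symmetric] using ne by simp
      ultimately show False using degree_mod_less[OF u0, of "v j n"] by auto
    qed
    obtain m c where mc: "\<And>i. i < n \<Longrightarrow> v (N + m) i + (- q (N + m)) * u i
        = (\<Sum>j<m. c j * (v (N + j) i + (- q (N + j)) * u i))"
      using Suc[of "\<lambda>j i. v (N + j) i + (- q (N + j)) * u i"] by blast
    let ?f = "\<lambda>i. q (N + m) * u i + (\<Sum>j<m. c j * (v (N + j) i + (- q (N + j)) * u i))"
    have "L (N + m) ?f"
      by (intro Ladd Lscale Lsum Lmono[OF N] Lbase) auto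
    then obtain e where e: "\<forall>i. ?f i = (\<Sum>j<N + m. e j * v j i)" unfolding L_def by blast
    have "v (N + m) i = ?f i" if "i < Suc n" for i
    proof (cases "i = n")
      case True
      thus ?thesis using q by simp
    next
      case False
      thus ?thesis using that mc[of i] by (simp add: algebra_simps)
    qed
    thus ?thesis using e by (intro exI[of _ "N + m"] exI[of _ e]) auto
  qed
qed auto

text \<open>
  The situation obtained from \<open>B\<close> by inverting the polynomials in \<open>a\<close>: \<open>R\<close> is a ring between \<open>k[x]\<close> and
  a finite extension of \<open>k(x)\<close>, and \<open>E\<close> is a basis of that extension.
\<close>

locale differential_ext = field_ext h for h :: "'k::field_char_0 poly fract \<Rightarrow> 'l::field" +
  fixes d :: "'l \<Rightarrow> 'l" and E :: "'l set" and R :: "'l set"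
  assumes d: "is_derivation d" and d_h: "d (h r) = h (fract_deriv pderiv r)"
    and E: "finite E" "independent E" "span E = UNIV"
    and R: "is_subring R" "E \<subseteq> R" "\<And>p. h (to_fract p) \<in> R"
    and surj: "\<And>r. r \<in> R \<Longrightarrow> \<exists>s\<in>R. d s = r"
begin

abbreviation coord where "coord e v \<equiv> representation E v e"

text \<open>
  The trace of the multiplication by \<open>v\<close>, written out in the basis \<open>E\<close>.
\<close>

definition tr :: "'l \<Rightarrow> 'k poly fract" where "tr v = (\<Sum>e\<in>E. coord e (v * e))"

lemma coord_simps: "coord e (u + v) = coord e u + coord e v" "coord e (u - v) = coord e u - coord e v"
  "coord e (h c * v) = c * coord e v" "coord e (\<Sum>i\<in>I. g i) = (\<Sum>i\<in>I. coord e (g i))"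
  using E by (simp_all add: representation_add representation_diff representation_scale representation_sum)

lemma expand: "v = (\<Sum>e\<in>E. h (coord e v) * e)"
  using sum_representation_eq[OF E(2), of v E] E by simp

lemma tr_linear: "tr (u + v) = tr u + tr v" "tr (u - v) = tr u - tr v" "tr (h c * v) = c * tr v"
  "tr (\<Sum>i\<in>I. g i) = (\<Sum>i\<in>I. tr (g i))"
proof -
  show a: "tr (u + v) = tr u + tr v" for u v by (simp add: tr_def distrib_right coord_simps sum.distrib)
  show "tr (u - v) = tr u - tr v" by (simp add: tr_def left_diff_distrib coord_simps sum_subtractf)
  show "tr (h c * v) = c * tr v" by (simp add: tr_def mult.assoc coord_simps sum_distrib_left)
  have "tr 0 = 0" using a[of 0 0] by (metis add.right_neutral add_left_cancel)
  thus "tr (\<Sum>i\<in>I. g i) = (\<Sum>i\<in>I. tr (g i))" by (induct I rule: infinite_finite_induct) (auto simp: a)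
qed

lemma tr_1: "tr 1 \<noteq> 0"
proof -
  have "tr 1 = of_nat (card E)"
    using E by (simp add: tr_def representation_basis)
  moreover have "card E \<noteq> 0" using E expand[of 1] by (auto simp: card_eq_0_iff)
  moreover have "(of_nat n :: 'k poly fract) = to_fract (of_nat n)" for n
    by (induct n) simp_all
  ultimately show ?thesis by simp
qed

lemma coord_d: "coord f (d v) = fract_deriv pderiv (coord f v) + (\<Sum>e\<in>E. coord e v * coord f (d e))"
  if "f \<in> E"
proof -
  have "d v = (\<Sum>e\<in>E. h (fract_deriv pderiv (coord e v)) * e) + (\<Sum>e\<in>E. h (coord e v) * d e)"
    by (subst expand[of v]) (simp add: deriv_sum[OF d] deriv_mult[OF d] d_h sum.distrib)
  hence "coord f (d v) = (\<Sum>e\<in>E. fract_deriv pderiv (coord e v) * coord f e) + (\<Sum>e\<in>E. coord e v * coord f (d e))"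
    by (simp add: coord_simps)
  also have "(\<Sum>e\<in>E. fract_deriv pderiv (coord e v) * coord f e) =
      (\<Sum>e\<in>E. if e = f then fract_deriv pderiv (coord e v) else 0)"
    using E by (intro sum.cong) (auto simp: representation_basis)
  also have "\<dots> = fract_deriv pderiv (coord f v)" using E that by simp
  finally show ?thesis .
qed

text \<open>
  In the basis \<open>E\<close> the derivation is the coordinatewise derivation plus a matrix \<open>N\<close>.  The matrix of the
  multiplication by \<open>d v\<close> is the derivative of the matrix of the multiplication by \<open>v\<close> plus its
  commutator with \<open>N\<close>, and a commutator has trace zero.
\<close>

lemma tr_d: "tr (d v) = fract_deriv pderiv (tr v)"
proof -
  let ?D = "fract_deriv (pderiv :: 'k poly \<Rightarrow> _)"
  note D = fract_deriv_derivation(1)[OF derivation_pderiv]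
  have e: "d v * e = d (v * e) - v * d e" for e by (simp add: deriv_mult[OF d])
  have "tr (d v) = (\<Sum>e\<in>E. coord e (d (v * e))) - (\<Sum>e\<in>E. coord e (v * d e))"
    by (simp add: tr_def e coord_simps sum_subtractf)
  also have "(\<Sum>e\<in>E. coord e (d (v * e))) =
      ?D (tr v) + (\<Sum>e\<in>E. \<Sum>f\<in>E. coord f (v * e) * coord e (d f))"
    by (simp add: coord_d sum.distrib tr_def deriv_sum[OF D])
  also have "(\<Sum>e\<in>E. coord e (v * d e)) = (\<Sum>e\<in>E. \<Sum>f\<in>E. coord f (d e) * coord e (v * f))"
  proof (rule sum.cong[OF refl])
    fix e
    have "v * d e = (\<Sum>f\<in>E. h (coord f (d e)) * (v * f))"
      by (subst expand[of "d e"]) (simp add: sum_distrib_left ac_simps)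
    thus "coord e (v * d e) = (\<Sum>f\<in>E. coord f (d e) * coord e (v * f))" by (simp add: coord_simps)
  qed
  also have "\<dots> = (\<Sum>e\<in>E. \<Sum>f\<in>E. coord f (v * e) * coord e (d f))"
    by (subst sum.swap) (simp add: ac_simps)
  finally show ?thesis by simp
qed

lemma tr_polynomial: "r \<in> R \<Longrightarrow> tr r \<in> range to_fract"
proof (rule exact_module_is_polynomial)
  fix q assume "r \<in> R"
  hence "h (to_fract q) * r \<in> R" using R subring_mult by blast
  then obtain s where "d s = h (to_fract q) * r" using surj by blast
  hence "fract_deriv pderiv (tr s) = to_fract q * tr r" by (metis tr_d tr_linear(3))
  thus "\<exists>u. fract_deriv pderiv u = to_fract q * tr r" ..
qed

text \<open>
  The traces of the products with basis elements map \<open>R\<close> into a free \<open>k[x]\<close>-module.  The map is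
  injective because the trace form is nondegenerate: \<open>z\<close> pairs with its inverse to the trace of 1,
  which is the degree of the extension and hence nonzero.
\<close>

theorem sequence_dependence:
  assumes v: "\<And>j. v j \<in> R"
  shows "\<exists>m p. v m = (\<Sum>j<m. h (to_fract (p j)) * v (j::nat))"
proof -
  obtain e where e: "bij_betw e {..<card E} E"
    using ex_bij_betw_nat_finite[OF E(1)] by (auto simp: atLeast0LessThan)
  have eE: "e i \<in> E" if "i < card E" for i using bij_betwE[OF e] that by auto
  have "\<exists>q. tr (v j * e i) = to_fract q" if "i < card E" for i j
  proof -
    have "v j * e i \<in> R" using v R eE[OF that] subring_mult[OF R(1)] by blast
    thus ?thesis using tr_polynomial by blast
  qed
  hence "\<forall>j i. \<exists>q. i < card E \<longrightarrow> tr (v j * e i) = to_fract q" by blast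
  then obtain V where V: "\<And>i j. i < card E \<Longrightarrow> tr (v j * e i) = to_fract (V j i)" by metis
  obtain m p where mp: "\<forall>i<card E. V m i = (\<Sum>j<m. p j * V j i)"
    using sequence_in_free_module[of "card E" V] by blast
  define z where "z = v m - (\<Sum>j<m. h (to_fract (p j)) * v j)"
  have tfs: "to_fract (sum g I) = (\<Sum>i\<in>I. to_fract (g i))" for g :: "nat \<Rightarrow> 'k poly" and I
    by (induct I rule: infinite_finite_induct) simp_all
  have zf: "tr (z * f) = 0" if "f \<in> E" for f
  proof -
    have "f \<in> e ` {..<card E}" using bij_betw_imp_surj_on[OF e] that by (simp only:)
    then obtain i where i: "i < card E" "f = e i" by blast
    have "z * f = v m * e i - (\<Sum>j<m. h (to_fract (p j)) * (v j * e i))"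
      using i by (simp add: z_def left_diff_distrib sum_distrib_right mult.assoc)
    hence "tr (z * f) = to_fract (V m i) - (\<Sum>j<m. to_fract (p j) * to_fract (V j i))"
      using i by (simp add: tr_linear V)
    also have "\<dots> = 0" using mp i by (simp add: tfs to_fract_mult)
    finally show ?thesis .
  qed
  have zy: "tr (z * y) = 0" for y
  proof -
    have "z * y = (\<Sum>f\<in>E. h (coord f y) * (z * f))"
      by (subst expand[of y]) (simp add: sum_distrib_left ac_simps)
    hence "tr (z * y) = (\<Sum>f\<in>E. coord f y * tr (z * f))" by (simp add: tr_linear)
    also have "\<dots> = 0" by (rule sum.neutral) (simp add: zf)
    finally show ?thesis .
  qed
  have "z = 0"
  proof (rule ccontr)
    assume "z \<noteq> 0"
    thus False using zy[of "inverse z"] tr_1 by simp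
  qed
  thus ?thesis by (intro exI[of _ m] exI[of _ p]) (simp add: z_def)
qed

end

section \<open>Taylor series along a derivation\<close>

lemma fps_nth_iterated_deriv:
  "fps_nth ((fps_deriv ^^ j) f) n = (\<Prod>l<j. of_nat (n + 1 + l)) * fps_nth (f :: complex fps) (n + j)"
proof (induct j arbitrary: n)
  case (Suc j)
  have "(\<Prod>l<Suc j. of_nat (n + 1 + l)) = (of_nat (n + 1) :: complex) * (\<Prod>l<j. of_nat (Suc n + 1 + l))"
    by (subst prod.lessThan_Suc_shift) (simp add: ac_simps)
  thus ?case by (simp add: Suc del: of_nat_Suc of_nat_add) 
qed simp

text \<open>
  A solution of a linear differential equation with polynomial coefficients and leading coefficient 1
  has no singularities.  On the level of coefficients, the recurrence bounds each coefficient by a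
  combination of earlier ones with a factor that tends to zero, even after scaling by powers of any \<open>R\<close>.
\<close>

lemma poly_ode_entire:
  fixes f :: "complex fps"
  assumes ode: "(fps_deriv ^^ m) f = (\<Sum>j<m. fps_of_poly (Q j) * (fps_deriv ^^ j) f)"
  shows "fps_conv_radius f = \<infinity>"
proof -
  have bounded: "\<exists>C. \<forall>k. cmod (fps_nth f k) * R ^ k \<le> C" if R: "R > 0" for R :: real
  proof -
    define t where "t k = cmod (fps_nth f k) * R ^ k" for k
    have t0: "t k \<ge> 0" for k using R by (simp add: t_def)
    define d where "d = Max (insert 0 ((\<lambda>j. Polynomial.degree (Q j)) ` {..<m}))"
    have Qd: "poly.coeff (Q j) i = 0" if "j < m" "i > d" for i j
    proof -
      have "Polynomial.degree (Q j) \<le> d" unfolding d_def using that by (intro Max_ge) auto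
      thus ?thesis using that by (intro coeff_eq_0) simp
    qed
    define K where "K = (\<Sum>j<m. \<Sum>i\<le>d. cmod (poly.coeff (Q j) i) * R ^ (m - j + i))"
    have K0: "K \<ge> 0" unfolding K_def using R by (intro sum_nonneg) auto
    have step: "t (n + m) \<le> K / (n + 1) * T" if T: "\<And>l. l < n + m \<Longrightarrow> t l \<le> T" "T \<ge> 0" for n T
    proof -
      \<comment> \<open>The factor \<open>1 / (n + 1)\<close> arises because the derivative of order \<open>m\<close> multiplies coefficients by
        at least \<open>n + 1\<close> times what a derivative of lower order does.\<close>
      let ?P = "\<lambda>j n. (\<Prod>l<j. real (n + 1 + l))"
      have Ppos: "?P j n > 0" for j n by (intro prod_pos) auto
      have cP: "(\<Prod>l<j. of_nat (n + 1 + l)) = complex_of_real (?P j n)" for j n by simp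
      have rec: "of_real (?P m n) * fps_nth f (n + m) =
          (\<Sum>j<m. \<Sum>i=0..n. poly.coeff (Q j) i * (of_real (?P j (n - i)) * fps_nth f (n - i + j)))"
        using arg_cong[OF ode, of "\<lambda>g. fps_nth g n"]
        unfolding fps_nth_iterated_deriv cP fps_sum_nth fps_mult_nth fps_of_poly_nth by simp
      have term_bound: "cmod (poly.coeff (Q j) i * (of_real (?P j (n - i)) * fps_nth f (n - i + j))) * R ^ (n + m)
          \<le> cmod (poly.coeff (Q j) i) * R ^ (m - j + i) * (?P m n / (n + 1) * T)" if ji: "j < m" "i \<le> n" for j i
      proof -
        have "?P j (n - i) \<le> ?P j n" by (intro prod_mono) auto
        also have "\<dots> \<le> ?P m n / (n + 1)"
        proof -
          obtain k where k: "m = j + Suc k" using ji less_imp_Suc_add by fastforce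
          have "?P j n * (n + 1) \<le> ?P (j + Suc k) n"
          proof (induct k)
            case 0
            have "?P j n * (n + 1) \<le> ?P j n * real (n + 1 + j)" using Ppos[of n j] by (intro mult_left_mono) auto
            thus ?case by simp
          next
            case (Suc k)
            have "?P (j + Suc k) n * 1 \<le> ?P (j + Suc k) n * real (n + 1 + (j + Suc k))"
              using Ppos[of n "j + Suc k"] by (intro mult_left_mono) auto
            with Suc show ?case by simp
          qed
          thus ?thesis unfolding k by (simp add: field_simps)
        qed
        finally have P: "?P j (n - i) \<le> ?P m n / (n + 1)" .
        have e: "n + m = (m - j + i) + (n - i + j)" using ji by simp
        have Re: "R ^ (n + m) = R ^ (m - j + i) * R ^ (n - i + j)" by (subst e) (rule power_add)
        have "cmod (poly.coeff (Q j) i * (of_real (?P j (n - i)) * fps_nth f (n - i + j))) * R ^ (n + m)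
            = cmod (poly.coeff (Q j) i) * R ^ (m - j + i) * (?P j (n - i) * t (n - i + j))"
          unfolding Re t_def norm_mult norm_of_real using Ppos[of "n - i" j] by simp
        also have "\<dots> \<le> cmod (poly.coeff (Q j) i) * R ^ (m - j + i) * (?P m n / (n + 1) * T)"
        proof (intro mult_left_mono mult_mono P T)
          show "n - i + j < n + m" using ji by simp
          show "0 \<le> ?P m n / real (n + 1)" using Ppos[of n m] by simp
        qed (use R t0 in auto)
        finally show ?thesis .
      qed
      have "?P m n * t (n + m) = cmod (of_real (?P m n) * fps_nth f (n + m)) * R ^ (n + m)"
        using Ppos[of n m] unfolding norm_mult norm_of_real t_def by simp
      also have "\<dots> \<le> (\<Sum>j<m. \<Sum>i=0..n. cmod (poly.coeff (Q j) i * (of_real (?P j (n - i)) * fps_nth f (n - i + j)))) * R ^ (n + m)"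
        unfolding rec using R by (intro mult_right_mono order_trans[OF norm_sum] sum_mono norm_sum) auto
      also have "\<dots> = (\<Sum>j<m. \<Sum>i=0..n. cmod (poly.coeff (Q j) i * (of_real (?P j (n - i)) * fps_nth f (n - i + j))) * R ^ (n + m))"
        by (simp add: sum_distrib_right)
      also have "\<dots> \<le> (\<Sum>j<m. \<Sum>i=0..n. cmod (poly.coeff (Q j) i) * R ^ (m - j + i) * (?P m n / (n + 1) * T))"
        by (intro sum_mono term_bound) auto
      also have "\<dots> = (\<Sum>j<m. \<Sum>i=0..n. cmod (poly.coeff (Q j) i) * R ^ (m - j + i)) * (?P m n / (n + 1) * T)"
        by (simp only: sum_distrib_right)
      also have "\<dots> \<le> K * (?P m n / (n + 1) * T)"
      proof (rule mult_right_mono)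
        have "(\<Sum>i=0..n. cmod (poly.coeff (Q j) i) * R ^ (m - j + i)) \<le> (\<Sum>i\<le>d. cmod (poly.coeff (Q j) i) * R ^ (m - j + i))"
          if "j < m" for j
        proof -
          have "(\<Sum>i=0..n. cmod (poly.coeff (Q j) i) * R ^ (m - j + i)) = (\<Sum>i\<in>{0..n} \<inter> {..d}. cmod (poly.coeff (Q j) i) * R ^ (m - j + i))"
            by (rule sum.mono_neutral_right) (use Qd[OF that] in auto)
          also have "\<dots> \<le> (\<Sum>i\<le>d. cmod (poly.coeff (Q j) i) * R ^ (m - j + i))"
            by (rule sum_mono2) (use R in auto)
          finally show ?thesis .
        qed
        thus "(\<Sum>j<m. \<Sum>i=0..n. cmod (poly.coeff (Q j) i) * R ^ (m - j + i)) \<le> K"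
          unfolding K_def by (intro sum_mono) auto
        show "0 \<le> ?P m n / (n + 1) * T" using Ppos[of n m] T by simp
      qed
      finally have "?P m n * t (n + m) \<le> ?P m n * (K / (n + 1) * T)" by (simp add: ac_simps)
      thus ?thesis using Ppos[of n m] by (simp only: mult_le_cancel_left_pos)
    qed
    obtain N where N: "K \<le> real N" using real_arch_simple by blast
    define C where "C = (\<Sum>l<N + m. t l)"
    have C0: "C \<ge> 0" unfolding C_def by (intro sum_nonneg t0)
    have "t k \<le> C" for k
    proof (induct k rule: less_induct)
      case (less k)
      show ?case
      proof (cases "k < N + m")
        case True
        thus ?thesis unfolding C_def using member_le_sum[of k "{..<N + m}" t] t0 by auto
      next
        case False
        define n where "n = k - m"
        have k: "k = n + m" "N \<le> n" using False by (auto simp: n_def)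
        have "t k \<le> K / (n + 1) * C" unfolding k(1) by (rule step) (use less k C0 in auto)
        also have "\<dots> \<le> 1 * C"
          using N k K0 C0 by (intro mult_right_mono) (auto simp: field_simps)
        finally show ?thesis by simp
      qed
    qed
    thus ?thesis unfolding t_def by blast
  qed
  have "conv_radius (fps_nth f) \<ge> \<infinity>"
  proof (rule conv_radius_geI_ex')
    fix r :: real assume r: "0 < r"
    obtain C where C: "\<And>k. cmod (fps_nth f k) * (2 * r) ^ k \<le> C" using bounded[of "2 * r"] r by auto
    show "summable (\<lambda>n. fps_nth f n * complex_of_real r ^ n)"
    proof (rule summable_comparison_test')
      show "summable (\<lambda>n. C * (1 / 2) ^ n)" by (intro summable_mult summable_geometric) simp
      fix n :: nat
      have "norm (fps_nth f n * complex_of_real r ^ n) = cmod (fps_nth f n) * (2 * r) ^ n * (1 / 2) ^ n"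
        using r by (simp add: norm_mult norm_power power_mult_distrib power_divide)
      also have "\<dots> \<le> C * (1 / 2) ^ n" by (intro mult_right_mono C) auto
      finally show "norm (fps_nth f n * complex_of_real r ^ n) \<le> C * (1 / 2) ^ n" .
    qed
  qed
  thus ?thesis by (simp add: fps_conv_radius_def)
qed

text \<open>
  By the usual bound for the roots of a monic polynomial, a function that is integral over \<open>\<complex>[z]\<close> grows
  at most like the coefficients of its equation.
\<close>

lemma integral_entire_is_polynomial:
  fixes f :: "complex fps"
  assumes r: "fps_conv_radius f = \<infinity>"
    and eq: "f ^ N = (\<Sum>j<N. fps_of_poly (Q j) * f ^ j)" and deg: "\<And>j. j < N \<Longrightarrow> Polynomial.degree (Q j) \<le> n"
    and k: "k > n"
  shows "fps_nth f k = 0"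
proof -
  define F where "F = eval_fps f"
  define B where "B = 1 + (\<Sum>j<N. \<Sum>i\<le>n. cmod (poly.coeff (Q j) i))"
  have hol: "F holomorphic_on UNIV" unfolding F_def by (intro holomorphic_intros) (simp add: r)
  have rp: "fps_conv_radius (f ^ j) = \<infinity>" for j
    using fps_conv_radius_power[of f j] by (simp add: r)
  have rm: "fps_conv_radius (fps_of_poly q * f ^ j) = \<infinity>" for q j
    using fps_conv_radius_mult[of "fps_of_poly q" "f ^ j"] by (simp add: rp)
  have sum_eval: "fps_conv_radius (\<Sum>j<M. fps_of_poly (Q j) * f ^ j) = \<infinity> \<and>
      eval_fps (\<Sum>j<M. fps_of_poly (Q j) * f ^ j) z = (\<Sum>j<M. poly (Q j) z * F z ^ j)" for M z
  proof (induct M)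
    case (Suc M)
    have "fps_conv_radius ((\<Sum>j<M. fps_of_poly (Q j) * f ^ j) + fps_of_poly (Q M) * f ^ M) = \<infinity>"
      using fps_conv_radius_add[of "\<Sum>j<M. fps_of_poly (Q j) * f ^ j" "fps_of_poly (Q M) * f ^ M"] Suc rm by simp
    moreover have "eval_fps (fps_of_poly (Q M) * f ^ M) z = poly (Q M) z * F z ^ M"
      by (subst eval_fps_mult) (simp_all add: rp eval_fps_power F_def r)
    ultimately show ?case using Suc rm by (simp add: eval_fps_add)
  qed simp
  have Feq: "F z ^ N = (\<Sum>j<N. poly (Q j) z * F z ^ j)" for z
    using sum_eval[of N z] arg_cong[OF eq, of "\<lambda>g. eval_fps g z"] by (simp add: eval_fps_power r F_def)
  have bound: "norm (F z) \<le> B * norm z ^ n" if z: "1 \<le> norm z" for z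
  proof -
    have Qb: "cmod (poly (Q j) z) \<le> (\<Sum>i\<le>n. cmod (poly.coeff (Q j) i)) * norm z ^ n" if "j < N" for j
    proof -
      have "poly (Q j) z = (\<Sum>i\<le>n. poly.coeff (Q j) i * z ^ i)"
        unfolding poly_altdef using deg[OF that] by (intro sum.mono_neutral_left) (auto simp: not_le coeff_eq_0)
      also have "cmod \<dots> \<le> (\<Sum>i\<le>n. cmod (poly.coeff (Q j) i) * norm z ^ i)"
        by (rule order_trans[OF norm_sum]) (simp add: norm_mult norm_power)
      also have "\<dots> \<le> (\<Sum>i\<le>n. cmod (poly.coeff (Q j) i) * norm z ^ n)"
        using z by (intro sum_mono mult_left_mono power_increasing) auto
      finally show ?thesis by (simp add: sum_distrib_right)
    qed
    have zn: "norm z ^ n \<ge> 1" using z by simp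
    show ?thesis
    proof (cases "norm (F z) \<le> 1")
      case True
      have "1 \<le> B" unfolding B_def by (simp add: sum_nonneg)
      hence "1 * 1 \<le> B * norm z ^ n" using zn by (intro mult_mono) auto
      thus ?thesis using True by simp
    next
      case False
      hence F1: "norm (F z) > 1" by simp
      have N0: "N \<noteq> 0" using Feq[of z] by (intro notI) simp
      then obtain N' where N': "N = Suc N'" by (cases N) auto
      have "norm (F z) * norm (F z) ^ N' = norm (\<Sum>j<N. poly (Q j) z * F z ^ j)"
        using arg_cong[OF Feq[of z], of norm] by (simp add: norm_power norm_mult N')
      also have "\<dots> \<le> (\<Sum>j<N. cmod (poly (Q j) z) * norm (F z) ^ j)"
        by (rule order_trans[OF norm_sum]) (simp add: norm_mult norm_power)
      also have "\<dots> \<le> (\<Sum>j<N. cmod (poly (Q j) z) * norm (F z) ^ N')"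
        using F1 N' by (intro sum_mono mult_left_mono power_increasing) auto
      finally have "norm (F z) * norm (F z) ^ N' \<le> (\<Sum>j<N. cmod (poly (Q j) z)) * norm (F z) ^ N'"
        by (simp add: sum_distrib_right)
      moreover have "0 < norm (F z) ^ N'" using F1 by (intro zero_less_power) linarith
      ultimately have "norm (F z) \<le> (\<Sum>j<N. cmod (poly (Q j) z))" by (rule mult_right_le_imp_le)
      also have "\<dots> \<le> (\<Sum>j<N. (\<Sum>i\<le>n. cmod (poly.coeff (Q j) i)) * norm z ^ n)"
        by (intro sum_mono Qb) auto
      also have "\<dots> = (B - 1) * norm z ^ n" by (simp add: B_def sum_distrib_right)
      also have "\<dots> \<le> B * norm z ^ n" using zn by (intro mult_right_mono) auto
      finally show ?thesis .
    qed
  qed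
  define c where "c j = (deriv ^^ j) F 0 / fact j" for j
  define p where "p = (\<Sum>j\<le>n. monom (c j) j)"
  have "F \<xi> = poly p \<xi>" for \<xi>
    using Liouville_polynomial[OF hol bound, where \<xi>=\<xi>] by (simp add: p_def c_def poly_sum poly_monom)
  hence "F = poly p" by blast
  have "fps_nth f k = (deriv ^^ k) F 0 / fact k"
    by (rule fps_nth_fps_expansion) (simp add: F_def eval_fps_has_fps_expansion r)
  moreover have "fps_nth (fps_of_poly p) k = (deriv ^^ k) F 0 / fact k"
    by (rule fps_nth_fps_expansion) (simp add: \<open>F = poly p\<close> has_fps_expansion_def)
  ultimately have "fps_nth f k = poly.coeff p k" by (simp add: fps_of_poly_nth)
  also have "\<dots> = 0" using k by (simp add: p_def coeff_sum)
  finally show ?thesis .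
qed

lemma iterated_derivation_mult:
  assumes d: "is_derivation d"
  shows "(d ^^ n) (a * b) = (\<Sum>i\<le>n. of_nat (n choose i) * (d ^^ i) a * (d ^^ (n - i)) b)"
proof (induct n)
  case (Suc n)
  note D = derivation_rules[OF d]
  have dn: "d (of_nat c) = 0" for c by (induct c) (simp_all add: D)
  have "(d ^^ Suc n) (a * b) = (\<Sum>i\<le>n. of_nat (n choose i) * ((d ^^ Suc i) a * (d ^^ (n - i)) b + (d ^^ i) a * (d ^^ Suc (n - i)) b))"
    by (simp add: Suc D dn algebra_simps)
  also have "\<dots> = (\<Sum>i\<le>n. of_nat (n choose i) * (d ^^ Suc i) a * (d ^^ (n - i)) b) +
      (\<Sum>i\<le>n. of_nat (n choose i) * (d ^^ i) a * (d ^^ (Suc n - i)) b)"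
    by (simp add: algebra_simps sum.distrib Suc_diff_le)
  also have "(\<Sum>i\<le>n. of_nat (n choose i) * (d ^^ i) a * (d ^^ (Suc n - i)) b) =
      (\<Sum>i\<le>Suc n. of_nat (n choose i) * (d ^^ i) a * (d ^^ (Suc n - i)) b)"
    by (simp add: binomial_eq_0)
  also have "\<dots> = a * (d ^^ Suc n) b + (\<Sum>i\<le>n. of_nat (n choose Suc i) * (d ^^ Suc i) a * (d ^^ (n - i)) b)"
    by (subst sum.atMost_Suc_shift) simp
  also have "(\<Sum>i\<le>n. of_nat (n choose i) * (d ^^ Suc i) a * (d ^^ (n - i)) b) +
     (a * (d ^^ Suc n) b + (\<Sum>i\<le>n. of_nat (n choose Suc i) * (d ^^ Suc i) a * (d ^^ (n - i)) b)) =
     (\<Sum>i\<le>Suc n. of_nat (Suc n choose i) * (d ^^ i) a * (d ^^ (Suc n - i)) b)"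
  proof -
    have "(\<Sum>i\<le>Suc n. of_nat (Suc n choose i) * (d ^^ i) a * (d ^^ (Suc n - i)) b) =
      a * (d ^^ Suc n) b + (\<Sum>i\<le>n. of_nat (Suc n choose Suc i) * (d ^^ Suc i) a * (d ^^ (n - i)) b)"
      by (rule trans[OF sum.atMost_Suc_shift]) simp
    thus ?thesis by (simp add: algebra_simps sum.distrib)
  qed
  finally show ?case .
qed simp

text \<open>
  The expansion of \<open>f\<close> at the point \<open>\<pi>\<close> along the flow of the vector field \<open>d\<close>, as a formal power
  series.  By the Leibniz rule this is a ring homomorphism, and it turns \<open>d\<close> into \<open>d/dz\<close>.
\<close>

definition taylor :: "('b::comm_ring_1 \<Rightarrow> complex) \<Rightarrow> ('b \<Rightarrow> 'b) \<Rightarrow> 'b \<Rightarrow> complex fps" where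
  "taylor \<pi> d f = Abs_fps (\<lambda>k. \<pi> ((d ^^ k) f) / fact k)"

lemma taylor_hom:
  assumes h: "ring_hom_on UNIV \<pi>" and d: "is_derivation d"
  shows "ring_hom_on UNIV (taylor \<pi> d)" and "(fps_deriv ^^ j) (taylor \<pi> d f) = taylor \<pi> d ((d ^^ j) f)"
proof -
  note D = derivation_rules[OF d] and H = hom_on_closed[OF h subring_UNIV]
  have Hn: "\<pi> (of_nat c) = of_nat c" for c by (induct c) (simp_all add: H)
  have it_add: "(d ^^ k) (a + b) = (d ^^ k) a + (d ^^ k) b" for k a b by (induct k) (simp_all add: D)
  have it_1: "(d ^^ k) 1 = (if k = 0 then 1 else 0)" for k by (induct k) (simp_all add: D)
  have mult: "taylor \<pi> d (a * b) = taylor \<pi> d a * taylor \<pi> d b" for a b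
  proof (rule fps_ext)
    fix n
    have "fps_nth (taylor \<pi> d a * taylor \<pi> d b) n
      = (\<Sum>i=0..n. \<pi> ((d ^^ i) a) / fact i * (\<pi> ((d ^^ (n - i)) b) / fact (n - i)))"
      by (simp add: fps_mult_nth taylor_def)
    also have "\<dots> = (\<Sum>i\<le>n. of_nat (n choose i) * \<pi> ((d ^^ i) a) * \<pi> ((d ^^ (n - i)) b)) / fact n"
      unfolding sum_divide_distrib atLeast0AtMost
      by (intro sum.cong) (auto simp: binomial_fact field_simps)
    also have "\<dots> = \<pi> ((d ^^ n) (a * b)) / fact n"
      unfolding iterated_derivation_mult[OF d] by (simp add: H Hn)
    finally show "fps_nth (taylor \<pi> d (a * b)) n = fps_nth (taylor \<pi> d a * taylor \<pi> d b) n"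
      by (simp add: taylor_def)
  qed
  show "ring_hom_on UNIV (taylor \<pi> d)" unfolding ring_hom_on_def
    by (auto simp: mult) (auto simp: taylor_def fps_eq_iff it_add it_1 H add_divide_distrib)
  show "(fps_deriv ^^ j) (taylor \<pi> d f) = taylor \<pi> d ((d ^^ j) f)"
  proof (induct j arbitrary: f)
    case (Suc j)
    have "fps_deriv (taylor \<pi> d g) = taylor \<pi> d (d g)" for g
      by (simp add: taylor_def fps_eq_iff funpow_swap1 fact_reduce field_simps del: of_nat_Suc)
    thus ?case using Suc by simp
  qed simp
qed

text \<open>
  The elements \<open>s\<close> and \<open>t\<close> have constant expansions, and those of \<open>P j\<close> and \<open>Q j\<close> are polynomials of
  degree at most \<open>n\<close>.  So the expansion of \<open>f\<close> is entire and integral over \<open>\<complex>[z]\<close>, whence it is a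
  polynomial of degree at most \<open>n\<close>.  It is essential that this bound does not depend on \<open>\<pi>\<close>.
\<close>

theorem integral_ode_vanishing:
  fixes d :: "'b::comm_ring_1 \<Rightarrow> 'b" and \<pi> :: "'b \<Rightarrow> complex"
  assumes h: "ring_hom_on UNIV \<pi>" and d: "is_derivation d"
    and s: "d s = 0" "\<pi> s \<noteq> 0" and t: "d t = 0" "\<pi> t \<noteq> 0"
    and P: "\<And>j i. j < m \<Longrightarrow> i > n \<Longrightarrow> (d ^^ i) (P j) = 0" and Q: "\<And>j i. j < N \<Longrightarrow> i > n \<Longrightarrow> (d ^^ i) (Q j) = 0"
    and ode: "s * (d ^^ m) f = (\<Sum>j<m. P j * (d ^^ j) f)"
    and int: "t * f ^ N = (\<Sum>j<N. Q j * f ^ j)"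
    and k: "k > n"
  shows "\<pi> ((d ^^ k) f) = 0"
proof -
  let ?T = "taylor \<pi> d"
  note T = hom_on_closed[OF taylor_hom(1)[OF h d] subring_UNIV]
  have const: "?T g = fps_const (\<pi> g)" if "d g = 0" for g
  proof -
    have "(d ^^ k) g = 0" if "k \<noteq> 0" for k
    proof (cases k)
      case (Suc l)
      have "(d ^^ l) 0 = 0" by (induct l) (simp_all add: deriv_0[OF d])
      thus ?thesis using Suc \<open>d g = 0\<close> by (simp add: funpow_swap1)
    qed (use that in simp)
    thus ?thesis using hom_on_0[OF h subring_UNIV] by (auto simp: taylor_def fps_eq_iff)
  qed
  define tp where "tp g = (\<Sum>i\<le>n. monom (\<pi> ((d ^^ i) g) / fact i) i)" for g
  have tp: "?T g = fps_of_poly (tp g)" if "\<And>i. i > n \<Longrightarrow> (d ^^ i) g = 0" for g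
    using that hom_on_0[OF h subring_UNIV] by (auto simp: taylor_def fps_eq_iff tp_def coeff_sum)
  have tpd: "Polynomial.degree (Polynomial.smult c (tp g)) \<le> n" for g c
    unfolding tp_def by (intro degree_le) (auto simp: coeff_sum)
  have inv: "?T g = fps_const (inverse (\<pi> s)) * ?T (s * g)" if "d s = 0" "\<pi> s \<noteq> 0" for s g
    using that by (simp add: T const mult.assoc[symmetric])
  have "(fps_deriv ^^ m) (?T f) = fps_const (inverse (\<pi> s)) * ?T (s * (d ^^ m) f)"
    unfolding taylor_hom(2)[OF h d] by (rule inv[OF s])
  also have "\<dots> = (\<Sum>j<m. fps_of_poly (Polynomial.smult (inverse (\<pi> s)) (tp (P j))) * (fps_deriv ^^ j) (?T f))"
    unfolding ode by (simp add: T tp[OF P] taylor_hom(2)[OF h d] sum_distrib_left fps_of_poly_smult ac_simps)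
  finally have "fps_conv_radius (?T f) = \<infinity>" by (rule poly_ode_entire)
  moreover have "?T f ^ N = (\<Sum>j<N. fps_of_poly (Polynomial.smult (inverse (\<pi> t)) (tp (Q j))) * ?T f ^ j)"
  proof -
    have "?T f ^ N = fps_const (inverse (\<pi> t)) * ?T (t * f ^ N)" using inv[OF t, of "f ^ N"] by (simp add: T)
    thus ?thesis unfolding int by (simp add: T tp[OF Q] sum_distrib_left fps_of_poly_smult ac_simps)
  qed
  ultimately have "fps_nth (?T f) k = 0"
    by (rule integral_entire_is_polynomial) (use k tpd in auto)
  thus ?thesis by (simp add: taylor_def)
qed

section \<open>Algebraic dependence and valuation rings over the complex numbers\<close>

locale const_field = field_ext \<kappa> for \<kappa> :: "complex \<Rightarrow> 'l::field"
begin

definition ev :: "'l \<Rightarrow> complex poly \<Rightarrow> 'l" where "ev u p = poly (map_poly \<kappa> p) u"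

lemma ev_simps [simp]:
  "ev u (p + q) = ev u p + ev u q" "ev u (p * q) = ev u p * ev u q" "ev u 0 = 0" "ev u 1 = 1"
  "ev u [:c:] = \<kappa> c" "ev u (pCons c p) = \<kappa> c + u * ev u p" "ev u (- p) = - ev u p" "ev u (p - q) = ev u p - ev u q"
  "ev u (Polynomial.smult c p) = \<kappa> c * ev u p" "ev u (p ^ n) = ev u p ^ n" "ev u (sum P I) = (\<Sum>i\<in>I. ev u (P i))"
proof -
  show a: "ev u (p + q) = ev u p + ev u q" for p q by (simp add: ev_def map_poly_h)
  show z: "ev u 0 = 0" by (simp add: ev_def)
  show m: "ev u (p * q) = ev u p * ev u q" for p q by (simp add: ev_def map_poly_h)
  show o: "ev u 1 = 1" by (simp add: ev_def one_pCons map_poly_h)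
  show "ev u (pCons c p) = \<kappa> c + u * ev u p" for c p by (simp add: ev_def map_poly_h)
  show c: "ev u [:c:] = \<kappa> c" for c by (simp add: ev_def map_poly_h)
  show n: "ev u (- p) = - ev u p" for p using a[of p "- p"] z by (simp add: add_eq_0_iff)
  show "ev u (p - q) = ev u p - ev u q" for p q using a[of p "- q"] n by simp
  show "ev u (Polynomial.smult c p) = \<kappa> c * ev u p" for c p using m[of "[:c:]" p] c by simp
  show "ev u (p ^ n) = ev u p ^ n" by (induct n) (simp_all add: m o)
  show "ev u (sum P I) = (\<Sum>i\<in>I. ev u (P i))" by (induct I rule: infinite_finite_induct) (simp_all add: a z)
qed

lemma ev_monom: "ev u (monom c n) = \<kappa> c * u ^ n"
  by (induct n) (simp_all add: monom_0 monom_Suc)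

lemma ev_altdef: "Polynomial.degree p \<le> n \<Longrightarrow> ev u p = (\<Sum>i\<le>n. \<kappa> (poly.coeff p i) * u ^ i)"
  by (subst poly_as_sum_of_monoms'[symmetric]) (simp_all add: ev_monom)

abbreviation K where "K \<equiv> range \<kappa>"



lemma \<kappa>_inject [simp]: "\<kappa> a = \<kappa> b \<longleftrightarrow> a = b"
  using h_eq_0[of "a - b"] by (simp del: h_eq_0)

lemma \<kappa>_inverse: "\<kappa> (inverse c) = inverse (\<kappa> c)"
proof (cases "c = 0")
  case False
  have "\<kappa> c * \<kappa> (inverse c) = 1" using False by (metis h_simps(2,4) right_inverse)
  thus ?thesis by (metis inverse_unique)
qed simp

lemma K_closed: "\<kappa> c \<in> K" "1 \<in> K" "0 \<in> K" "u \<in> K \<Longrightarrow> inverse u \<in> K"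
  by (auto intro: range_eqI[of _ _ 1] range_eqI[of _ _ 0] range_eqI[of _ _ "inverse _"] simp: \<kappa>_inverse)

lemma K_subring: "is_subring K"
  unfolding is_subring_def
proof (intro conjI ballI; (elim imageE)?)
  show "1 \<in> K" by (rule K_closed)
  fix a b c e assume "a = \<kappa> c" "b = \<kappa> e"
  hence "a - b = \<kappa> (c - e)" "a * b = \<kappa> (c * e)" by auto
  thus "a - b \<in> K" "a * b \<in> K" by (metis rangeI)+
qed

lemma adjoin_K: "adjoin K u = range (ev u)"
proof
  show "adjoin K u \<subseteq> range (ev u)"
  proof
    fix v assume "v \<in> adjoin K u"
    then obtain p where p: "p \<in> polys_over K" "v = poly p u" by (auto simp: adjoin_def)
    have "\<exists>q. v = ev u q" unfolding p(2) using p(1)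
    proof (induct p)
      case 0
      show ?case by (intro exI[of _ 0]) simp
    next
      case (pCons c p)
      have "c \<in> K" using polys_over_coeff[OF pCons(3), of 0] by simp
      moreover have "p \<in> polys_over K"
        unfolding polys_over_def using polys_over_coeff[OF pCons(3), of "Suc i" for i] by simp
      ultimately obtain e q where "c = \<kappa> e" "poly p u = ev u q" using pCons(2) by auto
      thus ?case by (intro exI[of _ "pCons e q"]) simp
    qed
    thus "v \<in> range (ev u)" by blast
  qed
  show "range (ev u) \<subseteq> adjoin K u"
    unfolding adjoin_def ev_def by (auto simp: polys_over_def map_poly_h intro!: imageI)
qed

text \<open>
  Over the complex numbers a polynomial is a product of linear factors, so a prime-like property of
  the value of a nonzero polynomial at \<open>u\<close> passes to some \<open>u - \<mu>\<close>.  This is used for being zero and for being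
  divisible by a prime element.
\<close>

lemma root_predicate:
  assumes mult: "\<And>v w. v \<in> range (ev u) \<Longrightarrow> w \<in> range (ev u) \<Longrightarrow> P (v * w) \<Longrightarrow> P v \<or> P w"
    and const: "\<And>c. P (\<kappa> c) \<Longrightarrow> c = 0"
    and q: "q \<noteq> 0" "P (ev u q)"
  shows "\<exists>\<mu>. poly q \<mu> = 0 \<and> P (u - \<kappa> \<mu>)"
  using q
proof (induct "Polynomial.degree q" arbitrary: q)
  case 0
  then obtain c where "q = [:c:]" by (auto elim: degree_eq_zeroE)
  thus ?case using 0 const[of c] by auto
next
  case (Suc n)
  obtain \<mu> where \<mu>: "poly q \<mu> = 0" using alg_closed_imp_poly_has_root[of q] Suc by auto
  then obtain r where r: "q = [:- \<mu>, 1:] * r" by (auto simp: poly_eq_0_iff_dvd dvd_def)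
  have r0: "r \<noteq> 0" using r Suc by auto
  have dr: "n = Polynomial.degree r" using Suc(2) r r0 by (simp add: degree_mult_eq del: mult_pCons_left)
  have e: "ev u q = (u - \<kappa> \<mu>) * ev u r" unfolding r ev_simps(2) by simp
  have "u - \<kappa> \<mu> \<in> range (ev u)" by (rule range_eqI[of _ _ "[:- \<mu>, 1:]"]) simp
  hence "P (u - \<kappa> \<mu>) \<or> P (ev u r)" using mult[of "u - \<kappa> \<mu>" "ev u r"] Suc(4) unfolding e by auto
  thus ?case
  proof
    assume "P (ev u r)"
    from Suc(1)[OF dr r0 this] show ?thesis unfolding r by (auto simp del: mult_pCons_left)
  qed (use \<mu> in auto)
qed

lemma ev_eq_0: "u \<notin> K \<Longrightarrow> ev u q = 0 \<longleftrightarrow> q = 0"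
  using root_predicate[of u "\<lambda>v. v = 0" q] by auto

definition ev2 :: "'l \<Rightarrow> 'l \<Rightarrow> complex poly poly \<Rightarrow> 'l" where
  "ev2 u v P = (\<Sum>i\<le>Polynomial.degree P. ev u (poly.coeff P i) * v ^ i)"

text \<open>
  Algebraic dependence is expressed by a nonzero polynomial in two variables, because in this form it
  is symmetric.
\<close>

definition dependent2 :: "'l \<Rightarrow> 'l \<Rightarrow> bool" where
  "dependent2 u v \<longleftrightarrow> (\<exists>P. P \<noteq> 0 \<and> ev2 u v P = 0)"

lemma ev2_bound: "Polynomial.degree P \<le> n \<Longrightarrow> ev2 u v P = (\<Sum>i\<le>n. ev u (poly.coeff P i) * v ^ i)"
  unfolding ev2_def by (rule sum.mono_neutral_left) (auto simp: coeff_eq_0 not_le)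

lemma dependent2_sym:
  assumes "dependent2 u v"
  shows "dependent2 v u"
proof -
  obtain P where P: "P \<noteq> 0" "ev2 u v P = 0" using assms by (auto simp: dependent2_def)
  define n where "n = Polynomial.degree P"
  define m where "m = Max (insert 0 ((\<lambda>i. Polynomial.degree (poly.coeff P i)) ` {..n}))"
  have m: "Polynomial.degree (poly.coeff P i) \<le> m" for i
  proof (cases "i \<le> n")
    case True
    thus ?thesis unfolding m_def by (intro Max_ge) auto
  qed (simp add: n_def coeff_eq_0)
  define Q where "Q = (\<Sum>j\<le>m. monom (\<Sum>i\<le>n. monom (poly.coeff (poly.coeff P i) j) i) j)"
  have cQ: "poly.coeff Q j = (if j \<le> m then (\<Sum>i\<le>n. monom (poly.coeff (poly.coeff P i) j) i) else 0)" for j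
    unfolding Q_def coeff_sum coeff_monom by (simp add: sum.delta)
  have ccQ: "poly.coeff (poly.coeff Q j) i = (if j \<le> m \<and> i \<le> n then poly.coeff (poly.coeff P i) j else 0)" for i j
    unfolding cQ by (simp add: coeff_sum coeff_monom sum.delta)
  have "Q \<noteq> 0"
  proof
    assume Q: "Q = 0"
    have "poly.coeff (poly.coeff P i) j = 0" for i j
    proof (cases "j \<le> m \<and> i \<le> n")
      case True
      thus ?thesis using ccQ[of j i] Q by simp
    next
      case False
      thus ?thesis using m[of i] by (auto simp: n_def not_le coeff_eq_0)
    qed
    hence "P = 0" by (metis leading_coeff_0_iff)
    thus False using P by simp
  qed
  moreover have "ev2 v u Q = 0"
  proof -
    have "Polynomial.degree Q \<le> m" by (rule degree_le) (simp add: cQ)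
    hence "ev2 v u Q = (\<Sum>j\<le>m. ev v (poly.coeff Q j) * u ^ j)" by (rule ev2_bound)
    also have "\<dots> = (\<Sum>j\<le>m. \<Sum>i\<le>n. \<kappa> (poly.coeff (poly.coeff P i) j) * v ^ i * u ^ j)"
      by (simp add: cQ ev_monom sum_distrib_right)
    also have "\<dots> = (\<Sum>i\<le>n. \<Sum>j\<le>m. \<kappa> (poly.coeff (poly.coeff P i) j) * u ^ j * v ^ i)"
      by (subst sum.swap) (simp add: ac_simps)
    also have "\<dots> = (\<Sum>i\<le>n. ev u (poly.coeff P i) * v ^ i)"
      by (simp add: ev_altdef[OF m] sum_distrib_right)
    also have "\<dots> = 0" using P(2) by (simp add: ev2_def n_def)
    finally show ?thesis .
  qed
  ultimately show ?thesis by (auto simp: dependent2_def)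
qed

text \<open>
  Substituting \<open>f = g h\<close> in a relation between \<open>g\<close> and \<open>f\<close> gives a relation between \<open>g\<close> and \<open>h\<close>.
\<close>

lemma dependent2_divide:
  assumes dep: "dependent2 g f" and g: "g \<noteq> 0"
  shows "dependent2 g (f / g)"
proof -
  obtain P where P: "P \<noteq> 0" "ev2 g f P = 0" using dep by (auto simp: dependent2_def)
  define n where "n = Polynomial.degree P"
  define Q where "Q = (\<Sum>i\<le>n. monom (poly.coeff P i * monom 1 i) i)"
  have cQ: "poly.coeff Q i = (if i \<le> n then poly.coeff P i * monom 1 i else 0)" for i
    unfolding Q_def coeff_sum coeff_monom by (simp add: sum.delta)
  have "poly.coeff Q n \<noteq> 0" using P by (simp add: cQ n_def)
  hence "Q \<noteq> 0" by auto
  moreover have "ev2 g (f / g) Q = 0"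
  proof -
    have "Polynomial.degree Q \<le> n" by (rule degree_le) (simp add: cQ)
    hence "ev2 g (f / g) Q = (\<Sum>i\<le>n. ev g (poly.coeff Q i) * (f / g) ^ i)" by (rule ev2_bound)
    also have "\<dots> = (\<Sum>i\<le>n. ev g (poly.coeff P i) * f ^ i)"
      using g by (intro sum.cong) (auto simp: cQ ev_monom power_divide)
    finally show ?thesis using P(2) by (simp add: ev2_def n_def)
  qed
  ultimately show ?thesis by (auto simp: dependent2_def)
qed

text \<open>
  Multiplication by the leading coefficient makes an algebraic element integral.
\<close>

lemma dependent2_integral:
  assumes dep: "dependent2 u v" and u: "u \<notin> K"
  obtains l n C where "l \<noteq> 0" "n > 0" "(ev u l * v) ^ n = (\<Sum>i<n. ev u (C i) * (ev u l * v) ^ i)"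
proof -
  obtain P where P: "P \<noteq> 0" "ev2 u v P = 0" using dep by (auto simp: dependent2_def)
  define n where "n = Polynomial.degree P"
  define l where "l = poly.coeff P n"
  have l0: "l \<noteq> 0" using P by (simp add: l_def n_def)
  have eq: "ev u l * v ^ n = - (\<Sum>i<n. ev u (poly.coeff P i) * v ^ i)"
    using P(2) by (simp add: ev2_def n_def l_def lessThan_Suc_atMost[symmetric] add_eq_0_iff)
  have n0: "n > 0"
  proof (rule ccontr)
    assume "\<not> n > 0"
    hence "ev u l = 0" using eq by simp
    thus False using l0 u by (simp add: ev_eq_0)
  qed
  have "(ev u l * v) ^ n = ev u l ^ (n - 1) * (ev u l * v ^ n)"
    using n0 by (cases n) (simp_all add: power_mult_distrib ac_simps)
  also have "\<dots> = (\<Sum>i<n. ev u (- poly.coeff P i * l ^ (n - 1 - i)) * (ev u l * v) ^ i)"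
    unfolding eq sum_negf[symmetric] sum_distrib_left
  proof (rule sum.cong[OF refl])
    fix i assume "i \<in> {..<n}"
    hence "n - 1 = (n - 1 - i) + i" by auto
    hence "ev u l ^ (n - 1) = ev u l ^ (n - 1 - i) * ev u l ^ i" by (metis power_add)
    thus "ev u l ^ (n - 1) * - (ev u (poly.coeff P i) * v ^ i)
        = ev u (- poly.coeff P i * l ^ (n - 1 - i)) * (ev u l * v) ^ i"
      by (simp add: power_mult_distrib ac_simps)
  qed
  finally show ?thesis using that[OF l0 n0, of "\<lambda>i. - poly.coeff P i * l ^ (n - 1 - i)"] by simp
qed

end

text \<open>
  Valuations are represented by their rings.  \<open>unit\<close> singles out the elements of order zero, and
  \<open>nonunit\<close> the maximal ideal.
\<close>

locale subfield_with_constants = const_field \<kappa> for \<kappa> :: "complex \<Rightarrow> 'l::field" +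
  fixes M :: "'l set"
  assumes M: "is_subring M" "\<And>u. u \<in> M \<Longrightarrow> inverse u \<in> M" "range \<kappa> \<subseteq> M"
begin

definition valring :: "'l set \<Rightarrow> bool" where
  "valring V \<longleftrightarrow> is_subring V \<and> V \<subseteq> M \<and> K \<subseteq> V \<and> (\<forall>u\<in>M. u \<in> V \<or> inverse u \<in> V)"

definition unit :: "'l set \<Rightarrow> 'l \<Rightarrow> bool" where "unit V u \<longleftrightarrow> u \<noteq> 0 \<and> u \<in> V \<and> inverse u \<in> V"
definition nonunit :: "'l set \<Rightarrow> 'l \<Rightarrow> bool" where "nonunit V u \<longleftrightarrow> u \<in> V \<and> \<not> unit V u"

context
  fixes V assumes V: "valring V"
begin

lemma val_subring: "is_subring V" and val_sub: "V \<subseteq> M" and val_K: "\<kappa> c \<in> V"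
  and val_cases: "u \<in> M \<Longrightarrow> u \<in> V \<or> inverse u \<in> V"
  using V by (auto simp: valring_def)

lemmas val_closed = subring_closed[OF val_subring]

lemma unit_closed: "unit V u \<Longrightarrow> unit V v \<Longrightarrow> unit V (u * v)" "unit V u \<Longrightarrow> unit V (inverse u)"
  "unit V u \<Longrightarrow> unit V (u ^ n)" "unit V u \<Longrightarrow> unit V (u powi k)" "c \<noteq> 0 \<Longrightarrow> unit V (\<kappa> c)"
  "finite I \<Longrightarrow> (\<And>i. i \<in> I \<Longrightarrow> unit V (w i)) \<Longrightarrow> unit V (prod w I)"
proof -
  show m: "unit V (u * v)" if "unit V u" "unit V v" for u v using that val_closed by (auto simp: unit_def)
  show i: "unit V (inverse u)" if "unit V u" for u using that by (auto simp: unit_def)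
  have o: "unit V 1" using val_closed by (auto simp: unit_def)
  show p: "unit V (u ^ n)" if "unit V u" for u n by (induct n) (use that m o in auto)
  show "unit V (u powi k)" if "unit V u" using p i that by (simp add: power_int_def)
  show "unit V (\<kappa> c)" if "c \<noteq> 0" using that val_K by (simp add: unit_def \<kappa>_inverse[symmetric])
  show "unit V (prod w I)" if "finite I" "\<And>i. i \<in> I \<Longrightarrow> unit V (w i)" using that by induct (use m o in auto)
qed

lemma nonunit_mult: "nonunit V u \<Longrightarrow> v \<in> V \<Longrightarrow> nonunit V (u * v)"
proof -
  assume u: "nonunit V u" and v: "v \<in> V"
  have "\<not> unit V (u * v)"
  proof
    assume a: "unit V (u * v)"
    hence "v * inverse (u * v) \<in> V" using v val_closed by (auto simp: unit_def)
    moreover have "v * inverse (u * v) = inverse u" using a by (auto simp: unit_def)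
    ultimately have "inverse u \<in> V" by (simp only:)
    thus False using u a by (auto simp: unit_def nonunit_def)
  qed
  thus ?thesis using u v val_closed by (auto simp: nonunit_def)
qed

lemma nonunit_0: "nonunit V 0" using val_closed by (simp add: nonunit_def unit_def)

lemma nonunit_add:
  assumes u: "nonunit V u" and v: "nonunit V v"
  shows "nonunit V (u + v)"
proof (cases "u = 0 \<or> v = 0")
  case False
  have uv: "u \<in> V" "v \<in> V" using u v by (auto simp: nonunit_def)
  hence "u * inverse v \<in> V \<or> inverse (u * inverse v) \<in> V"
    using val_cases[of "u * inverse v"] val_sub M subring_mult[OF M(1), of u "inverse v"] by auto
  thus ?thesis
  proof
    assume "u * inverse v \<in> V"
    hence "1 + u * inverse v \<in> V" using val_closed by auto
    hence "nonunit V (v * (1 + u * inverse v))" by (rule nonunit_mult[OF v])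
    moreover have "v * (1 + u * inverse v) = u + v" using False by (simp add: field_simps)
    ultimately show ?thesis by simp
  next
    assume "inverse (u * inverse v) \<in> V"
    hence "1 + v * inverse u \<in> V" using val_closed by (auto simp: ac_simps)
    hence "nonunit V (u * (1 + v * inverse u))" by (rule nonunit_mult[OF u])
    moreover have "u * (1 + v * inverse u) = u + v" using False by (simp add: field_simps)
    ultimately show ?thesis by simp
  qed
qed (use u v in auto)

lemma nonunit_sum: "(\<And>i. i \<in> I \<Longrightarrow> nonunit V (w i)) \<Longrightarrow> nonunit V (sum w I)"
  by (induct I rule: infinite_finite_induct) (auto intro: nonunit_0 nonunit_add)

lemma nonunit_uminus: "nonunit V u \<Longrightarrow> nonunit V (- u)"
  using nonunit_mult[of u "- 1"] val_closed by simp

lemma unit_add_nonunit: "unit V u \<Longrightarrow> nonunit V v \<Longrightarrow> unit V (u + v)"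
proof (rule ccontr)
  assume u: "unit V u" and v: "nonunit V v" and n: "\<not> unit V (u + v)"
  have "u + v \<in> V" using u v val_closed by (auto simp: unit_def nonunit_def)
  hence "nonunit V (u + v)" using n by (simp add: nonunit_def)
  hence "nonunit V (u + v + - v)" by (rule nonunit_add[OF _ nonunit_uminus[OF v]])
  hence "nonunit V u" by (simp only: add.assoc add.right_inverse add.right_neutral)
  thus False using u by (simp add: nonunit_def)
qed

lemma not_in_V: "u \<in> M \<Longrightarrow> u \<notin> V \<Longrightarrow> nonunit V (inverse u)"
  using val_cases[of u] by (auto simp: nonunit_def unit_def)

lemma integrally_closed:
  assumes u: "u \<in> M" and C: "\<And>i. i < n \<Longrightarrow> C i \<in> V" and eq: "u ^ n = (\<Sum>i<n. C i * u ^ i)"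
  shows "u \<in> V"
proof (rule ccontr)
  assume n: "u \<notin> V"
  hence i: "inverse u \<in> V" and u0: "u \<noteq> 0" using val_cases[OF u] val_closed by auto
  have "n \<noteq> 0" using eq by (intro notI) simp
  then obtain m where m: "n = Suc m" by (cases n) auto
  have "u = u ^ n * inverse u ^ m" using u0 by (simp add: m power_inverse)
  also have "\<dots> = (\<Sum>i<n. C i * inverse u ^ (m - i))"
    unfolding eq sum_distrib_right
  proof (rule sum.cong[OF refl])
    fix i assume "i \<in> {..<n}"
    hence "m = i + (m - i)" using m by auto
    hence "inverse u ^ m = inverse u ^ i * inverse u ^ (m - i)" by (metis power_add)
    thus "C i * u ^ i * inverse u ^ m = C i * inverse u ^ (m - i)" using u0 by (simp add: power_inverse)
  qed
  also have "\<dots> \<in> V" using C i val_closed by (intro val_closed(8)) auto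
  finally show False using n by simp
qed

lemma root_in_V: "u \<in> M \<Longrightarrow> u ^ q \<in> V \<Longrightarrow> q > 0 \<Longrightarrow> u \<in> V"
proof -
  assume "u \<in> M" "u ^ q \<in> V" "q > 0"
  have "u ^ q = (\<Sum>i<q. (if i = 0 then u ^ q else 0) * u ^ i)"
    using \<open>q > 0\<close> by (simp add: if_distrib[of "\<lambda>x. x * _"] sum.delta cong: if_cong)
  thus "u \<in> V" using integrally_closed[OF \<open>u \<in> M\<close>, of q "\<lambda>i. if i = 0 then u ^ q else 0"] \<open>u ^ q \<in> V\<close> val_closed
    by simp
qed

lemma ev_in_V: "u \<in> V \<Longrightarrow> ev u p \<in> V"
  by (induct p) (use val_closed val_K in auto)

end


text \<open>
  \<open>ideal_rep V t a m\<close> means that 1 lies in the ideal of \<open>V[a]\<close> generated by \<open>t\<close>, with a witness of degree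
  at most \<open>m\<close> in \<open>a\<close>.
\<close>

definition ideal_rep :: "'l set \<Rightarrow> 'l \<Rightarrow> 'l \<Rightarrow> nat \<Rightarrow> bool" where
  "ideal_rep V t a m \<longleftrightarrow> (\<exists>\<alpha>. (\<forall>i. \<exists>v\<in>V. \<alpha> i = t * v) \<and> 1 = (\<Sum>i\<le>m. \<alpha> i * a ^ i))"

text \<open>
  The representation in terms of \<open>1 / a\<close> can be solved for 1 without using a constant term, since \<open>1 - t v\<close>
  is invertible; multiplied by \<open>a\<^sup>m\<close> it allows to eliminate the top power of \<open>a\<close>.
\<close>

lemma ideal_rep_reduce:
  assumes V: "is_subring V" and t: "t \<in> V" and inv: "\<And>v. v \<in> V \<Longrightarrow> 1 - t * v \<noteq> 0 \<and> inverse (1 - t * v) \<in> V"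
    and a: "a \<noteq> 0" and rep: "ideal_rep V t a m" "ideal_rep V t (inverse a) n" and nm: "n \<le> m"
  shows "\<exists>m'<m. ideal_rep V t a m'"
proof -
  note C = subring_closed[OF V]
  obtain \<alpha> where \<alpha>: "\<And>i. \<exists>v\<in>V. \<alpha> i = t * v" "1 = (\<Sum>i\<le>m. \<alpha> i * a ^ i)" using rep(1) by (auto simp: ideal_rep_def)
  obtain \<beta> where \<beta>: "\<And>i. \<exists>v\<in>V. \<beta> i = t * v" "1 = (\<Sum>i\<le>n. \<beta> i * inverse a ^ i)" using rep(2) by (auto simp: ideal_rep_def)
  obtain b where b: "b \<in> V" "\<beta> 0 = t * b" using \<beta>(1) by blast
  define w where "w = inverse (1 - \<beta> 0)"
  have w: "w \<in> V" "1 - \<beta> 0 \<noteq> 0" using inv[OF b(1)] b by (auto simp: w_def)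
  have n0: "n \<noteq> 0"
  proof
    assume "n = 0"
    hence "\<beta> 0 = 1" using \<beta>(2) by simp
    thus False using w by simp
  qed
  then obtain n' where n': "n = Suc n'" by (cases n) auto
  obtain m' where m': "m = Suc m'" using n0 nm by (cases m) auto
  have "1 - \<beta> 0 = (\<Sum>j\<le>n'. \<beta> (Suc j) * inverse a ^ Suc j)"
    using \<beta>(2) unfolding n' sum.atMost_Suc_shift by (simp add: algebra_simps)
  hence "w * (1 - \<beta> 0) = (\<Sum>j\<le>n'. w * \<beta> (Suc j) * inverse a ^ Suc j)" by (simp add: sum_distrib_left ac_simps)
  hence one: "1 = (\<Sum>j\<le>n'. w * \<beta> (Suc j) * inverse a ^ Suc j)" using w by (simp add: w_def)
  have am: "a ^ m = (\<Sum>j\<le>n'. w * \<beta> (Suc j) * a ^ (m' - j))"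
  proof -
    have "a ^ m = (\<Sum>j\<le>n'. w * \<beta> (Suc j) * inverse a ^ Suc j) * a ^ m" using one by simp
    also have "\<dots> = (\<Sum>j\<le>n'. w * \<beta> (Suc j) * a ^ (m' - j))"
      unfolding sum_distrib_right
    proof (rule sum.cong[OF refl])
      fix j assume "j \<in> {..n'}"
      hence "m = Suc j + (m' - j)" using nm m' n' by auto
      hence "a ^ m = a ^ Suc j * a ^ (m' - j)" by (metis power_add)
      thus "w * \<beta> (Suc j) * inverse a ^ Suc j * a ^ m = w * \<beta> (Suc j) * a ^ (m' - j)"
        using a by (simp add: power_inverse del: power_Suc)
    qed
    finally show ?thesis .
  qed
  have reidx: "(\<Sum>j\<le>n'. w * \<beta> (Suc j) * a ^ (m' - j)) = (\<Sum>i\<le>m'. (if m' - i \<le> n' then w * \<beta> (Suc (m' - i)) else 0) * a ^ i)"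
  proof -
    have "(\<Sum>j\<le>n'. w * \<beta> (Suc j) * a ^ (m' - j)) = (\<Sum>j\<le>m'. (if j \<le> n' then w * \<beta> (Suc j) else 0) * a ^ (m' - j))"
      using nm m' n' by (intro sum.mono_neutral_cong_left) auto
    also have "\<dots> = (\<Sum>i\<le>m'. (if m' - i \<le> n' then w * \<beta> (Suc (m' - i)) else 0) * a ^ (m' - (m' - i)))"
      by (rule sum.reindex_bij_witness[of _ "\<lambda>i. m' - i" "\<lambda>j. m' - j"]) auto
    also have "\<dots> = (\<Sum>i\<le>m'. (if m' - i \<le> n' then w * \<beta> (Suc (m' - i)) else 0) * a ^ i)"
      by (intro sum.cong) auto
    finally show ?thesis .
  qed
  define \<gamma> where "\<gamma> i = \<alpha> i + \<alpha> m * (if m' - i \<le> n' then w * \<beta> (Suc (m' - i)) else 0)" for i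
  have "1 = (\<Sum>i\<le>m'. \<alpha> i * a ^ i) + \<alpha> m * a ^ m" using \<alpha>(2) by (simp add: m')
  also have "\<dots> = (\<Sum>i\<le>m'. \<gamma> i * a ^ i)"
    unfolding am reidx by (simp add: \<gamma>_def algebra_simps sum.distrib sum_distrib_left)
  finally have "1 = (\<Sum>i\<le>m'. \<gamma> i * a ^ i)" .
  moreover have "\<exists>v\<in>V. \<gamma> i = t * v" for i
  proof -
    obtain v1 v2 v3 where v: "v1 \<in> V" "\<alpha> i = t * v1" "v2 \<in> V" "\<alpha> m = t * v2" "v3 \<in> V" "\<beta> (Suc (m' - i)) = t * v3"
      using \<alpha>(1) \<beta>(1) by metis
    have tV: "t * v3 \<in> V" using t v C by auto
    have "w * (t * v3) \<in> V" by (intro C w tV)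
    hence "v1 + v2 * (if m' - i \<le> n' then w * (t * v3) else 0) \<in> V" using v C by simp
    moreover have "\<gamma> i = t * (v1 + v2 * (if m' - i \<le> n' then w * (t * v3) else 0))"
      using v by (simp add: \<gamma>_def algebra_simps)
    ultimately show ?thesis by blast
  qed
  ultimately have "ideal_rep V t a m'" unfolding ideal_rep_def by blast
  thus ?thesis using m' by blast
qed


text \<open>
  Every non-constant function \<open>b\<close> has a pole.  Let \<open>t = 1 / b\<close>.  A subring \<open>V\<close> that is maximal among
  those that contain \<open>\<complex>[t]\<close> but not \<open>b\<close> is a valuation ring: if neither \<open>u\<close> nor \<open>1 / u\<close> were in \<open>V\<close>,
  then \<open>b\<close> would lie in \<open>V[u]\<close> and in \<open>V[1 / u]\<close>, and comparing representations of least degree leads to a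
  contradiction.
\<close>

lemma valring_avoiding:
  assumes b: "b \<in> M" "b \<notin> K"
  obtains V where "valring V" "b \<notin> V"
proof -
  define t where "t = inverse b"
  have b0: "b \<noteq> 0" using b K_closed(3) by auto
  have bt: "b * t = 1" using b0 by (simp add: t_def)
  have tK: "t \<notin> K" using b(2) K_closed(4)[of t] by (auto simp: t_def)
  define Z where "Z = {S. is_subring S \<and> K \<subseteq> S \<and> S \<subseteq> M \<and> t \<in> S \<and> b \<notin> S}"
  note At = adjoin_subring[OF K_subring, of t]
  have "b \<notin> adjoin K t"
  proof
    assume "b \<in> adjoin K t"
    then obtain p where p: "b = ev t p" by (auto simp: adjoin_K)
    have "ev t (pCons (- 1) p) = 0" using bt p by (simp add: mult.commute)
    hence "pCons (- 1) p = 0" using tK by (simp add: ev_eq_0 del: ev_simps)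
    thus False by simp
  qed
  moreover have "adjoin K t \<subseteq> M" using M b by (intro adjoin_least) (auto simp: t_def)
  ultimately have ne: "adjoin K t \<in> Z" using At by (auto simp: Z_def)
  have "\<exists>V\<in>Z. \<forall>S\<in>Z. V \<subseteq> S \<longrightarrow> S = V"
  proof (rule subset_Zorn_nonempty)
    show "Z \<noteq> {}" using ne by auto
    fix \<C> assume ne: "\<C> \<noteq> {}" and ch: "subset.chain Z \<C>"
    have CZ: "S \<in> Z" if "S \<in> \<C>" for S using that ch by (auto simp: subset.chain_def)
    have lin: "S \<subseteq> T \<or> T \<subseteq> S" if "S \<in> \<C>" "T \<in> \<C>" for S T using that ch by (auto simp: subset_chain_def)
    have "is_subring (\<Union>\<C>)"
      unfolding is_subring_def
    proof (intro conjI ballI)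
      show "1 \<in> \<Union>\<C>" using ne CZ by (auto simp: Z_def subring_closed)
      fix u v assume "u \<in> \<Union>\<C>" "v \<in> \<Union>\<C>"
      then obtain S T where ST: "u \<in> S" "v \<in> T" "S \<in> \<C>" "T \<in> \<C>" by auto
      then obtain U where U: "U \<in> \<C>" "u \<in> U" "v \<in> U" using lin[of S T] by auto
      hence "u - v \<in> U" "u * v \<in> U" using CZ[of U] by (auto simp: Z_def subring_closed)
      thus "u - v \<in> \<Union>\<C>" "u * v \<in> \<Union>\<C>" using U by auto
    qed
    moreover have "K \<subseteq> \<Union>\<C>" "\<Union>\<C> \<subseteq> M" "t \<in> \<Union>\<C>" "b \<notin> \<Union>\<C>" using ne CZ unfolding Z_def by blast+
    ultimately show "\<Union>\<C> \<in> Z" by (simp add: Z_def)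
  qed
  then obtain V where VZ: "V \<in> Z" and max: "\<And>S. S \<in> Z \<Longrightarrow> V \<subseteq> S \<Longrightarrow> S = V" by blast
  have V: "is_subring V" "K \<subseteq> V" "V \<subseteq> M" "t \<in> V" "b \<notin> V" using VZ by (auto simp: Z_def)
  note C = subring_closed[OF V(1)] and CM = subring_closed[OF M(1)]
  have inv: "1 - t * v \<noteq> 0 \<and> inverse (1 - t * v) \<in> V" if v: "v \<in> V" for v
  proof -
    define w where "w = 1 - t * v"
    have wV: "w \<in> V" using v V C by (auto simp: w_def)
    have w0: "w \<noteq> 0"
    proof
      assume "w = 0"
      hence "b = b * (t * v)" by (simp add: w_def)
      also have "\<dots> = v" using bt by (simp add: mult.assoc[symmetric])
      finally show False using v V by simp
    qed
    \<comment> \<open>Inverting \<open>w\<close> does not bring in \<open>b\<close>, so \<open>w\<close> is invertible in \<open>V\<close> already, by maximality.\<close>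
    define V' where "V' = {u * inverse w ^ k | u k. u \<in> V}"
    have sub: "V \<subseteq> V'"
    proof
      fix u assume "u \<in> V"
      moreover have "u = u * inverse w ^ 0" by simp
      ultimately show "u \<in> V'" unfolding V'_def by blast
    qed
    have "is_subring V'"
      unfolding is_subring_def
    proof (intro conjI ballI)
      show "1 \<in> V'" using sub C by auto
      fix x y assume "x \<in> V'" "y \<in> V'"
      then obtain u k u' k' where *: "x = u * inverse w ^ k" "u \<in> V" "y = u' * inverse w ^ k'" "u' \<in> V"
        by (auto simp: V'_def)
      have "x * y = (u * u') * inverse w ^ (k + k')" using * by (simp add: power_add ac_simps)
      moreover have "u * u' \<in> V" using * C by auto
      ultimately show "x * y \<in> V'" unfolding V'_def by blast
      have "x = (u * w ^ k') * inverse w ^ (k + k')" "y = (u' * w ^ k) * inverse w ^ (k + k')"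
        using * w0 by (auto simp: power_add field_simps)
      hence "x - y = (u * w ^ k' - u' * w ^ k) * inverse w ^ (k + k')" by (simp add: left_diff_distrib)
      moreover have "u * w ^ k' - u' * w ^ k \<in> V" using * C wV by auto
      ultimately show "x - y \<in> V'" unfolding V'_def by blast
    qed
    moreover have "V' \<subseteq> M"
    proof -
      have "inverse w ^ k \<in> M" for k using wV V M CM by auto
      thus ?thesis unfolding V'_def using V CM by auto
    qed
    moreover have "b \<notin> V'"
    proof
      assume "b \<in> V'"
      then obtain u k where u: "b = u * inverse w ^ k" "u \<in> V" by (auto simp: V'_def)
      have "\<exists>x\<in>V. w ^ k = 1 - t * x"
      proof (induct k)
        case 0
        show ?case using C by (intro bexI[of _ 0]) auto
      next
        case (Suc k)
        then obtain x where x: "x \<in> V" "w ^ k = 1 - t * x" by blast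
        have "w ^ Suc k = (1 - t * v) * (1 - t * x)" unfolding power_Suc x(2) by (simp add: w_def)
        hence "w ^ Suc k = 1 - t * (v + x - v * t * x)" by (simp add: algebra_simps)
        moreover have "v + x - v * t * x \<in> V" using x v V C by auto
        ultimately show ?case by blast
      qed
      then obtain x where x: "x \<in> V" "w ^ k = 1 - t * x" by blast
      have "b * w ^ k = u" using u w0 by (simp add: power_inverse)
      hence "b = u + b * t * x" unfolding x by (simp add: algebra_simps)
      hence "b = u + x" using bt by simp
      thus False using u x V C by auto
    qed
    ultimately have "V' \<in> Z" using V sub by (auto simp: Z_def)
    hence "V' = V" using max sub by blast
    moreover have "inverse w \<in> V'" 
    proof -
      have "inverse w = 1 * inverse w ^ 1" by simp
      thus ?thesis unfolding V'_def using C(2) by blast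
    qed
    ultimately show ?thesis using w0 by (auto simp: w_def)
  qed
  have rep: "\<exists>m. ideal_rep V t a m" if a: "a \<in> M" "a \<notin> V" for a
  proof -
    note A = adjoin_subring[OF V(1), of a]
    have "adjoin V a \<noteq> V" using A(3) a by auto
    moreover have "adjoin V a \<subseteq> M" using V M a by (intro adjoin_least) auto
    ultimately have "b \<in> adjoin V a" using max[of "adjoin V a"] A V by (auto simp: Z_def)
    then obtain p where p: "p \<in> polys_over V" "b = poly p a" by (auto simp: adjoin_def)
    have "1 = t * b" using bt by (simp add: ac_simps)
    also have "\<dots> = (\<Sum>i\<le>Polynomial.degree p. (t * poly.coeff p i) * a ^ i)"
      unfolding p(2) poly_altdef sum_distrib_left by (simp add: ac_simps)
    finally show ?thesis unfolding ideal_rep_def using p(1) by (intro exI) (auto simp: polys_over_def)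
  qed
  have "u \<in> V \<or> inverse u \<in> V" if u: "u \<in> M" for u
  proof (rule ccontr)
    assume "\<not> ?thesis"
    hence n: "u \<notin> V" "inverse u \<notin> V" by auto
    have u0: "u \<noteq> 0" using n C by auto
    define m where "m = (LEAST m. ideal_rep V t u m)"
    define n' where "n' = (LEAST m. ideal_rep V t (inverse u) m)"
    have m: "ideal_rep V t u m" unfolding m_def using rep[OF u n(1)] by (rule LeastI_ex)
    have n': "ideal_rep V t (inverse u) n'" unfolding n'_def using rep[OF M(2)[OF u] n(2)] by (rule LeastI_ex)
    show False
    proof (cases "n' \<le> m")
      case True
      from ideal_rep_reduce[OF V(1,4) inv u0 m n' True] show False
        unfolding m_def using not_less_Least by blast
    next
      case False
      hence le: "m \<le> n'" by simp
      have "inverse u \<noteq> 0" "ideal_rep V t (inverse (inverse u)) m" using u0 m by auto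
      from ideal_rep_reduce[OF V(1,4) inv this(1) n' this(2) le] show False
        unfolding n'_def using not_less_Least by blast
    qed
  qed
  hence "valring V" using V by (auto simp: valring_def)
  thus ?thesis using that V by blast
qed

text \<open>
  If \<open>z\<close> has a pole, a polynomial in \<open>z\<close> has the order of its leading term.
\<close>

lemma unit_ev:
  assumes V: "valring V" and z: "z \<in> M" "z \<notin> V" and p: "p \<noteq> 0"
  shows "unit V (ev z p * inverse z ^ Polynomial.degree p)"
    and "Polynomial.degree p \<le> n \<Longrightarrow> ev z p * inverse z ^ n \<in> V"
proof -
  note C = val_closed[OF V]
  have z0: "z \<noteq> 0" using z C by auto
  have iz: "nonunit V (inverse z)" by (rule not_in_V[OF V z])
  hence izV: "inverse z \<in> V" by (simp add: nonunit_def)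
  show u: "unit V (ev z p * inverse z ^ Polynomial.degree p)"
    using p
  proof (induct p)
    case (pCons c p)
    show ?case
    proof (cases "p = 0")
      case True
      hence "c \<noteq> 0" using pCons by auto
      thus ?thesis using True unit_closed(5)[OF V] by simp
    next
      case False
      have u: "unit V (ev z p * inverse z ^ Polynomial.degree p)" using pCons False by simp
      have "nonunit V (inverse z * (\<kappa> c * inverse z ^ Polynomial.degree p))"
        using izV C val_K[OF V] by (intro nonunit_mult[OF V iz]) auto
      from unit_add_nonunit[OF V u this] have "unit V (ev z p * inverse z ^ Polynomial.degree p +
          inverse z * (\<kappa> c * inverse z ^ Polynomial.degree p))" .
      moreover have "ev z (pCons c p) * inverse z ^ Polynomial.degree (pCons c p)
        = (z * inverse z) * (ev z p * inverse z ^ Polynomial.degree p) + inverse z * (\<kappa> c * inverse z ^ Polynomial.degree p)"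
        using False by (simp add: algebra_simps)
      ultimately show ?thesis using z0 by (simp add: ac_simps)
    qed
  qed simp
  show "ev z p * inverse z ^ n \<in> V" if "Polynomial.degree p \<le> n"
  proof -
    have "inverse z ^ n = inverse z ^ Polynomial.degree p * inverse z ^ (n - Polynomial.degree p)"
      using that by (simp add: power_add[symmetric])
    moreover have "ev z p * inverse z ^ Polynomial.degree p * inverse z ^ (n - Polynomial.degree p) \<in> V"
      using u izV C by (auto simp: unit_def)
    ultimately show ?thesis by (simp add: ac_simps)
  qed
qed

text \<open>
  In a vanishing sum no term can dominate all the others, so two terms of an algebraic
  relation between \<open>z\<close> and \<open>u\<close> have the same order.  This says that the order of \<open>u\<close> is a rational multiple of the
  order of \<open>z\<close>.
\<close>

lemma value_exists:
  assumes V: "valring V" and z: "z \<in> M" "z \<notin> V" and u: "u \<in> M" "u \<noteq> 0" and dep: "dependent2 z u"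
  shows "\<exists>q>0. \<exists>k. unit V (u ^ q * z powi k)"
proof -
  note C = val_closed[OF V] and CM = subring_closed[OF M(1)]
  have z0: "z \<noteq> 0" using z C by auto
  have zK: "z \<notin> K" using z val_K[OF V] by auto
  obtain P where P: "P \<noteq> 0" "ev2 z u P = 0" using dep by (auto simp: dependent2_def)
  define c where "c i = poly.coeff P i" for i
  define I where "I = {i. i \<le> Polynomial.degree P \<and> c i \<noteq> 0}"
  define T where "T i = ev z (c i) * u ^ i" for i
  have fin: "finite I" and ne: "I \<noteq> {}" using P by (auto simp: I_def c_def intro!: exI[of _ "Polynomial.degree P"])
  have TM: "T i \<in> M" for i unfolding T_def
    using subring_mult[OF M(1)] CM u z M adjoin_least[OF M(1), of K z] unfolding adjoin_K by (metis range_subsetD)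
  have T0: "T i \<noteq> 0" if "i \<in> I" for i using that u by (simp add: T_def I_def ev_eq_0[OF zK])
  have sum0: "(\<Sum>i\<in>I. T i) = 0"
  proof -
    have "(\<Sum>i\<in>I. T i) = (\<Sum>i\<le>Polynomial.degree P. T i)"
      by (rule sum.mono_neutral_left) (auto simp: I_def T_def)
    thus ?thesis using P(2) by (simp add: T_def c_def ev2_def)
  qed
  have "\<exists>m\<in>I. \<forall>i\<in>I. T i * inverse (T m) \<in> V"
    using fin ne T0
  proof (induct I rule: finite_ne_induct)
    case (singleton i)
    thus ?case using C by auto
  next
    case (insert j J)
    then obtain m where m: "m \<in> J" "\<And>i. i \<in> J \<Longrightarrow> T i * inverse (T m) \<in> V" by auto
    have nz: "T m \<noteq> 0" "T j \<noteq> 0" using insert m by auto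
    have jj: "T j * inverse (T j) \<in> V" "T m * inverse (T m) \<in> V" using nz C by auto
    have "T j * inverse (T m) \<in> M" using TM M CM by auto
    from val_cases[OF V this] show ?case
    proof
      assume "T j * inverse (T m) \<in> V"
      thus ?thesis using m by (intro bexI[of _ m]) auto
    next
      assume "inverse (T j * inverse (T m)) \<in> V"
      hence mj: "T m * inverse (T j) \<in> V" by (simp add: ac_simps)
      have "T i * inverse (T j) \<in> V" if "i \<in> J" for i
      proof -
        have "T i * inverse (T m) * (T m * inverse (T j)) \<in> V" using m(2)[OF that] mj C by auto
        moreover have "T i * inverse (T m) * (T m * inverse (T j)) = T i * inverse (T j)" using nz by simp
        ultimately show ?thesis by simp
      qed
      thus ?thesis using jj by (intro bexI[of _ j]) auto
    qed
  qed
  then obtain m where m: "m \<in> I" "\<And>i. i \<in> I \<Longrightarrow> T i * inverse (T m) \<in> V" by blast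
  have "\<exists>j\<in>I - {m}. unit V (T j * inverse (T m))"
  proof (rule ccontr)
    assume "\<not> ?thesis"
    hence "nonunit V (T j * inverse (T m))" if "j \<in> I - {m}" for j using that m by (auto simp: nonunit_def)
    hence "nonunit V (\<Sum>j\<in>I - {m}. T j * inverse (T m))" by (intro nonunit_sum[OF V])
    moreover have "unit V 1" using unit_closed(5)[OF V, of 1] by simp
    ultimately have "unit V (1 + (\<Sum>j\<in>I - {m}. T j * inverse (T m)))" by (intro unit_add_nonunit[OF V])
    moreover have "1 + (\<Sum>j\<in>I - {m}. T j * inverse (T m)) = (\<Sum>j\<in>I. T j) * inverse (T m)"
      using T0[OF m(1)] by (simp add: sum.remove[OF fin m(1)] distrib_right sum_distrib_right)
    ultimately show False unfolding sum0 by (simp add: unit_def)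
  qed
  then obtain j where j: "j \<in> I" "j \<noteq> m" "unit V (T j * inverse (T m))" by blast
  define e where "e i = Polynomial.degree (c i)" for i
  define w where "w i = ev z (c i) * inverse z ^ e i" for i
  have wu: "unit V (w i)" if "i \<in> I" for i unfolding w_def e_def using that by (intro unit_ev[OF V z]) (auto simp: I_def)
  have Tw: "T i = w i * z ^ e i * u ^ i" for i using z0 by (simp add: T_def w_def power_inverse)
  have core: "\<exists>q>0. \<exists>k. unit V (u ^ q * z powi k)"
    if ab: "a \<in> I" "b \<in> I" "a < b" "unit V (T b * inverse (T a))" for a b
  proof -
    have "unit V (T b * inverse (T a) * (w a * inverse (w b)))" using ab wu unit_closed[OF V] by auto
    moreover have "T b * inverse (T a) * (w a * inverse (w b)) = u ^ (b - a) * z powi (int (e b) - int (e a))"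
    proof -
      have nz: "w a \<noteq> 0" "w b \<noteq> 0" using wu ab by (auto simp: unit_def)
      have "u ^ b = u ^ (b - a) * u ^ a" using ab by (simp add: power_add[symmetric])
      moreover have "z powi (int (e b) - int (e a)) = z ^ e b * inverse (z ^ e a)"
        using z0 by (simp add: power_int_diff divide_inverse)
      ultimately show ?thesis using nz u z0 by (simp add: Tw field_simps)
    qed
    ultimately show ?thesis using ab(3) by (intro exI[of _ "b - a"] conjI exI[of _ "int (e b) - int (e a)"]) auto
  qed
  show ?thesis
  proof (cases "m < j")
    case True
    thus ?thesis using core m j by blast
  next
    case False
    have "unit V (inverse (T j * inverse (T m)))" using j unit_closed[OF V] by blast
    hence "unit V (T m * inverse (T j))" by (simp add: ac_simps)
    thus ?thesis using False core m j by (metis linorder_neqE_nat)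
  qed
qed

end

section \<open>The places of an affine curve\<close>

lemma common_denominator:
  fixes c :: "nat \<Rightarrow> 'a::idom fract"
  obtains D p where "D \<noteq> 0" "\<And>i. i \<le> n \<Longrightarrow> c i * to_fract D = to_fract (p i)"
proof -
  have "\<exists>D. D \<noteq> 0 \<and> (\<forall>i\<le>n. \<exists>p. c i * to_fract D = to_fract p)"
  proof (induct n)
    case 0
    obtain a b where "c 0 = Fract a b" "b \<noteq> 0" by (cases "c 0") auto
    thus ?case by (intro exI[of _ b]) (auto simp: to_fract_def eq_fract)
  next
    case (Suc n)
    then obtain D where D: "D \<noteq> 0" "\<And>i. i \<le> n \<Longrightarrow> \<exists>p. c i * to_fract D = to_fract p" by auto
    obtain a b where ab: "c (Suc n) = Fract a b" "b \<noteq> 0" by (cases "c (Suc n)") auto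
    have "\<exists>p. c i * to_fract (b * D) = to_fract p" if i: "i \<le> Suc n" for i
    proof (cases "i = Suc n")
      case True
      have "c (Suc n) * to_fract (b * D) = to_fract (a * D)" using ab by (simp add: to_fract_def eq_fract)
      thus ?thesis using True by blast
    next
      case False
      then obtain p where "c i * to_fract D = to_fract p" using D(2)[of i] i by (metis le_SucE)
      hence "c i * to_fract (b * D) = to_fract (b * p)" by (simp add: to_fract_mult ac_simps)
      thus ?thesis by blast
    qed
    thus ?case using D ab by (intro exI[of _ "b * D"]) auto
  qed
  thus ?thesis using that by metis
qed

text \<open>
  Any two elements of \<open>A\<close> are algebraically dependent, so \<open>A\<close> is the coordinate ring of an affine
  curve (or a copy of \<open>\<complex>\<close>), and its only units are the constants.
\<close>

locale affine_curve = const_field \<kappa> for \<kappa> :: "complex \<Rightarrow> 'l::field" +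
  fixes A :: "'l set" and gs :: "'l list"
  assumes A: "is_subring A" "range \<kappa> \<subseteq> A" and gen: "A = adjoins (range \<kappa>) gs"
    and dep: "\<And>u v. u \<in> A \<Longrightarrow> v \<in> A \<Longrightarrow> dependent2 u v"
    and units: "\<And>u. u \<in> A \<Longrightarrow> u \<noteq> 0 \<Longrightarrow> inverse u \<in> A \<Longrightarrow> u \<in> range \<kappa>"
begin

lemmas Ac = subring_closed[OF A(1)]

definition M where "M = {a / b | a b. a \<in> A \<and> b \<in> A}"

sublocale subfield_with_constants \<kappa> M
proof
  note Ac = subring_closed[OF A(1)]
  have sub: "A \<subseteq> M"
  proof
    fix a assume "a \<in> A"
    moreover have "a = a / 1" by simp
    ultimately show "a \<in> M" unfolding M_def using Ac(2) by blast
  qed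
  show "is_subring M" unfolding is_subring_def
  proof (intro conjI ballI)
    show "1 \<in> M" using sub Ac by auto
    fix x y assume "x \<in> M" "y \<in> M"
    then obtain a b c e where *: "x = a / b" "y = c / e" "a \<in> A" "b \<in> A" "c \<in> A" "e \<in> A" by (auto simp: M_def)
    have "x * y = (a * c) / (b * e)" using * by simp
    thus "x * y \<in> M" using * Ac(6) unfolding M_def by blast
    show "x - y \<in> M"
    proof (cases "b = 0 \<or> e = 0")
      case True
      then consider "x - y = (- c) / e" | "x - y = a / b" using * by auto
      thus ?thesis by cases (use * Ac(3) in \<open>unfold M_def, blast+\<close>)
    next
      case False
      hence "x - y = (a * e - c * b) / (b * e)" using * by (simp add: field_simps)
      moreover have "a * e - c * b \<in> A" "b * e \<in> A" using * Ac by auto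
      ultimately show ?thesis unfolding M_def by blast
    qed
  qed
  show "inverse u \<in> M" if "u \<in> M" for u
  proof -
    obtain a b where "u = a / b" "a \<in> A" "b \<in> A" using \<open>u \<in> M\<close> by (auto simp: M_def)
    moreover from this have "inverse u = b / a" by simp
    ultimately show ?thesis unfolding M_def by blast
  qed
  show "range \<kappa> \<subseteq> M" using sub A by blast
qed

lemma A_sub_M: "a \<in> A \<Longrightarrow> a \<in> M"
  unfolding M_def using Ac(2) by (metis (mono_tags, lifting) div_by_1 mem_Collect_eq)

lemma const_in_A: "\<kappa> c \<in> A" using A by blast

lemma ev_in_A: "u \<in> A \<Longrightarrow> ev u p \<in> A"
  by (induct p) (use Ac const_in_A in auto)

lemma value_M:
  assumes V: "valring V" and z: "z \<in> A" "z \<notin> V" and u: "u \<in> M" "u \<noteq> 0"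
  shows "\<exists>q>0. \<exists>k. unit V (u ^ q * z powi k)"
proof -
  obtain a b where ab: "u = a / b" "a \<in> A" "b \<in> A" using u by (auto simp: M_def)
  have nz: "a \<noteq> 0" "b \<noteq> 0" using u ab by auto
  have z0: "z \<noteq> 0" using z val_closed[OF V] by auto
  note v = value_exists[OF V A_sub_M[OF z(1)] z(2)]
  obtain q k where a: "q > 0" "unit V (a ^ q * z powi k)" using v[OF A_sub_M[OF ab(2)] nz(1) dep[OF z(1) ab(2)]] by blast
  obtain r l where b: "r > 0" "unit V (b ^ r * z powi l)" using v[OF A_sub_M[OF ab(3)] nz(2) dep[OF z(1) ab(3)]] by blast
  have "unit V ((a ^ q * z powi k) ^ r * inverse ((b ^ r * z powi l) ^ q))"
    by (intro unit_closed[OF V] a b)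
  moreover have "(a ^ q * z powi k) ^ r * inverse ((b ^ r * z powi l) ^ q) = u ^ (q * r) * z powi (k * int r - l * int q)"
  proof -
    have "z powi (k * int r - l * int q) = (z powi k) ^ r * inverse ((z powi l) ^ q)"
      using z0 by (simp add: power_int_diff power_int_mult divide_inverse)
    moreover have "b ^ (r * q) = b ^ (q * r)" by (simp add: ac_simps)
    ultimately show ?thesis unfolding ab(1)
      by (simp add: power_mult_distrib power_mult[symmetric] power_divide divide_inverse power_inverse ac_simps)
  qed
  ultimately show ?thesis using a b by (intro exI[of _ "q * r"]) auto
qed

text \<open>
  Valuations of a function field of one variable have rank one.  If \<open>u\<close> were in \<open>W\<close> but not in \<open>V\<close>, then
  a power of \<open>u\<close> would be a positive power of \<open>z\<close> times a unit of \<open>V\<close>, which would put \<open>z\<close> into \<open>W\<close>.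
\<close>

lemma valrings_incomparable:
  assumes V: "valring V" and W: "valring W" and z: "z \<in> A" "z \<notin> V" "z \<notin> W" and sub: "V \<subseteq> W"
  shows "V = W"
proof (rule ccontr)
  assume "V \<noteq> W"
  then obtain u where u: "u \<in> W" "u \<notin> V" using sub by blast
  have uM: "u \<in> M" using u val_sub[OF W] by auto
  have nz: "u \<noteq> 0" "z \<noteq> 0" using u z val_closed[OF V] by auto
  obtain q k where qk: "q > 0" "unit V (u ^ q * z powi k)" using value_M[OF V z(1,2) uM nz(1)] by blast
  have iu: "nonunit V (inverse u)" by (rule not_in_V[OF V uM u(2)])
  have iz: "inverse z \<in> V" using not_in_V[OF V A_sub_M[OF z(1)] z(2)] by (simp add: nonunit_def)
  show False
  proof (cases "k \<ge> 0")
    case True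
    then obtain n where n: "k = int n" by (metis nonneg_int_cases)
    obtain q' where q': "q = Suc q'" using qk by (cases q) auto
    have "nonunit V (inverse u * (inverse u ^ q' * inverse z ^ n))"
      using iu iz val_closed[OF V] by (intro nonunit_mult[OF V iu]) (auto simp: nonunit_def)
    moreover have "inverse u * (inverse u ^ q' * inverse z ^ n) = inverse (u ^ q * z powi k)"
      by (simp add: n q' power_inverse)
    ultimately have "nonunit V (inverse (u ^ q * z powi k))" by simp
    thus False using unit_closed(2)[OF V qk(2)] by (simp add: nonunit_def)
  next
    case False
    then obtain n where n: "k = - int n" "n > 0" by (metis neg_int_cases not_less)
    have "inverse (u ^ q * z powi k) \<in> W" using qk(2) sub by (auto simp: unit_def)
    hence "inverse (u ^ q * z powi k) * u ^ q \<in> W" using u val_closed[OF W] by auto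
    moreover have "inverse (u ^ q * z powi k) * u ^ q = z ^ n" using nz n by (simp add: power_int_minus)
    ultimately have "z ^ n \<in> W" by (simp only:)
    from root_in_V[OF W A_sub_M[OF z(1)] this n(2)] z show False by simp
  qed
qed

text \<open>
  The field of fractions \<open>M\<close> is finite over \<open>\<complex>(z)\<close>, and denominators in a linear relation can be cleared.
\<close>

lemma finite_rank:
  assumes z: "z \<in> A" "z \<notin> K"
  obtains N where "\<And>w. (\<And>i. i \<le> N \<Longrightarrow> w i \<in> M) \<Longrightarrow>
     \<exists>p. (\<exists>i\<le>N. p i \<noteq> 0) \<and> (\<Sum>i\<le>N. ev z (p i) * w (i::nat)) = 0"
proof -
  have ringhom: "ring_hom_on UNIV (ev z)" by (simp add: ring_hom_on_def)
  define H where "H = fract_hom (ev z)"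
  have inj: "ev z p = 0 \<Longrightarrow> p = 0" for p using z by (simp add: ev_eq_0)
  interpret H: field_ext H by unfold_locales (simp add: H_def fract_hom_hom[OF ringhom inj])
  have Hp: "H (to_fract p) = ev z p" for p by (simp add: H_def fract_hom_hom[OF ringhom inj])
  have alg: "H.algebraic_elem g" if g: "g \<in> A" for g
  proof -
    obtain P where P: "P \<noteq> 0" "ev2 z g P = 0" using dep[OF z(1) g] by (auto simp: dependent2_def)
    let ?Q = "map_poly to_fract P"
    have c: "poly.coeff ?Q i = to_fract (poly.coeff P i)" for i by (simp add: coeff_map_poly)
    have "?Q \<noteq> 0" using P by (metis c coeff_0 leading_coeff_0_iff to_fract_eq_0_iff)
    moreover have "poly (map_poly H ?Q) g = 0"
    proof -
      have "Polynomial.degree (map_poly H ?Q) \<le> Polynomial.degree P"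
        by (rule degree_le) (auto simp: H.map_poly_h c coeff_eq_0)
      hence "poly (map_poly H ?Q) g = (\<Sum>i\<le>Polynomial.degree P. poly.coeff (map_poly H ?Q) i * g ^ i)"
        unfolding poly_altdef by (intro sum.mono_neutral_left) (auto simp: not_le coeff_eq_0)
      thus ?thesis using P(2) by (simp add: H.map_poly_h c Hp ev2_def)
    qed
    ultimately show ?thesis unfolding H.algebraic_elem_def by blast
  qed
  have "set gs \<subseteq> A" using adjoins_subring[OF K_subring, of gs] gen by simp
  hence "\<And>g. g \<in> set gs \<Longrightarrow> H.algebraic_elem g" using alg by blast
  then obtain E where E: "finite E" "is_subring (H.span E)" "range H \<subseteq> H.span E" "set gs \<subseteq> H.span E"
    using H.finite_algebra[of "set gs"] by blast
  have "K \<subseteq> H.span E"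
  proof -
    have "\<kappa> c = H (to_fract [:c:])" for c by (simp add: Hp)
    thus ?thesis using E(3) by (metis range_subsetD image_subsetI)
  qed
  hence "A \<subseteq> H.span E" unfolding gen using E by (intro adjoins_least[OF K_subring])
  hence ME: "M \<subseteq> H.span E"
    unfolding M_def divide_inverse using H.subring_span_inverse[OF E(1,2)] subring_mult[OF E(2)] by blast
  show ?thesis
  proof (rule that[of "card E"])
    fix w assume w: "\<And>i. i \<le> card E \<Longrightarrow> w i \<in> M"
    obtain c where c: "\<exists>i\<le>card E. c i \<noteq> 0" "(\<Sum>i\<le>card E. H (c i) * w i) = 0"
      using H.dependent_family[OF E(1), of "card E" w] w ME by blast
    obtain D p where D: "D \<noteq> 0" "\<And>i. i \<le> card E \<Longrightarrow> c i * to_fract D = to_fract (p i)"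
      using common_denominator[where c = c and n = "card E"] by blast
    have e: "ev z (p i) = H (c i) * H (to_fract D)" if "i \<le> card E" for i
      using arg_cong[OF D(2)[OF that], of H] by (simp add: Hp)
    have "(\<Sum>i\<le>card E. ev z (p i) * w i) = (\<Sum>i\<le>card E. H (c i) * w i) * H (to_fract D)"
      unfolding sum_distrib_right by (intro sum.cong) (auto simp: e)
    moreover have "p i \<noteq> 0" if "i \<le> card E" "c i \<noteq> 0" for i
    proof
      assume "p i = 0"
      thus False using D(2)[OF that(1)] that D(1) by simp
    qed
    ultimately show "\<exists>p. (\<exists>i\<le>card E. p i \<noteq> 0) \<and> (\<Sum>i\<le>card E. ev z (p i) * w i) = 0"
      using c by (intro exI[of _ p]) auto
  qed
qed

text \<open>
  An element \<open>u\<close> with a zero at \<open>V i\<close> and a pole at \<open>V j\<close> exists by incomparability, and \<open>s = u / (u - c)\<close>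
  has the values 0 and 1 there.  For all but finitely many constants \<open>c\<close> it has no pole at any of
  the given valuations.
\<close>

lemma separating_element:
  assumes V: "\<And>i. i \<le> n \<Longrightarrow> valring (V i)" "\<And>i. i \<le> n \<Longrightarrow> z \<notin> V i" and z: "z \<in> A"
    and ij: "i \<le> n" "j \<le> (n::nat)" "V i \<noteq> V j"
  shows "\<exists>s\<in>M. (\<forall>l\<le>n. s \<in> V l) \<and> nonunit (V i) s \<and> unit (V j) s"
proof -
  note Vi = V(1)[OF ij(1)] and Vj = V(1)[OF ij(2)]
  note CM = subring_closed[OF M(1)]
  obtain a where a: "a \<in> V i" "a \<notin> V j" using valrings_incomparable[OF Vi Vj z] V(2) ij by blast
  obtain b where b: "b \<in> V j" "b \<notin> V i" using valrings_incomparable[OF Vj Vi z] V(2) ij by blast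
  have abM: "a \<in> M" "b \<in> M" using a b val_sub[OF Vi] val_sub[OF Vj] by auto
  define u where "u = inverse b * a"
  have uM: "u \<in> M" unfolding u_def using abM M CM by auto
  have ui: "nonunit (V i) u" unfolding u_def by (rule nonunit_mult[OF Vi not_in_V[OF Vi abM(2) b(2)] a(1)])
  have "nonunit (V j) (inverse a * b)" by (rule nonunit_mult[OF Vj not_in_V[OF Vj abM(1) a(2)] b(1)])
  hence uj: "nonunit (V j) (inverse u)" by (simp add: u_def ac_simps)
  have u0: "u \<noteq> 0" using a b val_closed[OF Vi] val_closed[OF Vj] by (auto simp: u_def)
  define Bad where "Bad = (\<Union>l\<in>{..n}. {c. nonunit (V l) (u - \<kappa> c)}) \<union> {0}"
  have "finite Bad"
  proof -
    have "finite {c. nonunit (V l) (u - \<kappa> c)}" if "l \<le> n" for l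
    proof -
      have "c = e" if "nonunit (V l) (u - \<kappa> c)" "nonunit (V l) (u - \<kappa> e)" for c e
      proof (rule ccontr)
        assume "c \<noteq> e"
        hence "unit (V l) (\<kappa> (c - e))" by (intro unit_closed(5)[OF V(1)[OF \<open>l \<le> n\<close>]]) simp
        moreover have "nonunit (V l) ((u - \<kappa> e) + - (u - \<kappa> c))"
          using that by (intro nonunit_add[OF V(1)[OF \<open>l \<le> n\<close>]] nonunit_uminus[OF V(1)[OF \<open>l \<le> n\<close>]])
        ultimately show False by (simp add: nonunit_def)
      qed
      hence "{c. nonunit (V l) (u - \<kappa> c)} = {} \<or> (\<exists>c. {c. nonunit (V l) (u - \<kappa> c)} = {c})" by blast
      thus ?thesis by (metis finite.emptyI finite.insertI)
    qed
    thus ?thesis unfolding Bad_def by blast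
  qed
  moreover have "infinite (UNIV :: complex set)" by (rule infinite_UNIV_char_0)
  ultimately obtain c where c: "c \<notin> Bad" by (metis ex_new_if_finite)
  have c0: "c \<noteq> 0" and cn: "\<And>l. l \<le> n \<Longrightarrow> \<not> nonunit (V l) (u - \<kappa> c)" using c by (auto simp: Bad_def)
  define s where "s = u * inverse (u - \<kappa> c)"
  have outside: "unit (V l) s" if l: "l \<le> n" "nonunit (V l) (inverse u)" for l
  proof -
    note Vl = V(1)[OF l(1)]
    have "nonunit (V l) (inverse u * (- \<kappa> c))"
      by (rule nonunit_mult[OF Vl l(2)]) (use val_closed[OF Vl] val_K[OF Vl] in auto)
    moreover have "unit (V l) 1" using unit_closed(5)[OF Vl, of 1] by simp
    ultimately have "unit (V l) (1 + inverse u * (- \<kappa> c))" by (intro unit_add_nonunit[OF Vl])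
    hence "unit (V l) (inverse (1 + inverse u * (- \<kappa> c)))" by (rule unit_closed(2)[OF Vl])
    moreover have "inverse (1 + inverse u * (- \<kappa> c)) = s"
    proof -
      have "1 + inverse u * (- \<kappa> c) = inverse u * (u - \<kappa> c)" using u0 by (simp add: algebra_simps)
      thus ?thesis by (simp add: s_def)
    qed
    ultimately show ?thesis by simp
  qed
  have inside: "unit (V l) (u - \<kappa> c)" if l: "l \<le> n" "u \<in> V l" for l
    using cn[OF l(1)] l(2) val_closed[OF V(1)[OF l(1)]] val_K[OF V(1)[OF l(1)]] by (auto simp: nonunit_def)
  have "s \<in> V l" if l: "l \<le> n" for l
  proof (cases "u \<in> V l")
    case True
    thus ?thesis using inside[OF l True] val_closed[OF V(1)[OF l]] by (auto simp: s_def unit_def)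
  next
    case False
    from outside[OF l not_in_V[OF V(1)[OF l] uM False]] show ?thesis by (simp add: unit_def)
  qed
  moreover have "nonunit (V i) s"
    unfolding s_def using ui inside[OF ij(1)] by (intro nonunit_mult[OF Vi ui]) (auto simp: nonunit_def unit_def)
  moreover have "unit (V j) s" by (rule outside[OF ij(2) uj])
  ultimately show ?thesis using val_sub[OF Vi] ij by blast
qed

text \<open>
  The number of poles of \<open>z\<close> is at most the degree of \<open>M\<close> over \<open>\<complex>(z)\<close>.  Given too many poles there are
  elements \<open>e j\<close> that are units at \<open>V j\<close> and vanish at all the other \<open>V i\<close>.  In a linear relation with
  polynomial coefficients in \<open>z\<close> the term \<open>e m\<close>, where \<open>m\<close> belongs to a coefficient of largest
  degree, would dominate all the others at \<open>V m\<close>.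
\<close>

lemma finite_valrings_at:
  assumes z: "z \<in> A" "z \<notin> K"
  shows "finite {V. valring V \<and> z \<notin> V}"
proof (rule ccontr)
  assume inf: "infinite {V. valring V \<and> z \<notin> V}"
  obtain N where N: "\<And>w. (\<And>i. i \<le> N \<Longrightarrow> w i \<in> M) \<Longrightarrow>
     \<exists>p. (\<exists>i\<le>N. p i \<noteq> 0) \<and> (\<Sum>i\<le>N. ev z (p i) * w (i::nat)) = 0" by (rule finite_rank[OF z]) blast
  obtain V :: "nat \<Rightarrow> 'l set" where V: "inj V" "range V \<subseteq> {V. valring V \<and> z \<notin> V}"
    using infinite_countable_subset[OF inf] by auto
  have val: "valring (V i)" "z \<notin> V i" for i using V by auto
  have "\<exists>s\<in>M. i \<noteq> j \<longrightarrow> (\<forall>l\<le>N. s \<in> V l) \<and> nonunit (V i) s \<and> unit (V j) s" if "i \<le> N" "j \<le> N" for i j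
  proof (cases "i = j")
    case False
    hence "V i \<noteq> V j" using V by (auto simp: inj_def)
    from separating_element[OF val z(1) that this] show ?thesis by blast
  qed (use M K_closed in auto)
  hence "\<forall>i j. \<exists>s. i \<le> N \<and> j \<le> N \<longrightarrow> s \<in> M \<and> (i \<noteq> j \<longrightarrow> (\<forall>l\<le>N. s \<in> V l) \<and> nonunit (V i) s \<and> unit (V j) s)" by blast
  then obtain s where s: "\<And>i j. i \<le> N \<Longrightarrow> j \<le> N \<Longrightarrow> s i j \<in> M \<and> (i \<noteq> j \<longrightarrow> (\<forall>l\<le>N. s i j \<in> V l) \<and> nonunit (V i) (s i j) \<and> unit (V j) (s i j))"
    by metis
  define e where "e j = (\<Prod>i\<in>{..N} - {j}. s i j)" for j
  have eM: "e j \<in> M" if "j \<le> N" for j unfolding e_def using s that by (intro subring_prod[OF M(1)]) auto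
  have eu: "unit (V j) (e j)" if "j \<le> N" for j unfolding e_def using s that by (intro unit_closed(6)[OF val(1)]) auto
  have en: "nonunit (V i) (e j)" if ij: "i \<le> N" "j \<le> N" "i \<noteq> j" for i j
  proof -
    have "e j = s i j * (\<Prod>l\<in>{..N} - {j} - {i}. s l j)" unfolding e_def using ij by (intro prod.remove) auto
    moreover have "(\<Prod>l\<in>{..N} - {j} - {i}. s l j) \<in> V i" using s ij by (intro subring_prod[OF val_subring[OF val(1)]]) auto
    ultimately show ?thesis using s ij nonunit_mult[OF val(1)] by metis
  qed
  obtain p where p: "\<exists>i\<le>N. p i \<noteq> 0" "(\<Sum>i\<le>N. ev z (p i) * e i) = 0" using N[of e] eM by blast
  define d where "d = Max (Polynomial.degree ` p ` {i. i \<le> N \<and> p i \<noteq> 0})"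
  have fin: "finite (Polynomial.degree ` p ` {i. i \<le> N \<and> p i \<noteq> 0})" by simp
  have "d \<in> Polynomial.degree ` p ` {i. i \<le> N \<and> p i \<noteq> 0}" unfolding d_def using p(1) by (intro Max_in) auto
  then obtain m where m: "m \<le> N" "p m \<noteq> 0" "d = Polynomial.degree (p m)" by blast
  have dmax: "Polynomial.degree (p i) \<le> d" if "i \<le> N" "p i \<noteq> 0" for i
    unfolding d_def using that by (intro Max_ge fin) blast
  define g where "g i = ev z (p i) * inverse z ^ d" for i
  note zz = A_sub_M[OF z(1)] val(2)
  have gV: "g i \<in> V m" if "i \<le> N" for i
  proof (cases "p i = 0")
    case True
    thus ?thesis using val_closed[OF val(1)] by (simp add: g_def)
  next
    case False
    thus ?thesis unfolding g_def using unit_ev(2)[OF val(1) zz, of "p i"] dmax that by blast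
  qed
  have gu: "unit (V m) (g m)" unfolding g_def m(3) by (rule unit_ev(1)[OF val(1) zz m(2)])
  have "(\<Sum>i\<le>N. g i * e i) = (\<Sum>i\<le>N. ev z (p i) * e i) * inverse z ^ d"
    unfolding sum_distrib_right by (intro sum.cong) (auto simp: g_def)
  hence "0 = g m * e m + (\<Sum>i\<in>{..N} - {m}. g i * e i)" using p(2) m(1) by (simp add: sum.remove)
  moreover have "nonunit (V m) (\<Sum>i\<in>{..N} - {m}. g i * e i)"
  proof (rule nonunit_sum[OF val(1)])
    fix i assume "i \<in> {..N} - {m}"
    hence i: "i \<le> N" "m \<noteq> i" by auto
    have "nonunit (V m) (e i * g i)" by (rule nonunit_mult[OF val(1) en[OF m(1) i] gV[OF i(1)]])
    thus "nonunit (V m) (g i * e i)" by (simp add: ac_simps)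
  qed
  moreover have "unit (V m) (g m * e m)" using gu eu[OF m(1)] unit_closed(1)[OF val(1)] by blast
  ultimately have "unit (V m) 0" using unit_add_nonunit[OF val(1)] by metis
  thus False by (simp add: unit_def)
qed

text \<open>
  The places at infinity, that is, those at which some element of \<open>A\<close> has a pole.
\<close>

definition places :: "'l set set" where "places = {V. valring V \<and> \<not> A \<subseteq> V}"

lemma finite_places: "finite places"
proof -
  have "places \<subseteq> (\<Union>g\<in>{g \<in> set gs. g \<notin> K}. {V. valring V \<and> g \<notin> V})"
  proof
    fix V assume V: "V \<in> places"
    hence v: "valring V" by (simp add: places_def)
    have "K \<subseteq> V" using val_K[OF v] by blast
    hence "set gs \<subseteq> V \<Longrightarrow> A \<subseteq> V"
      using adjoins_least[OF K_subring val_subring[OF v], of gs] unfolding gen by blast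
    hence "\<not> set gs \<subseteq> V" using V by (auto simp: places_def)
    then obtain g where "g \<in> set gs" "g \<notin> V" by blast
    thus "V \<in> (\<Union>g\<in>{g \<in> set gs. g \<notin> K}. {V. valring V \<and> g \<notin> V})" using v val_K[OF v] by blast
  qed
  moreover have "set gs \<subseteq> A" using adjoins_subring[OF K_subring, of gs] gen by simp
  hence "finite (\<Union>g\<in>{g \<in> set gs. g \<notin> K}. {V. valring V \<and> g \<notin> V})"
    using finite_valrings_at by (intro finite_UN_I) auto
  ultimately show ?thesis by (rule finite_subset)
qed

lemma regular_everywhere: 
  assumes b: "b \<in> A" "\<And>V. V \<in> places \<Longrightarrow> b \<in> V"
  shows "b \<in> K"
proof (rule ccontr)
  assume "b \<notin> K"
  then obtain V where "valring V" "b \<notin> V" using valring_avoiding[OF A_sub_M[OF b(1)]] by blast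
  thus False using b by (auto simp: places_def)
qed

end

section \<open>Factorial affine curves with constant units\<close>

context affine_curve
begin

definition dvdA :: "'l \<Rightarrow> 'l \<Rightarrow> bool" where "dvdA f u \<longleftrightarrow> (\<exists>q\<in>A. u = f * q)"

definition primeA :: "'l \<Rightarrow> bool" where
  "primeA f \<longleftrightarrow> f \<in> A \<and> f \<noteq> 0 \<and> f \<notin> K \<and>
     (\<forall>u\<in>A. \<forall>v\<in>A. dvdA f (u * v) \<longrightarrow> dvdA f u \<or> dvdA f v)"

lemma dvdA_closed:
  "dvdA f u \<Longrightarrow> dvdA f v \<Longrightarrow> dvdA f (u + v)" "dvdA f u \<Longrightarrow> dvdA f v \<Longrightarrow> dvdA f (u - v)"
  "dvdA f u \<Longrightarrow> v \<in> A \<Longrightarrow> dvdA f (u * v)" "dvdA f u \<Longrightarrow> v \<in> A \<Longrightarrow> dvdA f (v * u)"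
  "dvdA f u \<Longrightarrow> dvdA u v \<Longrightarrow> dvdA f v"
proof -
  show "dvdA f (u + v)" if "dvdA f u" "dvdA f v" using that Ac(4) unfolding dvdA_def by (metis distrib_left)
  show "dvdA f (u - v)" if "dvdA f u" "dvdA f v" using that Ac(5) unfolding dvdA_def by (metis right_diff_distrib)
  show *: "dvdA f (u * v)" if "dvdA f u" "v \<in> A" for u v using that Ac(6) unfolding dvdA_def by (metis mult.assoc)
  show "dvdA f (v * u)" if "dvdA f u" "v \<in> A" using *[OF that] by (simp add: mult.commute)
  show "dvdA f v" if "dvdA f u" "dvdA u v" using that Ac(6) unfolding dvdA_def by (metis mult.assoc)
qed

lemma unit_const: "u \<in> A \<Longrightarrow> v \<in> A \<Longrightarrow> u * v = \<kappa> c \<Longrightarrow> c \<noteq> 0 \<Longrightarrow> u \<in> K"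
proof -
  assume *: "u \<in> A" "v \<in> A" "u * v = \<kappa> c" "c \<noteq> 0"
  have "u * (v * \<kappa> (inverse c)) = 1" using * by (simp add: mult.assoc[symmetric] \<kappa>_inverse)
  hence "inverse u = v * \<kappa> (inverse c)" by (rule inverse_unique)
  hence "inverse u \<in> A" using * const_in_A Ac by simp
  moreover have "u \<noteq> 0" using * by auto
  ultimately show "u \<in> K" using units *(1) by blast
qed

lemma prime_not_dvd_const: "primeA f \<Longrightarrow> dvdA f (\<kappa> c) \<Longrightarrow> c = 0"
  unfolding dvdA_def primeA_def using unit_const by metis

text \<open>
  The zero set of a prime element is a single point: a relation between \<open>c\<close> and \<open>f\<close> of least degree
  reduces modulo \<open>f\<close> to a nonzero polynomial in \<open>c\<close> that is divisible by \<open>f\<close>.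
\<close>

lemma residue_constant:
  assumes f: "primeA f" and c: "c \<in> A"
  shows "\<exists>\<mu>. dvdA f (c - \<kappa> \<mu>)"
proof -
  have fA: "f \<in> A" "f \<noteq> 0" using f by (auto simp: primeA_def)
  define J where "J P \<longleftrightarrow> P \<noteq> 0 \<and> ev2 c f P = 0" for P
  define P where "P = arg_min Polynomial.degree J"
  have "\<exists>P. J P" using dep[OF c fA(1)] by (auto simp: J_def dependent2_def)
  hence P: "P \<noteq> 0" "ev2 c f P = 0" using arg_min_natI[of J] by (auto simp: P_def J_def)
  obtain p Q where pQ: "P = pCons p Q" by (cases P)
  have e: "ev2 c f P = ev c p + f * ev2 c f Q"
  proof (cases "Q = 0")
    case True
    thus ?thesis by (simp add: pQ ev2_def)
  next
    case False
    hence "ev2 c f P = (\<Sum>i\<le>Suc (Polynomial.degree Q). ev c (poly.coeff P i) * f ^ i)" by (simp add: ev2_def pQ)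
    also have "\<dots> = ev c p + (\<Sum>i\<le>Polynomial.degree Q. ev c (poly.coeff Q i) * f ^ Suc i)"
      by (subst sum.atMost_Suc_shift) (simp add: pQ)
    also have "(\<Sum>i\<le>Polynomial.degree Q. ev c (poly.coeff Q i) * f ^ Suc i) = f * ev2 c f Q"
      unfolding ev2_def sum_distrib_left by (simp add: ac_simps)
    finally show ?thesis .
  qed
  have "p \<noteq> 0"
  proof
    assume p: "p = 0"
    hence Q: "Q \<noteq> 0" "ev2 c f Q = 0" using P pQ e fA by auto
    hence "J Q" "Polynomial.degree Q < Polynomial.degree P" by (auto simp: J_def pQ)
    thus False using arg_min_nat_le[of J Q Polynomial.degree] by (simp add: P_def)
  qed
  have "ev2 c f Q \<in> A" unfolding ev2_def using c fA ev_in_A Ac by (intro Ac(8)) auto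
  moreover have "ev c p = f * (- ev2 c f Q)" using e P by (simp add: add_eq_0_iff)
  ultimately have "dvdA f (ev c p)" unfolding dvdA_def using Ac(3) by blast
  moreover have "dvdA f v \<or> dvdA f w" if "v \<in> range (ev c)" "w \<in> range (ev c)" "dvdA f (v * w)" for v w
    using that f ev_in_A[OF c] unfolding primeA_def by blast
  ultimately show ?thesis
    using root_predicate[of c "dvdA f" p] prime_not_dvd_const[OF f] \<open>p \<noteq> 0\<close> by blast
qed

text \<open>
  If \<open>h = f / g\<close> is regular at infinity, its only pole is the point \<open>g = 0\<close>, of order one.  A
  function with no other pole is a polynomial in \<open>h\<close>: a multiple of \<open>h\<^sup>k\<close> cancels its leading
  polar term, and a function without poles is constant.
\<close>

lemma pole_reduction:
  assumes g: "primeA g" and f: "f \<in> A" "\<not> dvdA g f"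
    and h: "\<And>V. V \<in> places \<Longrightarrow> f / g \<in> V"
    and a: "a \<in> A" and b: "\<And>V. V \<in> places \<Longrightarrow> a / g ^ k \<in> V"
  shows "a / g ^ k \<in> range (ev (f / g))"
  using a b
proof (induct k arbitrary: a)
  case 0
  hence "a \<in> K" using regular_everywhere[of a] by simp
  then obtain c where "a = \<kappa> c" by blast
  thus ?case by (intro range_eqI[of _ _ "[:c:]"]) simp
next
  case (Suc k)
  have gA: "g \<in> A" "g \<noteq> 0" using g by (auto simp: primeA_def)
  obtain \<alpha> where \<alpha>: "dvdA g (a - \<kappa> \<alpha>)" using residue_constant[OF g Suc.prems(1)] by blast
  obtain \<phi> where \<phi>: "dvdA g (f - \<kappa> \<phi>)" using residue_constant[OF g f(1)] by blast
  have \<phi>0: "\<phi> \<noteq> 0" using \<phi> f(2) by auto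
  have pw: "dvdA g (f ^ n - \<kappa> \<phi> ^ n)" for n
  proof (induct n)
    case 0
    show ?case unfolding dvdA_def using Ac(1) by (intro bexI[of _ 0]) auto
  next
    case (Suc n)
    have "f ^ Suc n - \<kappa> \<phi> ^ Suc n = f * (f ^ n - \<kappa> \<phi> ^ n) + (f - \<kappa> \<phi>) * \<kappa> \<phi> ^ n" by (simp add: algebra_simps)
    thus ?case using dvdA_closed(1)[OF dvdA_closed(4)[OF Suc f(1)] dvdA_closed(3)[OF \<phi>, of "\<kappa> \<phi> ^ n"]]
        const_in_A Ac by simp
  qed
  \<comment> \<open>The values of \<open>a\<close> and \<open>f\<close> at the point \<open>g = 0\<close> determine the multiple of \<open>h\<close> to be subtracted.\<close>
  define c where "c = \<alpha> / \<phi> ^ Suc k"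
  have "\<kappa> c * \<kappa> \<phi> ^ Suc k = \<kappa> \<alpha>"
  proof -
    have "c * \<phi> ^ Suc k = \<alpha>" using \<phi>0 by (simp add: c_def)
    thus ?thesis by (metis h_simps(4) h_simps(7))
  qed
  hence "a - \<kappa> c * f ^ Suc k = (a - \<kappa> \<alpha>) - \<kappa> c * (f ^ Suc k - \<kappa> \<phi> ^ Suc k)" by (simp only: right_diff_distrib) simp
  hence "dvdA g (a - \<kappa> c * f ^ Suc k)"
    using dvdA_closed(2)[OF \<alpha> dvdA_closed(4)[OF pw[of "Suc k"] const_in_A[of c]]] by (simp only:)
  then obtain a' where a': "a' \<in> A" "a - \<kappa> c * f ^ Suc k = g * a'" by (auto simp: dvdA_def)
  have eq: "a / g ^ Suc k = \<kappa> c * (f / g) ^ Suc k + a' / g ^ k"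
  proof -
    have "a = \<kappa> c * f ^ Suc k + g * a'" using a'(2) by (simp add: algebra_simps)
    thus ?thesis using gA by (simp add: add_divide_distrib power_divide)
  qed
  have "a' / g ^ k \<in> V" if V: "V \<in> places" for V
  proof -
    have v: "valring V" using V by (simp add: places_def)
    have "a' / g ^ k = a / g ^ Suc k - \<kappa> c * (f / g) ^ Suc k" using eq by simp
    also have "\<dots> \<in> V" using Suc.prems(2)[OF V] h[OF V] val_K[OF v] by (intro val_closed[OF v])
    finally show ?thesis .
  qed
  from Suc.hyps[OF a'(1) this] obtain p where "a' / g ^ k = ev (f / g) p" by blast
  hence "a / g ^ Suc k = ev (f / g) (monom c (Suc k) + p)" unfolding eq by (simp add: ev_monom)
  thus ?case by blast
qed

text \<open>
  For every complex \<open>l\<close> there is a prime factor \<open>F l\<close> of \<open>z0 - l\<close>, and these are pairwise non-associate.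
  At each place the order of \<open>F l\<close> is encoded by a pair \<open>(q, k)\<close> such that \<open>F l ^ q * z powi k\<close> is a
  unit, \<open>z\<close> being a fixed function with a pole there.  There are only countably many such data.
\<close>

lemma equal_order_primes:
  assumes primes: "\<And>u. u \<in> A \<Longrightarrow> u \<notin> K \<Longrightarrow> \<exists>f. primeA f \<and> dvdA f u" and z0: "z0 \<in> A" "z0 \<notin> K"
  obtains f g where "primeA f" "primeA g" "\<not> dvdA g f" "\<And>V. V \<in> places \<Longrightarrow> f / g \<in> V"
proof -
  have "\<exists>f. primeA f \<and> dvdA f (z0 - \<kappa> l)" for l
  proof (rule primes)
    show "z0 - \<kappa> l \<in> A" using z0 const_in_A Ac by auto
    show "z0 - \<kappa> l \<notin> K"
    proof
      assume "z0 - \<kappa> l \<in> K"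
      then obtain c where "z0 - \<kappa> l = \<kappa> c" by blast
      hence "z0 = \<kappa> (c + l)" by (simp add: diff_eq_eq)
      thus False using z0 by blast
    qed
  qed
  then obtain F where F: "\<And>l. primeA (F l)" "\<And>l. dvdA (F l) (z0 - \<kappa> l)" by metis
  have nd: "\<not> dvdA (F m) (F l)" if "l \<noteq> m" for l m
  proof
    assume "dvdA (F m) (F l)"
    hence "dvdA (F m) (z0 - \<kappa> l)" using F(2) dvdA_closed(5) by blast
    hence "dvdA (F m) ((z0 - \<kappa> l) - (z0 - \<kappa> m))" using F(2) dvdA_closed(2) by blast
    moreover have "(z0 - \<kappa> l) - (z0 - \<kappa> m) = \<kappa> (m - l)" by simp
    ultimately have "dvdA (F m) (\<kappa> (m - l))" by (simp only:)
    from prime_not_dvd_const[OF F(1) this] that show False by simp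
  qed
  have FA: "F l \<in> A" "F l \<noteq> 0" for l using F(1) by (auto simp: primeA_def)
  have "\<exists>z. V \<in> places \<longrightarrow> z \<in> A \<and> z \<notin> V" for V by (auto simp: places_def)
  then obtain z where z: "\<And>V. V \<in> places \<Longrightarrow> z V \<in> A \<and> z V \<notin> V" by metis
  have "\<exists>qk :: nat \<times> int. V \<in> places \<longrightarrow> fst qk > 0 \<and> unit V (F l ^ fst qk * z V powi snd qk)" for l V
  proof (cases "V \<in> places")
    case True
    hence "valring V" by (simp add: places_def)
    from value_M[OF this _ _ A_sub_M[OF FA(1)] FA(2)] z[OF True]
    obtain q k where "q > 0" "unit V (F l ^ q * z V powi k)" by blast
    thus ?thesis by (intro exI[of _ "(q, k)"]) auto
  qed simp
  note order = this
  define w where "w l V = (SOME qk :: nat \<times> int. fst qk > 0 \<and> unit V (F l ^ fst qk * z V powi snd qk))" for l V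
  have w: "fst (w l V) > 0 \<and> unit V (F l ^ fst (w l V) * z V powi snd (w l V))" if "V \<in> places" for l V
    unfolding w_def by (rule someI_ex) (use order[of V l] that in blast)
  have "\<not> inj (\<lambda>l. restrict (w l) places)"
  proof
    assume inj: "inj (\<lambda>l. restrict (w l) places)"
    have "countable (places \<rightarrow>\<^sub>E (UNIV :: (nat \<times> int) set))" by (intro countable_PiE finite_places) auto
    moreover have "range (\<lambda>l. restrict (w l) places) \<subseteq> places \<rightarrow>\<^sub>E UNIV" by auto
    ultimately have "countable (UNIV :: complex set)" using inj countable_image_inj_eq countable_subset by blast
    thus False using uncountable_UNIV_complex by blast
  qed
  then obtain l m where lm: "l \<noteq> m" "restrict (w l) places = restrict (w m) places" by (auto simp: inj_def)
  have "F l / F m \<in> V" if V: "V \<in> places" for V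
  proof -
    have v: "valring V" using V by (simp add: places_def)
    have eq: "w l V = w m V" using fun_cong[OF lm(2), of V] V by simp
    define q k where "q = fst (w l V)" and "k = snd (w l V)"
    have q: "q > 0" and u: "unit V (F l ^ q * z V powi k)" "unit V (F m ^ q * z V powi k)"
      using w[OF V, of l] w[OF V, of m] eq by (auto simp: q_def k_def)
    have "unit V ((F l ^ q * z V powi k) * inverse (F m ^ q * z V powi k))"
      by (intro unit_closed[OF v] u)
    moreover have cancel: "(p ^ q * Z) * inverse (r ^ q * Z) = (p / r) ^ q" if "Z \<noteq> 0" for p r Z :: 'l
      using that by (simp add: divide_inverse power_mult_distrib power_inverse)
    have "(F l ^ q * z V powi k) * inverse (F m ^ q * z V powi k) = (F l / F m) ^ q"
      by (rule cancel) (use u in \<open>auto simp: unit_def\<close>)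
    ultimately have "(F l / F m) ^ q \<in> V" by (simp add: unit_def)
    moreover have "F l / F m \<in> M" unfolding M_def using FA by blast
    ultimately show ?thesis using root_in_V[OF v _ _ q] by blast
  qed
  thus ?thesis using that F(1) nd[OF lm(1)] by blast
qed

lemma divisor_of_prime_power:
  assumes g: "primeA g" and "e \<in> A" "a \<in> A" "e * a = g ^ k"
  shows "\<exists>c j. e = \<kappa> c * g ^ j"
  using assms(2-)
proof (induct k arbitrary: e a)
  case 0
  hence "e * a = \<kappa> 1" by simp
  hence "e \<in> K" by (rule unit_const[OF 0(1,2)]) simp
  thus ?case by (metis imageE mult.right_neutral power_0)
next
  case (Suc k)
  have gA: "g \<in> A" "g \<noteq> 0" using g by (auto simp: primeA_def)
  have "dvdA g (e * a)" unfolding dvdA_def Suc(4) using gA Ac by (intro bexI[of _ "g ^ k"]) auto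
  hence "dvdA g e \<or> dvdA g a" using g Suc by (auto simp: primeA_def)
  thus ?case
  proof
    assume "dvdA g e"
    then obtain e' where e': "e' \<in> A" "e = g * e'" by (auto simp: dvdA_def)
    hence "e' * a = g ^ k" using Suc(4) gA by simp
    from Suc(1)[OF e'(1) Suc(3) this] obtain c j where "e' = \<kappa> c * g ^ j" by blast
    hence "e = \<kappa> c * g ^ Suc j" using e' by (simp add: ac_simps)
    thus ?thesis by blast
  next
    assume "dvdA g a"
    then obtain a' where a': "a' \<in> A" "a = g * a'" by (auto simp: dvdA_def)
    hence "e * a' = g ^ k" using Suc(4) gA by simp
    from Suc(1)[OF Suc(2) a'(1) this] show ?thesis .
  qed
qed

text \<open>
  A rational function of \<open>h\<close> in lowest terms, with a Bezout identity for later use.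
\<close>

lemma coprime_relation:
  assumes h: "h \<notin> K" and r: "r \<noteq> 0" "ev h r * b = ev h s"
  obtains r' s' u v where "r' \<noteq> 0" "ev h r' * b = ev h s'" "u * r' + v * s' = 1"
proof -
  define d where "d = gcd r s"
  have d0: "d \<noteq> 0" using r by (simp add: d_def)
  obtain r' s' where rs: "r = d * r'" "s = d * s'" by (metis d_def dvd_def gcd_dvd1 gcd_dvd2)
  obtain u v where "u * r + v * s = d" using bezout_coefficients_fst_snd unfolding d_def by blast
  hence "d * (u * r' + v * s') = d * 1" unfolding rs by (simp add: algebra_simps)
  hence "u * r' + v * s' = 1" using d0 by (subst (asm) mult_cancel_left) simp
  moreover have "ev h d * (ev h r' * b) = ev h d * ev h s'" using r(2) unfolding rs by (simp add: ac_simps)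
  hence "ev h r' * b = ev h s'" using d0 h by (simp add: ev_eq_0)
  moreover have "r' \<noteq> 0" using r rs by auto
  ultimately show ?thesis using that by blast
qed

text \<open>
  Let \<open>h = f / g\<close> for two primes of equal orders at infinity.  A relation between \<open>f\<close> and \<open>g\<close> makes \<open>g\<close>
  algebraic over \<open>\<complex>(h)\<close>, so a multiple of \<open>g\<close> by a polynomial in \<open>h\<close> is integral over \<open>\<complex>[h]\<close>, hence
  regular at infinity, hence a polynomial in \<open>h\<close>.  So \<open>g\<close> is a rational function of \<open>h\<close>.
  As \<open>g\<close> is a unit of \<open>A[1/g]\<close> whereas the units of \<open>A\<close> are constant, some \<open>h - c\<close> is a unit of \<open>A[1/g]\<close>,
  which forces \<open>f - c g\<close> to be a constant.  Therefore \<open>1 / g\<close> is regular at infinity, and the same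
  reduction with 1 in place of \<open>f\<close> shows that every element of \<open>A\<close> is a rational function of \<open>g\<close>; its
  denominator is a unit of \<open>A\<close>.
\<close>

theorem affine_curve_is_line:
  assumes primes: "\<And>u. u \<in> A \<Longrightarrow> u \<notin> K \<Longrightarrow> \<exists>f. primeA f \<and> dvdA f u" and z0: "z0 \<in> A" "z0 \<notin> K"
  shows "\<exists>g\<in>A. A = range (ev g)"
proof -
  obtain f g where f: "primeA f" and g: "primeA g" and nd: "\<not> dvdA g f"
    and hV: "\<And>V. V \<in> places \<Longrightarrow> f / g \<in> V" using equal_order_primes[OF primes z0] by blast
  define h where "h = f / g"
  have fA: "f \<in> A" "f \<noteq> 0" and gA: "g \<in> A" "g \<noteq> 0" and gK: "g \<notin> K" using f g by (auto simp: primeA_def)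
  define Ag where "Ag = {a / g ^ k | a k. a \<in> A}"
  have AgI: "a / g ^ k \<in> Ag" if "a \<in> A" for a k using that by (auto simp: Ag_def)
  have Ag: "is_subring Ag" unfolding is_subring_def
  proof (intro conjI ballI)
    show "1 \<in> Ag" using AgI[OF Ac(2), of 0] by simp
    fix x y assume "x \<in> Ag" "y \<in> Ag"
    then obtain a k b l where *: "x = a / g ^ k" "y = b / g ^ l" "a \<in> A" "b \<in> A" by (auto simp: Ag_def)
    have "x * y = (a * b) / g ^ (k + l)" using * by (simp add: power_add)
    moreover have "(a * b) / g ^ (k + l) \<in> Ag" using * Ac by (intro AgI) auto
    ultimately show "x * y \<in> Ag" by (simp only:)
    have "x - y = (a * g ^ l - b * g ^ k) / g ^ (k + l)"
    proof -
      have "x = (a * g ^ l) / g ^ (k + l)" "y = (b * g ^ k) / g ^ (k + l)" using * gA by (simp_all add: power_add)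
      thus ?thesis by (simp only: diff_divide_distrib)
    qed
    moreover have "(a * g ^ l - b * g ^ k) / g ^ (k + l) \<in> Ag" using * Ac gA by (intro AgI) auto
    ultimately show "x - y \<in> Ag" by (simp only:)
  qed
  note AgC = subring_closed[OF Ag]
  have AAg: "a \<in> Ag" if "a \<in> A" for a using AgI[OF that, of 0] by simp
  have hAg: "h \<in> Ag" using AgI[OF fA(1), of 1] by (simp add: h_def)
  have igAg: "inverse g \<in> Ag" using AgI[OF Ac(2), of 1] by (simp add: divide_inverse)
  have evAg: "ev u p \<in> Ag" if "u \<in> Ag" for u p
    by (induct p) (use AgC that AAg const_in_A in auto)
  have hK: "h \<notin> K"
  proof
    assume "h \<in> K"
    then obtain c where "f / g = \<kappa> c" by (auto simp: h_def)
    hence "f = g * \<kappa> c" using gA by (simp add: field_simps)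
    thus False using nd const_in_A by (auto simp: dvdA_def)
  qed
  have reduce: "b \<in> range (ev (f' / g))"
    if b: "b \<in> Ag" "\<And>V. V \<in> places \<Longrightarrow> b \<in> V" and f': "f' \<in> A" "\<not> dvdA g f'" "\<And>V. V \<in> places \<Longrightarrow> f' / g \<in> V" for b f'
  proof -
    obtain a k where ak: "b = a / g ^ k" "a \<in> A" using b(1) by (auto simp: Ag_def)
    show ?thesis unfolding ak(1) by (rule pole_reduction[OF g f' ak(2)]) (use b(2) ak(1) in auto)
  qed
  have AgM: "b \<in> M" if b: "b \<in> Ag" for b
  proof -
    obtain a k where "b = a / g ^ k" "a \<in> A" using b by (auto simp: Ag_def)
    moreover have "g ^ k \<in> A" by (rule subring_power[OF A(1) gA(1)])
    ultimately show ?thesis unfolding M_def by blast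
  qed
  have "dependent2 h g" unfolding h_def using dependent2_sym[OF dependent2_divide[OF dep[OF gA(1) fA(1)] gA(2)]] .
  then obtain l n C where l: "l \<noteq> 0" "n > 0" "(ev h l * g) ^ n = (\<Sum>i<n. ev h (C i) * (ev h l * g) ^ i)"
    using dependent2_integral[OF _ hK] by metis
  have lg: "ev h l * g \<in> Ag" by (rule AgC(6)[OF evAg[OF hAg] AAg[OF gA(1)]])
  have "ev h l * g \<in> V" if V: "V \<in> places" for V
  proof -
    have v: "valring V" using V by (simp add: places_def)
    show ?thesis
      by (rule integrally_closed[OF v AgM[OF lg] _ l(3)]) (use ev_in_V[OF v] hV[OF V] in \<open>simp add: h_def\<close>)
  qed
  from reduce[OF lg this fA(1) nd hV] obtain s where "ev h l * g = ev h s" by (auto simp: h_def)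
  then obtain r s u v where rs: "r \<noteq> 0" "ev h r * g = ev h s" "u * r + v * s = 1"
    using coprime_relation[OF hK l(1)] by metis
  have one: "ev h u * ev h r + ev h v * ev h s = 1" using arg_cong[OF rs(3), of "ev h"] by simp
  \<comment> \<open>As \<open>r\<close> and \<open>s\<close> are coprime and \<open>s / r\<close> is the unit \<open>g\<close>, both are units of \<open>A[1/g]\<close>; they
    are not both constant, since \<open>g\<close> is not.\<close>
  have ru: "ev h r * (ev h u + ev h v * g) = 1"
  proof -
    have "ev h r * (ev h u + ev h v * g) = ev h u * ev h r + ev h v * (ev h r * g)" by (simp add: algebra_simps)
    thus ?thesis unfolding rs(2) one .
  qed
  have su: "ev h s * (ev h u * inverse g + ev h v) = 1"
  proof -
    have "ev h s * (ev h u * inverse g + ev h v) = ev h u * (ev h s * inverse g) + ev h v * ev h s"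
      by (simp add: algebra_simps)
    also have "ev h s * inverse g = ev h r" using rs(2)[symmetric] gA by simp
    finally show ?thesis using one by simp
  qed
  obtain w x where w: "Polynomial.degree w > 0" "ev h w * x = 1" "x \<in> Ag"
  proof (cases "Polynomial.degree r > 0")
    case True
    show ?thesis
      by (rule that[OF True ru]) (intro AgC(4,6) evAg[OF hAg] AAg[OF gA(1)])
  next
    case False
    then obtain c where c: "r = [:c:]" by (auto elim: degree_eq_zeroE)
    have c0: "c \<noteq> 0" using c rs by auto
    have "Polynomial.degree s > 0"
    proof (rule ccontr)
      assume "\<not> ?thesis"
      then obtain e where "s = [:e:]" by (auto elim: degree_eq_zeroE)
      hence "\<kappa> c * g = \<kappa> e" using rs(2) c by simp
      hence "g = \<kappa> e * inverse (\<kappa> c)" using c0 by (simp add: field_simps)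
      hence "g = \<kappa> (e * inverse c)" by (simp add: \<kappa>_inverse)
      thus False using gK by blast
    qed
    thus ?thesis
      by (rule that[OF _ su]) (intro AgC(4,6) evAg[OF hAg] igAg)
  qed
  obtain c where c: "poly w c = 0" using alg_closed_imp_poly_has_root[OF w(1)] by blast
  then obtain w' where w': "w = [:- c, 1:] * w'" by (auto simp: poly_eq_0_iff_dvd dvd_def)
  have hc: "(h - \<kappa> c) * (ev h w' * x) = 1" using w(2) unfolding w' ev_simps(2) by (simp add: ac_simps)
  define e where "e = f - \<kappa> c * g"
  have eA: "e \<in> A" using fA gA const_in_A Ac by (auto simp: e_def)
  have e0: "e \<noteq> 0"
  proof
    assume "e = 0"
    hence "h = \<kappa> c" using gA by (simp add: e_def h_def field_simps)
    thus False using hK by blast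
  qed
  have "\<exists>c' j. e = \<kappa> c' * g ^ j"
  proof -
    have "ev h w' * x \<in> Ag" by (rule AgC(6)[OF evAg[OF hAg] w(3)])
    then obtain a k where ak: "ev h w' * x = a / g ^ k" "a \<in> A" by (auto simp: Ag_def)
    have "h - \<kappa> c = e / g" using gA by (simp add: e_def h_def field_simps)
    hence "e / g * (a / g ^ k) = 1" using hc ak by simp
    hence "e * a = g ^ Suc k" using gA by (simp add: field_simps)
    from divisor_of_prime_power[OF g eA ak(2) this] show ?thesis .
  qed
  then obtain c' j where cj: "e = \<kappa> c' * g ^ j" by blast
  have c'0: "c' \<noteq> 0" using cj e0 by auto
  have j0: "j = 0"
  proof (cases j)
    case (Suc j')
    have "f = g * (\<kappa> c + \<kappa> c' * g ^ j')" using cj Suc by (simp add: e_def algebra_simps)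
    moreover have "\<kappa> c + \<kappa> c' * g ^ j' \<in> A" using const_in_A gA Ac by auto
    ultimately show ?thesis using nd by (auto simp: dvdA_def)
  qed simp
  have igV: "1 / g \<in> V" if V: "V \<in> places" for V
  proof -
    have v: "valring V" using V by (simp add: places_def)
    have "h - \<kappa> c = \<kappa> c' * inverse g" using cj j0 gA by (simp add: e_def h_def field_simps)
    hence "1 / g = (h - \<kappa> c) * \<kappa> (inverse c')" using c'0 by (simp add: \<kappa>_inverse divide_inverse)
    also have "\<dots> \<in> V" unfolding h_def by (intro val_closed(5,6)[OF v] hV[OF V] val_K[OF v])
    finally show ?thesis .
  qed
  have nd1: "\<not> dvdA g 1" using prime_not_dvd_const[OF g, of 1] by auto
  have "b \<in> range (ev g)" if b: "b \<in> A" for b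
  proof -
    obtain l n C where l: "l \<noteq> 0" "n > 0" "(ev g l * b) ^ n = (\<Sum>i<n. ev g (C i) * (ev g l * b) ^ i)"
      using dependent2_integral[OF dep[OF gA(1) b] gK] by metis
    define b1 where "b1 = ev g l * b"
    have b1A: "b1 \<in> A" using ev_in_A[OF gA(1)] b Ac by (auto simp: b1_def)
    \<comment> \<open>The pole order of an integral element is bounded by the degrees in its equation.\<close>
    define m where "m = Max (insert 0 ((\<lambda>i. Polynomial.degree (C i)) ` {..<n}))"
    have m: "Polynomial.degree (C i) \<le> m" if "i < n" for i unfolding m_def using that by (intro Max_ge) auto
    have "b1 / g ^ m \<in> V" if V: "V \<in> places" for V
    proof -
      have v: "valring V" using V by (simp add: places_def)
      note vc = val_closed[OF v]
      have ig: "inverse g \<in> V" using igV[OF V] by (simp add: divide_inverse)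
      have bound: "ev g p * inverse g ^ k \<in> V" if "Polynomial.degree p \<le> k" for p k
        unfolding ev_altdef[OF that] sum_distrib_right
      proof (intro vc(8))
        fix i assume "i \<in> {..k}"
        hence "k = i + (k - i)" by simp
        hence "inverse g ^ k = inverse g ^ i * inverse g ^ (k - i)" by (metis power_add)
        hence "\<kappa> (poly.coeff p i) * g ^ i * inverse g ^ k = \<kappa> (poly.coeff p i) * inverse g ^ (k - i)"
          using gA by (simp add: power_inverse)
        moreover have "\<kappa> (poly.coeff p i) * inverse g ^ (k - i) \<in> V" by (intro vc(6,7) val_K[OF v] ig)
        ultimately show "\<kappa> (poly.coeff p i) * g ^ i * inverse g ^ k \<in> V" by (simp only:)
      qed
      show ?thesis
      proof (rule integrally_closed[OF v])
        show "b1 / g ^ m \<in> M" by (rule AgM[OF AgI[OF b1A]])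
        fix i assume i: "i < n"
        have "m * 1 \<le> m * (n - i)" using i by (intro mult_le_mono2) simp
        hence "Polynomial.degree (C i) \<le> m * (n - i)" using m[OF i] by linarith
        thus "ev g (C i) * inverse g ^ (m * (n - i)) \<in> V" by (rule bound)
      next
        have "(b1 / g ^ m) ^ n = b1 ^ n * inverse g ^ (m * n)"
          by (simp add: divide_inverse power_mult_distrib power_inverse power_mult)
        also have "b1 ^ n = (\<Sum>i<n. ev g (C i) * b1 ^ i)" unfolding b1_def by (rule l(3))
        also have "(\<Sum>i<n. ev g (C i) * b1 ^ i) * inverse g ^ (m * n) = (\<Sum>i<n. ev g (C i) * inverse g ^ (m * (n - i)) * (b1 / g ^ m) ^ i)"
          unfolding sum_distrib_right
        proof (rule sum.cong[OF refl])
          fix i assume "i \<in> {..<n}"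
          hence "m * n = m * (n - i) + m * i" by (simp add: add_mult_distrib2[symmetric])
          hence "inverse g ^ (m * n) = inverse g ^ (m * (n - i)) * (inverse g ^ m) ^ i"
            by (metis power_add power_mult)
          thus "ev g (C i) * b1 ^ i * inverse g ^ (m * n) = ev g (C i) * inverse g ^ (m * (n - i)) * (b1 / g ^ m) ^ i"
            by (simp add: divide_inverse power_mult_distrib power_inverse ac_simps)
        qed
        finally show "(b1 / g ^ m) ^ n = (\<Sum>i<n. ev g (C i) * inverse g ^ (m * (n - i)) * (b1 / g ^ m) ^ i)" .
      qed
    qed
    from reduce[OF AgI[OF b1A] this Ac(2) nd1 igV] obtain p where p: "b1 / g ^ m = ev (inverse g) p"
      by (auto simp: divide_inverse)
    define k where "k = Polynomial.degree p"
    \<comment> \<open>The reciprocal polynomial: \<open>g\<^sup>k\<close> times a polynomial in \<open>1 / g\<close> is a polynomial in \<open>g\<close>.\<close>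
    define q where "q = (\<Sum>i\<le>k. monom (poly.coeff p i) (k - i))"
    have "ev (inverse g) p * g ^ k = ev g q"
    proof -
      have "ev (inverse g) p * g ^ k = (\<Sum>i\<le>k. \<kappa> (poly.coeff p i) * inverse g ^ i * g ^ k)"
        unfolding k_def by (subst ev_altdef[OF order_refl]) (simp add: sum_distrib_right)
      also have "\<dots> = (\<Sum>i\<le>k. \<kappa> (poly.coeff p i) * g ^ (k - i))"
      proof (rule sum.cong[OF refl])
        fix i assume "i \<in> {..k}"
        hence "k = i + (k - i)" by simp
        hence "g ^ k = g ^ i * g ^ (k - i)" by (metis power_add)
        thus "\<kappa> (poly.coeff p i) * inverse g ^ i * g ^ k = \<kappa> (poly.coeff p i) * g ^ (k - i)"
          using gA by (simp add: power_inverse)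
      qed
      finally show ?thesis by (simp add: q_def ev_monom)
    qed
    hence "b1 * g ^ k = ev g q * g ^ m" using p gA by (simp add: field_simps)
    hence "ev g (l * monom 1 k) * b = ev g (q * monom 1 m)" by (simp add: b1_def ev_monom ac_simps)
    moreover have "l * monom 1 k \<noteq> 0" using l(1) by simp
    ultimately obtain R S u v where RS: "R \<noteq> 0" "ev g R * b = ev g S" "u * R + v * S = 1"
      using coprime_relation[OF gK] by metis
    have "ev g u * ev g R + ev g v * ev g S = 1" using arg_cong[OF RS(3), of "ev g"] by simp
    have "ev g R * (ev g u + ev g v * b) = \<kappa> 1"
    proof -
      have "ev g R * (ev g u + ev g v * b) = ev g u * ev g R + ev g v * (ev g R * b)" by (simp add: algebra_simps)
      also have "\<dots> = 1" unfolding RS(2) by (rule \<open>ev g u * ev g R + ev g v * ev g S = 1\<close>)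
      finally show ?thesis by simp
    qed
    moreover have "ev g u + ev g v * b \<in> A" using ev_in_A[OF gA(1)] b Ac by auto
    ultimately have "ev g R \<in> K" using unit_const[OF ev_in_A[OF gA(1)]] by (metis one_neq_zero)
    then obtain c where c: "ev g R = \<kappa> c" by blast
    have c0: "c \<noteq> 0" using c RS(1) gK by (metis ev_eq_0 h_simps(1))
    have "b = \<kappa> (inverse c) * ev g S" using RS(2)[symmetric] c c0 by (simp add: \<kappa>_inverse)
    hence "b = ev g (Polynomial.smult (inverse c) S)" by simp
    thus ?thesis by blast
  qed
  hence "A = range (ev g)" using ev_in_A[OF gA(1)] by blast
  thus ?thesis using gA by blast
qed

end

section \<open>Local nilpotency of the derivation\<close>

instance fract :: ("{idom, ring_char_0}") field_char_0
proof
  show "inj (of_nat :: nat \<Rightarrow> 'a fract)"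
    by (rule injI) (simp add: of_nat_fract eq_fract)
qed

lemma polys_over_range:
  assumes "f 0 = 0" "p \<in> polys_over (range f)"
  shows "\<exists>q. p = map_poly f q"
  using assms(2)
proof (induct p)
  case 0
  show ?case by (intro exI[of _ 0]) simp
next
  case (pCons c p)
  have "c \<in> range f" using polys_over_coeff[OF pCons(3), of 0] by simp
  moreover have "p \<in> polys_over (range f)"
    unfolding polys_over_def using polys_over_coeff[OF pCons(3), of "Suc i" for i] by simp
  ultimately obtain e q where "c = f e" "p = map_poly f q" using pCons(2) by auto
  thus ?case using assms(1) by (intro exI[of _ "pCons e q"]) (simp add: map_poly_pCons)
qed

lemma const_subring: "is_derivation d \<Longrightarrow> is_subring {b. d b = 0}"
  by (auto simp: is_subring_def derivation_rules)

lemma deriv_poly: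
  fixes d :: "'b::idom \<Rightarrow> 'b"
  assumes d: "is_derivation d" and x: "d x = 1" and p: "p \<in> polys_over {b. d b = 0}"
  shows "d (poly p x) = poly (pderiv p) x"
  using p
proof (induct p)
  case (pCons c p)
  have "d c = 0" using polys_over_coeff[OF pCons(3), of 0] by simp
  moreover have "p \<in> polys_over {b. d b = 0}"
    unfolding polys_over_def using polys_over_coeff[OF pCons(3), of "Suc i" for i] by simp
  ultimately show ?case using pCons by (simp add: derivation_rules[OF d] x pderiv_pCons algebra_simps)
qed (simp add: deriv_0[OF d])

text \<open>
  Differentiating a relation for \<open>x\<close> lowers its degree.
\<close>

lemma slice_transcendental:
  fixes d :: "'b::idom \<Rightarrow> 'b"
  assumes d: "is_derivation d" and x: "d x = 1" and char: "\<And>n. of_nat (Suc n) \<noteq> (0::'b)"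
  shows "transcendental {b. d b = 0} x"
proof -
  have "p = 0" if "p \<in> polys_over {b. d b = 0}" "poly p x = 0" for p
    using that
  proof (induct "Polynomial.degree p" arbitrary: p rule: less_induct)
    case less
    show ?case
    proof (cases "Polynomial.degree p")
      case 0
      then obtain c where "p = [:c:]" by (auto elim: degree_eq_zeroE)
      thus ?thesis using less by simp
    next
      case (Suc n)
      have "Polynomial.degree (pderiv p) \<le> n"
        by (rule degree_le) (use Suc in \<open>auto simp: coeff_pderiv coeff_eq_0\<close>)
      moreover have "pderiv p \<in> polys_over {b. d b = 0}"
      proof -
        have "d (of_nat n) = 0" for n by (induct n) (simp_all add: derivation_rules[OF d])
        thus ?thesis using less(2) by (simp add: polys_over_def coeff_pderiv derivation_rules[OF d] del: of_nat_Suc)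
      qed
      moreover have "poly (pderiv p) x = 0" using deriv_poly[OF d x less(2)] less(3) deriv_0[OF d] by simp
      ultimately have "pderiv p = 0" using less(1)[of "pderiv p"] Suc by simp
      hence "poly.coeff (pderiv p) n = 0" by simp
      hence "poly.coeff p (Suc n) = 0" using char[of n] by (simp add: coeff_pderiv del: of_nat_Suc)
      thus ?thesis using Suc by (metis leading_coeff_0_iff)
    qed
  qed
  thus ?thesis by (auto simp: transcendental_def)
qed

lemma poly_map_hom:
  assumes h: "ring_hom_on UNIV h"
  shows "h (poly p v) = poly (map_poly h p) (h v)"
  by (induct p) (use hom_on_closed[OF h subring_UNIV] in \<open>auto simp: map_poly_pCons\<close>)

text \<open>
  The algebra \<open>B\<close> with a surjective derivation, a slice \<open>x\<close> and a non-constant element \<open>a\<close> of the kernel.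
\<close>

locale slice_algebra =
  fixes \<kappa> :: "complex \<Rightarrow> 'b::idom" and D :: "'b \<Rightarrow> 'b" and gs :: "'b list" and x a :: 'b
  assumes \<kappa>: "ring_hom_on UNIV \<kappa>" and \<kappa>_inj: "\<And>c. \<kappa> c = 0 \<Longrightarrow> c = 0"
    and gen: "adjoins (range \<kappa>) gs = UNIV"
    and D: "is_derivation D" and D_\<kappa>: "\<And>c. D (\<kappa> c) = 0" and D_surj: "surj D"
    and Dx: "D x = 1" and Da: "D a = 0" and a: "a \<notin> range \<kappa>"
    and dim: "\<not> 3 \<le> krull_dim (ring_of_type_algebra :: 'b ring)"
begin

abbreviation \<iota> :: "'b \<Rightarrow> 'b fract" where "\<iota> \<equiv> to_fract"

definition evB :: "'b \<Rightarrow> complex poly \<Rightarrow> 'b" where "evB u p = poly (map_poly \<kappa> p) u"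

definition bev :: "'b \<Rightarrow> 'b \<Rightarrow> complex poly poly \<Rightarrow> 'b" where "bev u v P = poly (map_poly (evB u) P) v"

lemmas \<kappa>_simps [simp] = hom_on_closed[OF \<kappa> subring_UNIV, simplified]
lemmas D_simps = derivation_rules[OF D]

lemma \<iota>_hom: "ring_hom_on UNIV \<iota>" by (simp add: ring_hom_on_def)

lemma K_subring: "is_subring (range \<kappa>)" by (rule subring_image[OF \<kappa> subring_UNIV])

lemma inj_\<kappa>: "inj \<kappa>"
  by (rule injI) (metis \<kappa>_inj \<kappa>_simps(6) right_minus_eq)

lemma char_B: "of_nat (Suc n) \<noteq> (0::'b)"
proof
  assume "of_nat (Suc n) = (0::'b)"
  moreover have "of_nat m = \<kappa> (of_nat m)" for m by (induct m) simp_all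
  ultimately have "(of_nat (Suc n) :: complex) = 0" using \<kappa>_inj by metis
  thus False by (simp del: of_nat_Suc)
qed

lemma evB_hom: "ring_hom_on UNIV (evB u)"
proof -
  have "map_poly \<kappa> (p + q) = map_poly \<kappa> p + map_poly \<kappa> q" "map_poly \<kappa> (p * q) = map_poly \<kappa> p * map_poly \<kappa> q" for p q
    using map_poly_hom_on(1,2)[OF \<kappa> subring_UNIV, of p q] by (auto simp: polys_over_def)
  thus ?thesis by (simp add: ring_hom_on_def evB_def one_pCons map_poly_pCons)
qed

lemma bev_hom: "ring_hom_on UNIV (bev u v)"
proof -
  have "map_poly (evB u) (p + q) = map_poly (evB u) p + map_poly (evB u) q"
    "map_poly (evB u) (p * q) = map_poly (evB u) p * map_poly (evB u) q" for p q
    using map_poly_hom_on(1,2)[OF evB_hom subring_UNIV, of p q u] by (auto simp: polys_over_def)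
  thus ?thesis using hom_on_closed[OF evB_hom[of u] subring_UNIV]
    by (simp add: ring_hom_on_def bev_def one_pCons[where 'a="complex poly"] map_poly_pCons)
qed

lemma adjoin_evB: "adjoin (range \<kappa>) u = range (evB u)"
proof
  show "adjoin (range \<kappa>) u \<subseteq> range (evB u)"
  proof
    fix v assume "v \<in> adjoin (range \<kappa>) u"
    then obtain p where p: "p \<in> polys_over (range \<kappa>)" "v = poly p u" by (auto simp: adjoin_def)
    then obtain q where "p = map_poly \<kappa> q" using polys_over_range[of \<kappa> p] by auto
    thus "v \<in> range (evB u)" using p by (auto simp: evB_def)
  qed
  show "range (evB u) \<subseteq> adjoin (range \<kappa>) u"
    unfolding adjoin_def evB_def by (auto simp: polys_over_def coeff_map_poly intro!: imageI)
qed

lemma adjoin_bev: "adjoin (adjoin (range \<kappa>) u) v = range (bev u v)"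
proof
  have z: "evB u 0 = 0" by (simp add: evB_def)
  show "adjoin (adjoin (range \<kappa>) u) v \<subseteq> range (bev u v)"
  proof
    fix w assume "w \<in> adjoin (adjoin (range \<kappa>) u) v"
    hence "w \<in> adjoin (range (evB u)) v" by (simp only: adjoin_evB)
    then obtain p where p: "p \<in> polys_over (range (evB u))" "w = poly p v" unfolding adjoin_def by blast
    then obtain q where "p = map_poly (evB u) q" using polys_over_range[of "evB u" p] z by auto
    thus "w \<in> range (bev u v)" using p by (auto simp: bev_def)
  qed
  show "range (bev u v) \<subseteq> adjoin (adjoin (range \<kappa>) u) v"
    unfolding adjoin_def[of _ v] adjoin_evB bev_def using z by (auto simp: polys_over_def coeff_map_poly intro!: imageI)
qed

sublocale C: const_field "\<lambda>c. \<iota> (\<kappa> c)"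
  by unfold_locales (simp add: ring_hom_on_def)

lemma C_ev_embedded: "C.ev (\<iota> u) p = \<iota> (evB u p)"
  by (induct p) (simp_all add: evB_def map_poly_pCons)

lemma not_const: "u \<notin> range \<kappa> \<Longrightarrow> \<iota> u \<notin> C.K"
  by auto

lemma evB_eq_0: "u \<notin> range \<kappa> \<Longrightarrow> evB u p = 0 \<longleftrightarrow> p = 0"
  using C.ev_eq_0[OF not_const, of u p] by (simp add: C_ev_embedded)

lemma transcendental_over_constants:
  assumes u: "u \<notin> range \<kappa>"
  shows "transcendental (range \<kappa>) u"
  unfolding transcendental_def
proof (intro ballI impI)
  fix p assume p: "p \<in> polys_over (range \<kappa>)" "poly p u = 0"
  then obtain q where q: "p = map_poly \<kappa> q" using polys_over_range[of \<kappa> p] by auto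
  hence "evB u q = 0" using p by (simp add: evB_def)
  thus "p = 0" using q u by (simp add: evB_eq_0)
qed

definition A where "A = {b. D b = 0}"

lemma A_subring: "is_subring A" unfolding A_def by (rule const_subring[OF D])
lemma K_sub_A: "range \<kappa> \<subseteq> A" using D_\<kappa> by (auto simp: A_def)

lemma x_transcendental: "transcendental A x"
  unfolding A_def by (rule slice_transcendental[OF D Dx char_B])

lemma transcendental_mono: "transcendental S t \<Longrightarrow> T \<subseteq> S \<Longrightarrow> transcendental T t"
  unfolding transcendental_def using polys_over_mono by blast

text \<open>
  Otherwise \<open>a\<close>, \<open>x\<close>, \<open>c\<close> would be algebraically independent.
\<close>

lemma algebraic_over_slice: "\<not> transcendental (adjoin (adjoin (range \<kappa>) a) x) c"
proof
  assume c: "transcendental (adjoin (adjoin (range \<kappa>) a) x) c"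
  have "adjoin (range \<kappa>) a \<subseteq> A" using Da by (intro adjoin_least A_subring K_sub_A) (simp add: A_def)
  from transcendental_mono[OF x_transcendental this] c
  have "3 \<le> krull_dim (ring_of_type_algebra :: 'b ring)"
    using three_independent_krull_dim[OF K_subring _ gen transcendental_over_constants[OF a]] inj_\<kappa>
    by (meson finite_imageD infinite_UNIV_char_0)
  thus False using dim by blast
qed

text \<open>
  Otherwise \<open>u\<close>, \<open>v\<close>, \<open>x\<close> would be algebraically independent.
\<close>

lemma kernel_dependent:
  assumes u: "u \<in> A" and v: "v \<in> A"
  shows "C.dependent2 (\<iota> u) (\<iota> v)"
proof (cases "u \<in> range \<kappa>")
  case True
  then obtain c where c: "u = \<kappa> c" by blast
  have "C.ev2 (\<iota> u) (\<iota> v) [:[:- c, 1:]:] = 0" by (simp add: C.ev2_def c)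
  thus ?thesis unfolding C.dependent2_def by (intro exI[of _ "[:[:- c, 1:]:]"]) simp
next
  case False
  let ?U = "adjoin (range \<kappa>) u" and ?V = "adjoin (adjoin (range \<kappa>) u) v"
  have "?U \<subseteq> A" by (rule adjoin_least[OF A_subring K_sub_A u])
  hence "?V \<subseteq> A" by (rule adjoin_least[OF A_subring _ v])
  hence x: "transcendental ?V x" by (rule transcendental_mono[OF x_transcendental])
  have "\<not> transcendental ?U v"
  proof
    assume v: "transcendental ?U v"
    have "infinite (range \<kappa>)" using inj_\<kappa> by (meson finite_imageD infinite_UNIV_char_0)
    from three_independent_krull_dim[OF K_subring this gen transcendental_over_constants[OF False] v x] dim
    show False by blast
  qed
  then obtain p where p: "p \<in> polys_over ?U" "p \<noteq> 0" "poly p v = 0" by (auto simp: transcendental_def)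
  obtain P where P: "p = map_poly (evB u) P"
    using polys_over_range[of "evB u" p] p(1) by (auto simp: adjoin_evB evB_def)
  have "\<iota> (poly p v) = C.ev2 (\<iota> u) (\<iota> v) P"
  proof -
    have "poly p v = (\<Sum>i\<le>Polynomial.degree P. poly.coeff p i * v ^ i)"
    proof -
      have "Polynomial.degree p \<le> Polynomial.degree P"
        unfolding P by (rule degree_le) (simp add: coeff_map_poly evB_def coeff_eq_0)
      thus ?thesis unfolding poly_altdef by (intro sum.mono_neutral_left) (auto simp: not_le coeff_eq_0)
    qed
    also have "\<iota> \<dots> = (\<Sum>i\<le>Polynomial.degree P. \<iota> (poly.coeff p i) * \<iota> v ^ i)"
      using hom_on_closed[OF \<iota>_hom subring_UNIV] by simp
    also have "\<dots> = C.ev2 (\<iota> u) (\<iota> v) P"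
      unfolding C.ev2_def P by (simp add: coeff_map_poly C_ev_embedded evB_def)
    finally show ?thesis .
  qed
  thus ?thesis unfolding C.dependent2_def using p P by (intro exI[of _ P]) auto
qed

definition DL :: "'b fract \<Rightarrow> 'b fract" where "DL = fract_deriv D"

lemma DL: "is_derivation DL" "DL (\<iota> b) = \<iota> (D b)"
  using fract_deriv_derivation[OF D] by (auto simp: DL_def)

lemmas DL_simps = derivation_rules[OF DL(1)]

lemma evB_const: "evB a s \<in> A"
  using adjoin_least[OF A_subring K_sub_A, of a] Da unfolding adjoin_evB A_def by blast

text \<open>
  The embeddings \<open>h0\<close>, \<open>h1\<close> and \<open>h\<close> identify the rational functions in one variable, the polynomials over
  these, and the rational functions in two variables with subrings of \<open>L\<close>, the variables being
  sent to \<open>a\<close> and \<open>x\<close>.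
\<close>

definition h0 :: "complex poly fract \<Rightarrow> 'b fract" where "h0 = fract_hom (\<lambda>s. \<iota> (evB a s))"

lemma \<iota>_evB_hom: "ring_hom_on UNIV (\<lambda>s. \<iota> (evB a s))"
  using hom_on_closed[OF evB_hom[of a] subring_UNIV] by (simp add: ring_hom_on_def)

lemma \<iota>_evB_inj: "\<iota> (evB a s) = 0 \<Longrightarrow> s = 0" using evB_eq_0[OF a] by simp

sublocale H0: field_ext h0
  by unfold_locales (unfold h0_def, rule fract_hom_hom[OF \<iota>_evB_hom \<iota>_evB_inj])

lemma h0_to_fract: "h0 (to_fract s) = \<iota> (evB a s)"
  unfolding h0_def by (rule fract_hom_hom(2)[OF \<iota>_evB_hom \<iota>_evB_inj])

lemma DL_h0: "DL (h0 c) = 0"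
proof (cases c)
  case (Fract p q)
  have "c * to_fract q = to_fract p" using Fract by (simp add: to_fract_def eq_fract)
  hence "h0 c * \<iota> (evB a q) = \<iota> (evB a p)" by (metis H0.h_simps(4) h0_to_fract)
  hence "DL (h0 c * \<iota> (evB a q)) = DL (\<iota> (evB a p))" by simp
  hence "DL (h0 c) * \<iota> (evB a q) = 0" using evB_const by (simp add: DL_simps(2) DL(2) A_def)
  thus ?thesis using \<iota>_evB_inj[of q] Fract by auto
qed

definition h1 :: "complex poly fract poly \<Rightarrow> 'b fract" where "h1 P = poly (map_poly h0 P) (\<iota> x)"

lemma h0_over: "map_poly h0 P \<in> polys_over {v. DL v = 0}"
  by (simp add: polys_over_def H0.map_poly_h DL_h0)

lemma DL_x: "DL (\<iota> x) = 1" by (simp add: DL(2) Dx)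

lemma h1_hom: "ring_hom_on UNIV h1"
  by (simp add: ring_hom_on_def h1_def H0.map_poly_h one_pCons)

lemma h1_inj: "h1 P = 0 \<Longrightarrow> P = 0"
proof -
  have char: "of_nat (Suc n) \<noteq> (0 :: 'b fract)" for n
  proof -
    have "(of_nat m :: 'b fract) = \<iota> (of_nat m)" for m by (induct m) simp_all
    thus ?thesis using char_B[of n] by (simp del: of_nat_Suc)
  qed
  assume "h1 P = 0"
  hence "map_poly h0 P = 0"
    using slice_transcendental[OF DL(1) DL_x char] h0_over by (auto simp: transcendental_def h1_def)
  thus "P = 0" by (simp add: H0.map_poly_h)
qed

lemma DL_h1: "DL (h1 P) = h1 (pderiv P)"
proof -
  have n: "h0 (of_nat m) = of_nat m" for m by (induct m) simp_all
  have "pderiv (map_poly h0 P) = map_poly h0 (pderiv P)"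
    by (rule poly_eqI) (simp add: coeff_pderiv H0.map_poly_h n del: of_nat_Suc)
  thus ?thesis using deriv_poly[OF DL(1) DL_x h0_over] by (simp add: h1_def)
qed

definition h :: "complex poly fract poly fract \<Rightarrow> 'b fract" where "h = fract_hom h1"

sublocale H: field_ext h
  by unfold_locales (unfold h_def, rule fract_hom_hom[OF h1_hom h1_inj])

lemma h_to_fract: "h (to_fract P) = h1 P"
  unfolding h_def by (rule fract_hom_hom(2)[OF h1_hom h1_inj])

lemma DL_h: "DL (h r) = h (fract_deriv pderiv r)"
  by (rule hom_fract_deriv[OF H.hom derivation_pderiv DL(1), symmetric]) (simp add: h_to_fract DL_h1)

lemma h_lift: "h (to_fract (map_poly to_fract P)) = \<iota> (bev a x P)"
proof -
  have "map_poly h0 (map_poly to_fract P) = map_poly (\<lambda>s. \<iota> (evB a s)) P"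
    by (rule poly_eqI) (simp add: coeff_map_poly h0_to_fract evB_def)
  also have "\<dots> = map_poly \<iota> (map_poly (evB a) P)"
    by (rule poly_eqI) (simp add: coeff_map_poly evB_def)
  finally show ?thesis by (simp add: h_to_fract h1_def bev_def poly_map_hom[OF \<iota>_hom])
qed

lemma algebraic_element: "H.algebraic_elem (\<iota> g)"
proof -
  obtain p where p: "p \<in> polys_over (range (bev a x))" "p \<noteq> 0" "poly p g = 0"
    using algebraic_over_slice[of g] by (auto simp: transcendental_def adjoin_bev)
  have z: "bev a x 0 = 0" by (simp add: bev_def)
  obtain P where P: "p = map_poly (bev a x) P" using polys_over_range[OF z p(1)] by blast
  let ?Q = "map_poly (\<lambda>Q. to_fract (map_poly to_fract Q)) P"
  have m: "map_poly h ?Q = map_poly \<iota> p"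
    unfolding P by (rule poly_eqI) (simp add: coeff_map_poly h_lift z)
  have "poly (map_poly h ?Q) (\<iota> g) = 0" unfolding m using p by (simp add: poly_map_hom[OF \<iota>_hom, symmetric])
  moreover have "map_poly \<iota> p \<noteq> 0"
  proof
    assume "map_poly \<iota> p = 0"
    hence "poly.coeff (map_poly \<iota> p) i = 0" for i by simp
    hence "poly.coeff p i = 0" for i by (simp add: coeff_map_poly)
    thus False using p by (simp add: poly_eq_iff)
  qed
  hence "?Q \<noteq> 0" using m by auto
  ultimately show ?thesis unfolding H.algebraic_elem_def by blast
qed

text \<open>
  \<open>B\<close> with the nonzero polynomials in \<open>a\<close> inverted.  The derivation is linear over these
  polynomials, so it remains surjective.
\<close>

definition R where "R = {v. \<exists>s. s \<noteq> 0 \<and> v * \<iota> (evB a s) \<in> range \<iota>}"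

lemma R_I: "s \<noteq> 0 \<Longrightarrow> v * \<iota> (evB a s) = \<iota> b \<Longrightarrow> v \<in> R"
  unfolding R_def by (intro CollectI exI[of _ s]) simp

lemma evB_mult: "evB u (s * t) = evB u s * evB u t"
  using hom_on_mult[OF evB_hom subring_UNIV] by blast

lemma R_subring: "is_subring R"
  unfolding is_subring_def
proof (intro conjI ballI)
  have "evB a 1 = 1" by (rule hom_on_1[OF evB_hom subring_UNIV])
  thus "1 \<in> R" by (intro R_I[of 1 _ 1]) simp_all
  fix v w assume "v \<in> R" "w \<in> R"
  then obtain s t b c where *: "s \<noteq> 0" "t \<noteq> 0" "v * \<iota> (evB a s) = \<iota> b" "w * \<iota> (evB a t) = \<iota> c"
    unfolding R_def by blast
  have "(v - w) * \<iota> (evB a (s * t)) = v * \<iota> (evB a s) * \<iota> (evB a t) - w * \<iota> (evB a t) * \<iota> (evB a s)"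
    by (simp add: evB_mult algebra_simps)
  also have "\<dots> = \<iota> (b * evB a t - c * evB a s)" unfolding * by simp
  finally show "v - w \<in> R" by (rule R_I[rotated]) (use * in simp)
  have "(v * w) * \<iota> (evB a (s * t)) = (v * \<iota> (evB a s)) * (w * \<iota> (evB a t))"
    by (simp add: evB_mult algebra_simps)
  also have "\<dots> = \<iota> (b * c)" unfolding * by simp
  finally show "v * w \<in> R" by (rule R_I[rotated]) (use * in simp)
qed

lemma \<iota>_in_R: "\<iota> b \<in> R"
  using hom_on_1[OF evB_hom subring_UNIV, of a] by (intro R_I[of 1 _ b]) simp_all

lemma h1_in_R: "h1 P \<in> R"
  unfolding h1_def
proof (rule subring_poly[OF R_subring _ \<iota>_in_R])
  have "h0 c \<in> R" for c
  proof (cases c)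
    case (Fract p q)
    have "c * to_fract q = to_fract p" using Fract by (simp add: to_fract_def eq_fract)
    hence "h0 c * \<iota> (evB a q) = \<iota> (evB a p)" by (metis H0.h_simps(4) h0_to_fract)
    thus ?thesis using Fract by (intro R_I[of q])
  qed
  thus "map_poly h0 P \<in> polys_over R" by (simp add: polys_over_def H0.map_poly_h)
qed

lemma R_surj: "r \<in> R \<Longrightarrow> \<exists>s\<in>R. DL s = r"
proof -
  assume "r \<in> R"
  then obtain s b where s: "s \<noteq> 0" "r * \<iota> (evB a s) = \<iota> b" unfolding R_def by blast
  obtain y where y: "D y = b" using D_surj by (metis surjD)
  define v where "v = \<iota> y / \<iota> (evB a s)"
  have nz: "\<iota> (evB a s) \<noteq> 0" using \<iota>_evB_inj s by blast
  have e: "v * \<iota> (evB a s) = \<iota> y" using nz by (simp add: v_def)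
  hence "DL (v * \<iota> (evB a s)) = \<iota> b" by (simp add: DL(2) y)
  hence "DL v * \<iota> (evB a s) = r * \<iota> (evB a s)" using evB_const s by (simp add: DL_simps(2) DL(2) A_def)
  hence "DL v = r" using nz by (metis mult_right_cancel)
  thus ?thesis using R_I[OF s(1) e] by blast
qed

text \<open>
  \<open>B\<close> is generated by finitely many elements that are algebraic over \<open>\<complex>(a, x)\<close>, so it spans a finite-dimensional
  domain over this field, which is all of \<open>L\<close>.  Hence a basis can be chosen in \<open>B\<close>.
\<close>

lemma finite_span: obtains E where "finite E" "H.independent E" "H.span E = UNIV" "E \<subseteq> range \<iota>"
proof -
  obtain E where E: "finite E" "is_subring (H.span E)" "range h \<subseteq> H.span E" "\<iota> ` set gs \<subseteq> H.span E"
    using H.finite_algebra[of "\<iota> ` set gs"] algebraic_element by blast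
  have "is_subring {b. \<iota> b \<in> H.span E}" using subring_closed[OF E(2)] by (simp add: is_subring_def)
  moreover have "range \<kappa> \<subseteq> {b. \<iota> b \<in> H.span E}"
  proof -
    have "\<iota> (\<kappa> c) = h (to_fract (map_poly to_fract [:[:c:]:]))" for c
      unfolding h_lift by (simp add: bev_def evB_def map_poly_pCons)
    thus ?thesis using E(3) by (auto simp only: mem_Collect_eq)
  qed
  ultimately have "adjoins (range \<kappa>) gs \<subseteq> {b. \<iota> b \<in> H.span E}"
    using E(4) by (intro adjoins_least K_subring) auto
  hence all: "range \<iota> \<subseteq> H.span E" using gen by auto
  obtain B where B: "B \<subseteq> range \<iota>" "H.independent B" "range \<iota> \<subseteq> H.span B"
    by (rule H.maximal_independent_subset)
  have fB: "finite B" using H.independent_span_bound[OF E(1) B(2)] B(1) all by blast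
  have mult: "v * w \<in> H.span B" if v: "v \<in> H.span B" and w: "w \<in> H.span B" for v w
  proof -
    have 1: "\<iota> b * w \<in> H.span B" for b
      using w
    proof (induct rule: H.span_induct_alt)
      case (step c u y)
      obtain b' where b': "u = \<iota> b'" using step(1) B(1) by blast
      have "\<iota> b * (h c * u + y) = h c * \<iota> (b * b') + \<iota> b * y" by (simp add: b' algebra_simps)
      moreover have "\<iota> (b * b') \<in> H.span B" using B(3) by blast
      ultimately show ?case using step(2) by (simp only: H.span_add H.span_scale)
    qed (simp add: H.span_zero)
    show ?thesis using v
    proof (induct rule: H.span_induct_alt)
      case (step c u y)
      obtain b' where b': "u = \<iota> b'" using step(1) B(1) by blast
      have "(h c * u + y) * w = h c * (\<iota> b' * w) + y * w" by (simp add: b' algebra_simps)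
      thus ?case using step(2) 1 by (simp only: H.span_add H.span_scale)
    qed (simp add: H.span_zero)
  qed
  have sB: "is_subring (H.span B)"
    unfolding is_subring_def using mult B(3) H.span_diff to_fract_1 by (metis rangeI subsetD)
  have "v \<in> H.span B" for v
  proof (cases v)
    case (Fract p q)
    have "v = \<iota> p * inverse (\<iota> q)" using Fract by (simp add: to_fract_def)
    moreover have "\<iota> p \<in> H.span B" "inverse (\<iota> q) \<in> H.span B"
      using B(3) H.subring_span_inverse[OF fB sB] by blast+
    ultimately show ?thesis using mult by (simp only:)
  qed
  hence "H.span B = UNIV" by blast
  thus ?thesis using that fB B by blast
qed

text \<open>
  The relations over \<open>k[x]\<close> are brought back to \<open>B\<close> by a common denominator \<open>s\<close> from \<open>\<complex>[a]\<close>.  The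
  numerators \<open>g j\<close> have bounded degree in \<open>x\<close>, which is recorded as nilpotency of \<open>D\<close>.
\<close>

lemma monic_relation:
  fixes v :: "nat \<Rightarrow> 'b"
  shows "\<exists>m s n g. D s = 0 \<and> s \<noteq> 0 \<and> s * v m = (\<Sum>j<m. g j * v j) \<and> (\<forall>j<m. \<forall>i>n. (D ^^ i) (g j) = 0)"
proof -
  obtain E where E: "finite E" "H.independent E" "H.span E = UNIV" "E \<subseteq> range \<iota>" by (rule finite_span)
  interpret X: differential_ext h DL E R
    using E \<iota>_in_R R_surj h1_in_R
    by unfold_locales (auto simp: DL DL_h R_subring h_to_fract)
  obtain m p where mp: "\<iota> (v m) = (\<Sum>j<m. h1 (p j) * \<iota> (v j))"
    using X.sequence_dependence[of "\<lambda>j. \<iota> (v j)"] \<iota>_in_R by (auto simp: h_to_fract)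
  have "\<exists>s. s \<noteq> 0 \<and> (\<forall>j<k. \<exists>g. h1 (p j) * \<iota> (evB a s) = \<iota> g)" for k
  proof (induct k)
    case 0
    show ?case by (intro exI[of _ 1]) simp
  next
    case (Suc k)
    then obtain s where s: "s \<noteq> 0" "\<And>j. j < k \<Longrightarrow> \<exists>g. h1 (p j) * \<iota> (evB a s) = \<iota> g" by blast
    obtain t where t: "t \<noteq> 0" "\<exists>g. h1 (p k) * \<iota> (evB a t) = \<iota> g" using h1_in_R[of "p k"] unfolding R_def by blast
    have "\<exists>g. h1 (p j) * \<iota> (evB a (s * t)) = \<iota> g" if j: "j < Suc k" for j
    proof (cases "j = k")
      case True
      obtain g where g: "h1 (p k) * \<iota> (evB a t) = \<iota> g" using t by blast
      have "h1 (p k) * \<iota> (evB a (s * t)) = h1 (p k) * \<iota> (evB a t) * \<iota> (evB a s)" by (simp add: evB_mult ac_simps)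
      also have "\<dots> = \<iota> (g * evB a s)" unfolding g by simp
      finally show ?thesis using True by blast
    next
      case False
      then obtain g where g: "h1 (p j) * \<iota> (evB a s) = \<iota> g" using s(2)[of j] j by auto
      have "h1 (p j) * \<iota> (evB a (s * t)) = h1 (p j) * \<iota> (evB a s) * \<iota> (evB a t)" by (simp add: evB_mult ac_simps)
      also have "\<dots> = \<iota> (g * evB a t)" unfolding g by simp
      finally show ?thesis by blast
    qed
    thus ?case using s t by (intro exI[of _ "s * t"]) simp
  qed
  then obtain s where s: "s \<noteq> 0" "\<forall>j<m. \<exists>g. h1 (p j) * \<iota> (evB a s) = \<iota> g" by blast
  then obtain g where g: "\<And>j. j < m \<Longrightarrow> h1 (p j) * \<iota> (evB a s) = \<iota> (g j)" by metis
  define n where "n = Max (insert 0 ((\<lambda>j. Polynomial.degree (p j)) ` {..<m}))"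
  have it: "(DL ^^ i) (h1 P * \<iota> (evB a s)) = h1 ((pderiv ^^ i) P) * \<iota> (evB a s)" for i P
  proof (induct i)
    case (Suc i)
    have "D (evB a s) = 0" using evB_const by (simp add: A_def)
    thus ?case by (simp add: Suc DL_simps(2) DL_h1 DL(2))
  qed simp
  have itD: "(DL ^^ i) (\<iota> b) = \<iota> ((D ^^ i) b)" for i b by (induct i) (simp_all add: DL)
  have "(D ^^ i) (g j) = 0" if "j < m" "i > n" for i j
  proof -
    have "Polynomial.degree (p j) \<le> n" unfolding n_def using that by (intro Max_ge) auto
    hence "Polynomial.degree (p j) < i" using that by simp
    hence "(pderiv ^^ i) (p j) = 0"
    proof (induct i arbitrary: j)
      case (Suc i)
      have *: "Polynomial.degree ((pderiv ^^ k) q) \<le> Polynomial.degree q - k" for k and q :: "complex poly fract poly"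
        by (induct k) (auto simp: degree_pderiv)
      show ?case
      proof (cases "Polynomial.degree (p j) < i")
        case True
        thus ?thesis using Suc(1)[of j] by simp
      next
        case False
        hence "Polynomial.degree ((pderiv ^^ i) (p j)) = 0" using *[of i "p j"] Suc(2) by simp
        thus ?thesis by (simp add: pderiv_eq_0_iff)
      qed
    qed simp
    hence "\<iota> ((D ^^ i) (g j)) = h1 0 * \<iota> (evB a s)" unfolding itD[symmetric] g[OF that(1), symmetric] it by simp
    thus ?thesis by (simp add: h1_def)
  qed
  moreover have "\<iota> (evB a s * v m) = \<iota> (\<Sum>j<m. g j * v j)"
  proof -
    have "\<iota> (evB a s * v m) = (\<Sum>j<m. h1 (p j) * \<iota> (evB a s) * \<iota> (v j))"
      by (simp add: mp sum_distrib_left ac_simps)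
    also have "\<dots> = (\<Sum>j<m. \<iota> (g j * v j))" by (intro sum.cong) (simp_all add: g)
    finally show ?thesis using hom_on_sum[OF \<iota>_hom subring_UNIV] by simp
  qed
  hence "evB a s * v m = (\<Sum>j<m. g j * v j)" by (simp only: to_fract_eq_iff)
  moreover have "D (evB a s) = 0" "evB a s \<noteq> 0" using evB_const evB_eq_0[OF a] s by (auto simp: A_def)
  ultimately show ?thesis by (intro exI[of _ m] exI[of _ "evB a s"] exI[of _ n] exI[of _ g]) simp
qed

lemma separating_point:
  assumes b: "b \<noteq> 0"
  obtains \<pi> :: "'b \<Rightarrow> complex" where "ring_hom_on UNIV \<pi>" "\<pi> b \<noteq> 0"
proof -
  have "b \<in> adjoins (range \<kappa>) gs" using gen by simp
  from extend_hom_adjoins[OF K_subring this b]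
  obtain s where s: "s \<in> range \<kappa>" "s \<noteq> 0" and ext: "\<And>\<phi> :: 'b \<Rightarrow> complex. ring_hom_on (range \<kappa>) \<phi> \<Longrightarrow> \<phi> s \<noteq> 0 \<Longrightarrow>
      \<exists>\<psi>. ring_hom_on (adjoins (range \<kappa>) gs) \<psi> \<and> (\<forall>a\<in>range \<kappa>. \<psi> a = \<phi> a) \<and> \<psi> b \<noteq> 0" by blast
  have inv: "inv_into UNIV \<kappa> (\<kappa> c) = c" for c using inj_\<kappa> by simp
  have "inv_into UNIV \<kappa> (\<kappa> c + \<kappa> e) = c + e" "inv_into UNIV \<kappa> (\<kappa> c * \<kappa> e) = c * e" for c e
    using inv[of "c + e"] inv[of "c * e"] by simp_all
  hence "ring_hom_on (range \<kappa>) (inv_into UNIV \<kappa>)"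
    using inv[of 1] by (auto simp: ring_hom_on_def inv)
  moreover have "inv_into UNIV \<kappa> s \<noteq> 0" using s inv by auto
  ultimately obtain \<psi> :: "'b \<Rightarrow> complex" where "ring_hom_on (adjoins (range \<kappa>) gs) \<psi>" "\<psi> b \<noteq> 0"
    using ext[of "inv_into UNIV \<kappa>"] by blast
  thus ?thesis using that unfolding gen by blast
qed

text \<open>
  The differential equation and the integral equation for \<open>f\<close> are evaluated at all points where their
  denominators do not vanish; the Nullstellensatz then yields that \<open>D\<^sup>k f\<close> is zero.
\<close>

theorem locally_nilpotent: "\<exists>n. (D ^^ n) f = 0"
proof -
  obtain m s n1 P where ode: "D s = 0" "s \<noteq> 0" "s * (D ^^ m) f = (\<Sum>j<m. P j * (D ^^ j) f)"
    and P: "\<And>j i. j < m \<Longrightarrow> i > n1 \<Longrightarrow> (D ^^ i) (P j) = 0"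
    using monic_relation[of "\<lambda>j. (D ^^ j) f"] by blast
  obtain N t n2 Q where int: "D t = 0" "t \<noteq> 0" "t * f ^ N = (\<Sum>j<N. Q j * f ^ j)"
    and Q: "\<And>j i. j < N \<Longrightarrow> i > n2 \<Longrightarrow> (D ^^ i) (Q j) = 0"
    using monic_relation[of "\<lambda>j. f ^ j"] by blast
  define k where "k = Suc (max n1 n2)"
  have "(D ^^ k) f = 0"
  proof (rule ccontr)
    assume "(D ^^ k) f \<noteq> 0"
    hence "s * t * (D ^^ k) f \<noteq> 0" using ode int by simp
    then obtain \<pi> :: "'b \<Rightarrow> complex" where \<pi>: "ring_hom_on UNIV \<pi>" "\<pi> (s * t * (D ^^ k) f) \<noteq> 0"
      by (rule separating_point)
    have nz: "\<pi> s \<noteq> 0" "\<pi> t \<noteq> 0" "\<pi> ((D ^^ k) f) \<noteq> 0"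
      using \<pi>(2) hom_on_mult[OF \<pi>(1) subring_UNIV] by auto
    have "\<pi> ((D ^^ k) f) = 0"
      by (rule integral_ode_vanishing[OF \<pi>(1) D ode(1) nz(1) int(1) nz(2) _ _ ode(3) int(3), of "max n1 n2"])
        (use P Q in \<open>auto simp: k_def\<close>)
    thus False using nz by simp
  qed
  thus ?thesis by blast
qed

end

section \<open>The slice theorem and the polynomial ring\<close>

context slice_algebra
begin

text \<open>
  In characteristic zero \<open>A[x]\<close> contains an antiderivative of each of its elements, and two
  antiderivatives differ by an element of \<open>A\<close>.  So local nilpotency implies the claim by induction.
\<close>

lemma slice_generates: "adjoin A x = UNIV"
proof -
  note Ax = adjoin_subring[OF A_subring, of x]
  have anti: "\<exists>g\<in>adjoin A x. D g = u" if u: "u \<in> adjoin A x" for u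
  proof -
    obtain p where p: "p \<in> polys_over A" "u = poly p x" using u by (auto simp: adjoin_def)
    define g where "g = (\<Sum>i\<le>Polynomial.degree p. \<kappa> (1 / of_nat (Suc i)) * poly.coeff p i * x ^ Suc i)"
    have "\<kappa> c \<in> adjoin A x" "poly.coeff p i \<in> adjoin A x" for c i
      using Ax(2) K_sub_A polys_over_coeff[OF p(1)] by auto
    hence "g \<in> adjoin A x" unfolding g_def
      by (intro subring_sum[OF Ax(1)] subring_mult[OF Ax(1)] subring_power[OF Ax(1)] Ax(3))
    moreover have "D g = u"
    proof -
      have antideriv: "D (\<kappa> (1 / of_nat (Suc i)) * poly.coeff p i * x ^ Suc i) = poly.coeff p i * x ^ i" for i
      proof -
        define c where "c = \<kappa> (1 / of_nat (Suc i)) * poly.coeff p i"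
        have c: "D c = 0"
          using polys_over_coeff[OF p(1), of i] unfolding c_def by (simp add: D_simps(2) D_\<kappa> A_def)
        have "D (c * x ^ Suc i) = c * D (x ^ Suc i)" by (simp only: deriv_mult[OF D] c mult_zero_left add_0_left)
        also have "D (x ^ Suc i) = of_nat (Suc i) * x ^ i"
          unfolding deriv_power[OF D, of x "Suc i"] Dx by (simp del: of_nat_Suc)
        finally have "D (c * x ^ Suc i) = \<kappa> (1 / of_nat (Suc i)) * of_nat (Suc i) * (poly.coeff p i * x ^ i)"
          unfolding c_def by (simp only: ac_simps)
        also have "\<kappa> (1 / of_nat (Suc i)) * of_nat (Suc i) = 1"
        proof -
          have "(of_nat m :: 'b) = \<kappa> (of_nat m)" for m by (induct m) simp_all
          hence "\<kappa> (1 / of_nat (Suc i)) * of_nat (Suc i) = \<kappa> (1 / of_nat (Suc i) * of_nat (Suc i))"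
            by (metis \<kappa>_simps(4))
          also have "1 / of_nat (Suc i) * of_nat (Suc i) = (1 :: complex)" by (simp del: of_nat_Suc)
          finally show ?thesis by simp
        qed
        finally show ?thesis by (simp only: c_def mult_1_left)
      qed
      show ?thesis unfolding g_def deriv_sum[OF D] antideriv p(2) poly_altdef ..
    qed
    ultimately show ?thesis by blast
  qed
  have "f \<in> adjoin A x" if "(D ^^ n) f = 0" for n f
    using that
  proof (induct n arbitrary: f)
    case 0
    thus ?case using subring_0[OF Ax(1)] by simp
  next
    case (Suc n)
    have "(D ^^ n) (D f) = 0" using Suc(2) by (simp add: funpow_swap1)
    hence "D f \<in> adjoin A x" by (rule Suc(1))
    then obtain g where g: "g \<in> adjoin A x" "D g = D f" using anti by blast
    have "f - g \<in> A" using g by (simp add: A_def D_simps)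
    hence "f - g + g \<in> adjoin A x" using Ax g by (intro subring_add[OF Ax(1)]) auto
    thus ?case by simp
  qed
  thus ?thesis using locally_nilpotent by blast
qed

lemma nilpotency_index:
  assumes "u \<noteq> 0"
  obtains n where "(D ^^ n) u \<noteq> 0" "\<And>k. k > n \<Longrightarrow> (D ^^ k) u = 0"
proof -
  define n where "n = (LEAST n. (D ^^ n) u = 0)"
  have n: "(D ^^ n) u = 0" unfolding n_def using locally_nilpotent by (rule LeastI_ex)
  then obtain m where m: "n = Suc m" using assms by (cases n) auto
  have "(D ^^ m) u \<noteq> 0" using not_less_Least[of m "\<lambda>n. (D ^^ n) u = 0"] m by (simp add: n_def)
  moreover have "(D ^^ k) u = 0" if "k > m" for k
  proof -
    have "k = (k - n) + n" using that m by simp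
    hence "(D ^^ k) u = (D ^^ (k - n)) ((D ^^ n) u)" by (metis funpow_add comp_apply)
    also have "(D ^^ j) 0 = 0" for j by (induct j) (simp_all add: D_simps)
    hence "(D ^^ (k - n)) ((D ^^ n) u) = 0" unfolding n by blast
    finally show ?thesis .
  qed
  ultimately show ?thesis using that by blast
qed

text \<open>
  The nilpotency index behaves like a degree: the top derivatives of \<open>u\<close> and \<open>v\<close> multiply to the top
  derivative of \<open>u v\<close>, up to a binomial coefficient.
\<close>

lemma kernel_factorially_closed:
  assumes uv: "u * v \<in> A" "u * v \<noteq> 0"
  shows "u \<in> A"
proof -
  have nz: "u \<noteq> 0" "v \<noteq> 0" using uv by auto
  obtain n where n: "(D ^^ n) u \<noteq> 0" "\<And>k. k > n \<Longrightarrow> (D ^^ k) u = 0" using nilpotency_index[OF nz(1)] by blast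
  obtain m where m: "(D ^^ m) v \<noteq> 0" "\<And>k. k > m \<Longrightarrow> (D ^^ k) v = 0" using nilpotency_index[OF nz(2)] by blast
  have "(D ^^ (n + m)) (u * v) = (\<Sum>i\<le>n + m. of_nat (n + m choose i) * (D ^^ i) u * (D ^^ (n + m - i)) v)"
    by (rule iterated_derivation_mult[OF D])
  also have "\<dots> = (\<Sum>i\<in>{n}. of_nat (n + m choose i) * (D ^^ i) u * (D ^^ (n + m - i)) v)"
  proof (rule sum.mono_neutral_right)
    show "\<forall>i\<in>{..n + m} - {n}. of_nat (n + m choose i) * (D ^^ i) u * (D ^^ (n + m - i)) v = 0"
    proof
      fix i assume "i \<in> {..n + m} - {n}"
      hence "i > n \<or> n + m - i > m" by auto
      thus "of_nat (n + m choose i) * (D ^^ i) u * (D ^^ (n + m - i)) v = 0" using n(2) m(2) by auto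
    qed
  qed auto
  finally have e: "(D ^^ (n + m)) (u * v) = of_nat (n + m choose n) * (D ^^ n) u * (D ^^ m) v" by simp
  obtain c where "n + m choose n = Suc c" 
    by (metis binomial_eq_0_iff le_add1 not0_implies_Suc not_less)
  hence "(D ^^ (n + m)) (u * v) \<noteq> 0" using e char_B n m by (simp del: of_nat_Suc)
  moreover have "(D ^^ Suc k) (u * v) = 0" for k
  proof -
    have "(D ^^ k) (D (u * v)) = 0"
      using uv(1) by (induct k) (simp_all add: A_def D_simps)
    thus ?thesis by (simp add: funpow_swap1)
  qed
  ultimately have "n + m = 0" by (metis not0_implies_Suc)
  hence "D u = 0" using n(2)[of 1] by simp
  thus ?thesis by (simp add: A_def)
qed

text \<open>
  The substitution \<open>x = 0\<close> retracts \<open>B = A[x]\<close> onto \<open>A\<close>.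
\<close>

lemma kernel_finitely_generated:
  obtains hs where "A = adjoins (range \<kappa>) hs"
proof -
  have id: "ring_hom_on A (\<lambda>b. b)" by (simp add: ring_hom_on_def)
  have mid: "map_poly (\<lambda>b. b) p = p" for p :: "'b poly" by (simp add: map_poly_idI)
  have "poly (map_poly (\<lambda>b. b) p) 0 = 0" if "p \<in> polys_over A" "poly p x = 0" for p
    using x_transcendental that by (auto simp: transcendental_def)
  from extend_hom_eval[OF id A_subring this] obtain \<rho> where \<rho>: "ring_hom_on (adjoin A x) \<rho>"
    "\<And>b. b \<in> A \<Longrightarrow> \<rho> b = b" "\<And>p. p \<in> polys_over A \<Longrightarrow> \<rho> (poly p x) = poly (map_poly (\<lambda>b. b) p) 0" by metis
  have h: "ring_hom_on UNIV \<rho>" using \<rho>(1) unfolding slice_generates .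
  have in_A: "\<rho> b \<in> A" for b
  proof -
    have "b \<in> adjoin A x" using slice_generates by simp
    then obtain p where "p \<in> polys_over A" "b = poly p x" by (auto simp: adjoin_def)
    thus ?thesis using \<rho>(3) polys_over_coeff[of p A 0] by (simp add: mid poly_0_coeff_0)
  qed
  have "\<rho> (\<kappa> c) = \<kappa> c" for c using \<rho>(2) K_sub_A by blast
  hence \<rho>K: "\<rho> ` range \<kappa> = range \<kappa>" by (simp add: image_image)
  have "A \<subseteq> adjoins (range \<kappa>) (map \<rho> gs)"
  proof
    fix b assume "b \<in> A"
    hence "b \<in> \<rho> ` adjoins (range \<kappa>) gs" using \<rho>(2) gen by (metis UNIV_I imageI)
    thus "b \<in> adjoins (range \<kappa>) (map \<rho> gs)" using adjoins_image_subset[OF h K_subring, of gs] unfolding \<rho>K by blast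
  qed
  moreover have "adjoins (range \<kappa>) (map \<rho> gs) \<subseteq> A"
    by (rule adjoins_least[OF K_subring A_subring K_sub_A]) (use in_A in auto)
  ultimately show ?thesis using that by blast
qed

text \<open>
  As factors of elements of \<open>A\<close> lie in \<open>A\<close>, prime factors and units in \<open>B\<close> of elements of \<open>A\<close> are the
  prime factors and units in \<open>A\<close>, and the result on affine curves applies.
\<close>

lemma kernel_is_line:
  assumes units: "\<And>b. b dvd 1 \<Longrightarrow> b \<in> range \<kappa>"
    and primes: "\<And>b :: 'b. b \<noteq> 0 \<Longrightarrow> \<not> b dvd 1 \<Longrightarrow> \<exists>p. prime_elem p \<and> p dvd b"
  obtains y where "y \<in> A" "A = range (evB y)"
proof -
  obtain hs where hs: "A = adjoins (range \<kappa>) hs" by (rule kernel_finitely_generated)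
  have imA: "\<iota> ` A = adjoins C.K (map \<iota> hs)"
  proof
    have K: "\<iota> ` range \<kappa> = C.K" by auto
    show "\<iota> ` A \<subseteq> adjoins C.K (map \<iota> hs)" using adjoins_image_subset[OF \<iota>_hom K_subring, of hs] unfolding K hs .
    have "set hs \<subseteq> A" using adjoins_subring[OF K_subring, of hs] hs by simp
    thus "adjoins C.K (map \<iota> hs) \<subseteq> \<iota> ` A"
      using K_sub_A by (intro adjoins_least C.K_subring subring_image[OF \<iota>_hom A_subring]) auto
  qed
  have imD: "\<iota> u \<in> \<iota> ` A \<longleftrightarrow> u \<in> A" for u by auto
  interpret X: affine_curve "\<lambda>c. \<iota> (\<kappa> c)" "\<iota> ` A" "map \<iota> hs"
  proof
    show "is_subring (\<iota> ` A)" by (rule subring_image[OF \<iota>_hom A_subring])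
    show "C.K \<subseteq> \<iota> ` A" using K_sub_A by auto
    show "\<iota> ` A = adjoins C.K (map \<iota> hs)" by (rule imA)
    show "C.dependent2 u v" if "u \<in> \<iota> ` A" "v \<in> \<iota> ` A" for u v using that kernel_dependent by auto
    show "u \<in> C.K" if u: "u \<in> \<iota> ` A" "u \<noteq> 0" "inverse u \<in> \<iota> ` A" for u
    proof -
      obtain b c where bc: "u = \<iota> b" "inverse u = \<iota> c" using u by blast
      have "\<iota> (b * c) = \<iota> 1" using bc u(2) by (metis right_inverse to_fract_1 to_fract_mult)
      hence "b * c = 1" by (simp only: to_fract_eq_iff)
      hence "b dvd 1" by (metis dvd_triv_left)
      thus ?thesis using units bc by blast
    qed
  qed
  have dvd: "X.dvdA (\<iota> p) (\<iota> b) \<longleftrightarrow> p dvd b" if b: "p \<in> A" "b \<in> A" for p b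
  proof
    assume "X.dvdA (\<iota> p) (\<iota> b)"
    then obtain q where "\<iota> b = \<iota> p * \<iota> q" by (auto simp: X.dvdA_def)
    hence "\<iota> b = \<iota> (p * q)" by simp
    thus "p dvd b" unfolding to_fract_eq_iff by simp
  next
    assume "p dvd b"
    then obtain q where q: "b = p * q" by auto
    show "X.dvdA (\<iota> p) (\<iota> b)"
    proof (cases "b = 0")
      case True
      have "\<iota> 0 \<in> \<iota> ` A" using subring_0[OF A_subring] by blast
      thus ?thesis unfolding X.dvdA_def using True by (intro bexI[of _ "\<iota> 0"]) auto
    next
      case False
      have "q * p \<in> A" "q * p \<noteq> 0" using False q b by (auto simp: mult.commute)
      hence "q \<in> A" by (rule kernel_factorially_closed)
      thus ?thesis unfolding X.dvdA_def q by (intro bexI[of _ "\<iota> q"]) auto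
    qed
  qed
  have "\<exists>f. X.primeA f \<and> X.dvdA f u" if u: "u \<in> \<iota> ` A" "u \<notin> C.K" for u
  proof -
    obtain b where b: "u = \<iota> b" "b \<in> A" using u by blast
    have "b \<notin> range \<kappa>" using u b by auto
    hence nu: "\<not> b dvd 1" using units by blast
    have b0: "b \<noteq> 0" using \<open>b \<notin> range \<kappa>\<close> by (metis \<kappa>_simps(1) rangeI)
    obtain p where p: "prime_elem p" "p dvd b" using primes[OF b0 nu] by blast
    then obtain q where q: "b = p * q" by auto
    have pA: "p \<in> A" by (rule kernel_factorially_closed[of p q]) (use b b0 q in auto)
    have "X.primeA (\<iota> p)" unfolding X.primeA_def
    proof (intro conjI ballI impI)
      show "\<iota> p \<in> \<iota> ` A" using pA by blast
      show "\<iota> p \<noteq> 0" using p by auto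
      show "\<iota> p \<notin> C.K"
      proof
        assume "\<iota> p \<in> C.K"
        then obtain c where c: "p = \<kappa> c" by auto
        hence "c \<noteq> 0" using p by auto
        hence "p * \<kappa> (inverse c) = \<kappa> 1" unfolding c \<kappa>_simps(4)[symmetric] by simp
        hence "p dvd 1" by (metis \<kappa>_simps(2) dvd_triv_left)
        thus False using p by (simp add: prime_elem_def)
      qed
      fix v w assume vw: "v \<in> \<iota> ` A" "w \<in> \<iota> ` A" "X.dvdA (\<iota> p) (v * w)"
      then obtain c e where ce: "v = \<iota> c" "w = \<iota> e" "c \<in> A" "e \<in> A" by blast
      have "c * e \<in> A" using ce subring_mult[OF A_subring] by blast
      hence "p dvd c * e" using vw(3) dvd[OF pA, of "c * e"] ce by simp
      hence "p dvd c \<or> p dvd e" using p by (simp add: prime_elem_dvd_mult_iff)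
      thus "X.dvdA (\<iota> p) v \<or> X.dvdA (\<iota> p) w" using dvd[OF pA] ce by blast
    qed
    thus ?thesis using dvd[OF pA b(2)] p b by blast
  qed
  moreover have "\<iota> a \<in> \<iota> ` A" "\<iota> a \<notin> C.K" using a Da by (auto simp: A_def)
  ultimately obtain g where g: "g \<in> \<iota> ` A" "\<iota> ` A = range (C.ev g)" using X.affine_curve_is_line by blast
  then obtain y where y: "y \<in> A" "g = \<iota> y" by blast
  have "\<iota> ` A = \<iota> ` range (evB y)" using g(2) unfolding y(2) C_ev_embedded[abs_def] by (simp add: image_image)
  moreover have "inj \<iota>" by (rule injI) simp
  ultimately have "A = range (evB y)" by (simp only: inj_image_eq_iff)
  thus ?thesis using that y by blast
qed

theorem polynomial_ring:
  assumes units: "\<And>b. b dvd 1 \<Longrightarrow> b \<in> range \<kappa>"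
    and primes: "\<And>b :: 'b. b \<noteq> 0 \<Longrightarrow> \<not> b dvd 1 \<Longrightarrow> \<exists>p. prime_elem p \<and> p dvd b"
  obtains y where "bij (bev y x)" "\<And>P. D (bev y x P) = bev y x (pderiv P)"
proof -
  obtain y where y: "y \<in> A" "A = range (evB y)" by (rule kernel_is_line[OF units primes])
  have "y \<notin> range \<kappa>"
  proof
    assume "y \<in> range \<kappa>"
    hence "adjoin (range \<kappa>) y \<subseteq> range \<kappa>" by (intro adjoin_least K_subring) auto
    thus False using a Da y(2) unfolding adjoin_evB A_def by blast
  qed
  note inj_ev = evB_eq_0[OF this]
  have over: "map_poly (evB y) P \<in> polys_over A" for P
    using y(2) by (simp add: polys_over_def coeff_map_poly evB_def)
  have "P = 0" if "bev y x P = 0" for P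
  proof -
    have "map_poly (evB y) P = 0" using x_transcendental over that by (auto simp: transcendental_def bev_def)
    hence "evB y (poly.coeff P i) = 0" for i by (metis coeff_0 coeff_map_poly inj_ev)
    thus ?thesis by (simp add: inj_ev poly_eq_iff)
  qed
  moreover note H = hom_on_closed[OF bev_hom[of y x] subring_UNIV]
  ultimately have "inj (bev y x)" by (intro injI) (metis UNIV_I right_minus_eq)
  moreover have "range (bev y x) = UNIV"
    using slice_generates unfolding y(2) adjoin_evB[symmetric] adjoin_bev .
  ultimately have "bij (bev y x)" by (simp add: bij_def)
  moreover have "D (bev y x P) = bev y x (pderiv P)" for P
  proof -
    have n: "evB y (of_nat m) = of_nat m" for m
      by (induct m) (simp_all add: hom_on_closed[OF evB_hom subring_UNIV])
    have "pderiv (map_poly (evB y) P) = map_poly (evB y) (pderiv P)"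
      by (rule poly_eqI) (simp add: coeff_pderiv coeff_map_poly n hom_on_closed[OF evB_hom subring_UNIV] del: of_nat_Suc)
    thus ?thesis using deriv_poly[OF D Dx] over unfolding bev_def A_def by metis
  qed
  ultimately show ?thesis using that by blast
qed

end

section \<open>Surjective derivations of factorial affine surfaces\<close>

lemma factorial_prime_divisor:
  fixes b :: "'b::idom"
  assumes f: "factorial_domain (ring_of_type_algebra :: 'b ring)" and b: "b \<noteq> 0" "\<not> b dvd 1"
  shows "\<exists>p. prime_elem p \<and> p dvd b"
proof -
  let ?R = "ring_of_type_algebra :: 'b ring" and ?M = "mult_of (ring_of_type_algebra :: 'b ring)"
  interpret F: factorial_domain ?R by (rule f)
  have carr: "carrier ?M = UNIV - {0}" and mul: "\<And>u v. u \<otimes>\<^bsub>?M\<^esub> v = u * v" and one: "\<one>\<^bsub>?M\<^esub> = 1"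
    by (simp_all add: ring_of_type_algebra_def mult_of_def)
  have un: "u \<in> Units ?M \<longleftrightarrow> u \<noteq> 0 \<and> u dvd 1" for u
    unfolding Units_def carr mul one dvd_def by (auto simp: mult.commute)
  have "b \<in> carrier ?M" using b carr by blast
  moreover have "b \<notin> Units ?M" using un[of b] b by blast
  ultimately obtain fs where fs: "set fs \<subseteq> carrier ?M" "factors ?M fs b" using F.factors_exist by blast
  show ?thesis
  proof (cases fs)
    case Nil
    hence "b = 1" using fs(2) by (simp add: factors_def ring_of_type_algebra_def)
    thus ?thesis using b by simp
  next
    case (Cons p ps)
    have p: "p \<in> carrier ?M" "Divisibility.irreducible ?M p" using fs Cons by (auto simp: factors_def)
    have "Divisibility.prime ?M p" by (rule F.irreducible_prime[OF p(2,1)])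
    moreover have dv: "p divides\<^bsub>?M\<^esub> u \<longleftrightarrow> p dvd u" if "u \<noteq> 0" for u
      unfolding factor_def carr mul dvd_def using that by auto
    ultimately have pr: "\<not> p dvd 1" "\<And>u v. u \<noteq> 0 \<Longrightarrow> v \<noteq> 0 \<Longrightarrow> p dvd u * v \<Longrightarrow> p dvd u \<or> p dvd v"
      using p(1) unfolding Divisibility.prime_def un carr mul by (blast, metis DiffI UNIV_I mult_eq_0_iff singletonD)
    have p0: "p \<noteq> 0" using p(1) carr by auto
    have "p dvd b" using fs(2) Cons by (auto simp: factors_def ring_of_type_algebra_def)
    moreover have "prime_elem p" unfolding prime_elem_def using p0 pr by (metis dvd_0_right mult_eq_0_iff)
    ultimately show ?thesis by blast
  qed
qed

theorem theorem2p3: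
  fixes scale :: "complex \<Rightarrow> 'b::idom \<Rightarrow> 'b"
    and D :: "'b \<Rightarrow> 'b"
  assumes "complex_algebra scale"
    and "complex_algebra.finitely_generated scale"
    and "factorial_domain (ring_of_type_algebra :: 'b ring)"
    and "krull_dim (ring_of_type_algebra :: 'b ring) = 2"
    and "{b :: 'b. b dvd 1} = complex_algebra.constants scale - {0}"
    and "complex_algebra.derivation scale D"
    and "surj D"
    and "complex_algebra.constants scale \<subset> {b. D b = 0}"
  shows "\<exists>\<phi> :: 'b \<Rightarrow> complex poly poly.
           algebra_iso scale scale_xy \<phi> \<and> (\<forall>b. \<phi> (D b) = pderiv (\<phi> b))"
proof -
  interpret B: complex_algebra scale by (rule assms(1))
  define \<kappa> where "\<kappa> c = scale c 1" for c
  have sc: "scale c b = \<kappa> c * b" for c b using B.scale_mult[of c 1 b] by (simp add: \<kappa>_def)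
  have \<kappa>_hom: "ring_hom_on UNIV \<kappa>"
    unfolding ring_hom_on_def
  proof (intro conjI ballI)
    show "\<kappa> 1 = 1" by (simp add: \<kappa>_def)
    fix c e
    show "\<kappa> (c + e) = \<kappa> c + \<kappa> e" by (simp add: \<kappa>_def B.scale_left_distrib)
    show "\<kappa> (c * e) = \<kappa> c * \<kappa> e" unfolding sc[symmetric] by (simp add: \<kappa>_def)
  qed
  have constants_range: "B.constants = range \<kappa>" by (auto simp: B.constants_def \<kappa>_def)
  have \<kappa>_inj: "c = 0" if "\<kappa> c = 0" for c using that by (simp add: \<kappa>_def)
  have lin: "Vector_Spaces.linear scale scale D" and leib: "\<And>a b. D (a * b) = D a * b + a * D b"
    using assms(6) by (auto simp: B.derivation_def)
  interpret L: Vector_Spaces.linear scale scale D by (rule lin)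
  have der: "is_derivation D" by (simp add: is_derivation_def L.add leib)
  have D\<kappa>: "D (\<kappa> c) = 0" for c using assms(8) unfolding constants_range by blast
  have K: "is_subring (range \<kappa>)" by (rule subring_image[OF \<kappa>_hom subring_UNIV])
  obtain S where S: "finite S" "B.subalgebra hull S = UNIV" using assms(2) by (auto simp: B.finitely_generated_def)
  obtain gs where gs: "set gs = S" using finite_list[OF S(1)] by blast
  have gen: "adjoins (range \<kappa>) gs = UNIV"
  proof -
    note T = adjoins_subring[OF K, of gs]
    hence sr: "is_subring (adjoins (range \<kappa>) gs)" by blast
    have "B.subalgebra (adjoins (range \<kappa>) gs)"
      unfolding B.subalgebra_def B.subspace_def sc
      using T subring_closed[OF sr] by (auto simp: subset_iff)
    hence "B.subalgebra hull S \<subseteq> adjoins (range \<kappa>) gs" using T gs by (intro hull_minimal) auto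
    thus ?thesis using S by blast
  qed
  obtain x where x: "D x = 1" using assms(7) by (metis surjD)
  obtain a where a: "D a = 0" "a \<notin> range \<kappa>" using assms(8) unfolding constants_range by blast
  interpret S: slice_algebra \<kappa> D gs x a
  proof
    show "\<not> 3 \<le> krull_dim (ring_of_type_algebra :: 'b ring)" unfolding assms(4) by simp
  qed (use \<kappa>_hom \<kappa>_inj gen der D\<kappa> assms(7) x a in auto)
  have units: "b \<in> range \<kappa>" if "b dvd 1" for b using assms(5) that unfolding constants_range by blast
  obtain y where bij: "bij (S.bev y x)" and Dy: "\<And>P. D (S.bev y x P) = S.bev y x (pderiv P)"
    using S.polynomial_ring[OF units factorial_prime_divisor[OF assms(3)]] by blast
  define \<Psi> where "\<Psi> = S.bev y x"
  define \<phi> where "\<phi> = inv_into UNIV \<Psi>"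
  have \<Psi>\<phi>: "\<Psi> (\<phi> b) = b" for b unfolding \<phi>_def using bij by (simp add: \<Psi>_def bij_is_surj surj_f_inv_f)
  have \<phi>I: "\<phi> b = P" if "\<Psi> P = b" for b P unfolding \<phi>_def using bij that by (auto simp: \<Psi>_def bij_is_inj)
  note \<Psi> = hom_on_closed[OF S.bev_hom[of y x] subring_UNIV, folded \<Psi>_def]
  have \<Psi>_scale: "\<Psi> (scale_xy c P) = scale c (\<Psi> P)" for c P
  proof -
    have "scale_xy c P = [:[:c:]:] * P" by (simp add: scale_xy_def)
    moreover have "\<Psi> [:[:c:]:] = \<kappa> c" by (simp add: \<Psi>_def S.bev_def S.evB_def map_poly_pCons)
    ultimately show ?thesis using \<Psi>(4) by (simp only: sc UNIV_I)
  qed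
  interpret XY: complex_algebra scale_xy by (rule complex_algebra_xy)
  have "Vector_Spaces.linear scale scale_xy \<phi>"
  proof (intro Vector_Spaces.linear.intro module_hom.intro module_hom_axioms.intro
      B.vector_space_axioms XY.vector_space_axioms B.module_axioms XY.module_axioms)
    show "\<phi> (b + c) = \<phi> b + \<phi> c" for b c by (rule \<phi>I) (simp add: \<Psi> \<Psi>\<phi>)
    show "\<phi> (scale r b) = scale_xy r (\<phi> b)" for r b by (rule \<phi>I) (simp add: \<Psi>_scale \<Psi>\<phi>)
  qed
  moreover have "\<phi> 1 = 1" by (rule \<phi>I) (rule \<Psi>)
  moreover have "\<phi> (b * c) = \<phi> b * \<phi> c" for b c by (rule \<phi>I) (simp add: \<Psi> \<Psi>\<phi>)
  moreover have "bij \<phi>" unfolding \<phi>_def by (rule bij_imp_bij_inv) (use bij in \<open>simp add: \<Psi>_def\<close>)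
  ultimately have "algebra_iso scale scale_xy \<phi>" by (simp add: algebra_iso_def)
  moreover have "\<phi> (D b) = pderiv (\<phi> b)" for b
  proof (rule \<phi>I)
    show "\<Psi> (pderiv (\<phi> b)) = D b" using Dy[of "\<phi> b"] \<Psi>\<phi>[of b] by (simp add: \<Psi>_def)
  qed
  ultimately show ?thesis by blast
qed

end
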